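(* Fix parameters of the Hidden-Matching game as described in the context (a constant $\delta\in(0,1)$, integers $k,n_1$, a $(2n_1)$-vertex $(r_1,t_1)$-RS graph $G^{RS}_1$ and a $(2n_2)$-vertex $(r_2,t_2)$-RS graph $G^{RS}_2$ with $r_2=(k+\delta)n_1$). Any protocol $\pi$ (deterministic or randomized) for the Hidden-Matching game with communication cost \[ \mathsf{C}(\pi) = \min\{ o(t_2 \cdot r_2^{1-2/k}),\ o(t_1\cdot r_1)\} \] can only have value $\mathrm{val}(\pi) = o(r_1)$.
   Context: RS graphs. A bipartite graph $G=(L,R,E)$ with $|L|=|R|=n$ is called $(2n)$-vertex. A matching is induced if the subgraph induced on its vertices is the matching itself. A bipartite graph is an $(r,t)$-RS graph if its edges are partitioned into $t$ induced matchings $M_1,\dots,M_t$, each of size $r$; we fix an ordering $e_{1,j},\dots,e_{r,j}$ of the edges of each $M_j$. For a matching $M$ and vertex $u$, $M(u)$ is the partner of $u$ in $M$. Encoded-RS graph. For an $(r,t)$-RS graph $G=(L,R,E)$ and $X\in\{0,1\}^{r\times t}$, $H=\mathrm{EncodedRS}(G,X)$ has two vertices $a_v,b_v$ for each vertex $v$ of $G$, and for each $j\in[t]$, $i\in[r]$ with $e_{i,j}=(u,v)$, $u\in L$: if $X_{i,j}=0$ it contains edges $(a_u,a_v),(b_u,b_v)$; if $X_{i,j}=1$ it contains $(a_u,b_v),(b_u,a_v)$. The edges arising from $M_j$ form a matching $\mathrm{rep}(M_j)$ of size $2r$. Augmenting edges/paths. For $j\in[t]$ and a sequence $\vec u=(u_1,\dots,u_k)$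 of $k\ge2$ distinct vertices of $L(M_j)$, let $v_i=M_j(u_i)$. The augmenting edges of $\vec u$ are $(a_{v_i},a_{u_{i+1}})$ and $(b_{v_i},b_{u_{i+1}})$ for $i\in[k-1]$. The augmenting path $AP(\vec u)$ starts at $\mathrm{start}=a_{u_1}$ and alternately follows an edge of $\mathrm{rep}(M_j)$ and an augmenting edge, ending at a vertex $\mathrm{end}(AP(\vec u))\in\{a_{v_k},b_{v_k}\}$. Augmentation graph. For $X$, $j$, and an ordered collection $\mathcal U=(\vec u_1,\dots,\vec u_\ell)$ of $k$-sequences on $L(M_j)$ using pairwise distinct vertices overall, $A=\mathrm{AugGraph}(G,X,j,\mathcal U)$ has the vertices of $H=\mathrm{EncodedRS}(G,X)$ plus new vertex sets $P,Q$, and edge set $E(H)\cup\bar H$, where $\bar H$ consists of all augmenting edges of all $\vec u_i$, a perfect matching between $P$ and the vertices of $H$ not matched by $\mathrm{rep}(M_j)$, and a perfect matching between $Q$ and $\{\mathrm{start}(AP(\vec u_i))\}_{i\in[\ell]}$. Writing $\vec u_i=(u_{i,1},\dots,u_{i,k})$ and $v_{i,k}=M_j(u_{i,k})$: $\mathrm{aug}(A)=\{a_{v_{i,k}}: \mathrm{end}(AP(\vec u_i))=a_{v_{i,k}}\}$ and $\overline{\mathrm{aug}}(A)=\{a_{v_{i,k}}:\mathrm{end}(AP(\vec u_i))\ne a_{v_{i,k}}\}$. Distribution $\mathcal D_{\mathrm{aug}}(G,Y,k)$ for $Y\in\{0,1\}^\ell$ with $k\ell<r$: sample $j\in[t]$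 uniformly; then sample $(X,\mathcal U)$ uniformly among all pairs ($X\in\{0,1\}^{r\times t}$, $\mathcal U$ an ordered collection of $\ell$ vertex-disjoint $k$-sequences on $L(M_j)$) such that for each $i$, $\mathrm{end}(AP(\vec u_i))\in\mathrm{aug}(A)$ if $Y_i=0$ and $\in\overline{\mathrm{aug}}(A)$ if $Y_i=1$; output $A=\mathrm{AugGraph}(G,X,j,\mathcal U)$. Hidden-Matching game. Parameters: a constant $\delta\in(0,1)$, integers $k,n_1\ge1$, a fixed $(2n_1)$-vertex $(r_1,t_1)$-RS graph $G^{RS}_1$ with induced matchings $M^1_1,\dots,M^1_{t_1}$, $L(G^{RS}_1)=\{x_1,\dots,x_{n_1}\}$, $R(G^{RS}_1)=\{y_1,\dots,y_{n_1}\}$, and a fixed $(2n_2)$-vertex $(r_2,t_2)$-RS graph $G^{RS}_2$ with $r_2=(k+\delta)n_1$; these are known to both players, Alice and Bob, who may use public and private randomness. Phase I: Alice receives $G_A$, obtained from $G^{RS}_1$ by deleting each edge independently with probability $\delta$. Sample $j_1\in[t_1]$ uniformly; let $Y_L,Y_R\in\{0,1\}^{n_1}$ be the characteristic vectors of $L(M^1_{j_1})$ and $R(M^1_{j_1})$. Sample independently $A_L\sim\mathcal D_{\mathrm{aug}}(G^{RS}_2,Y_L,k)$ and $A_R\sim\mathcal D_{\mathrm{aug}}(G^{RS}_2,Y_R,k)$ (on disjoint vertex sets), with encoded-RS graphs $H_L,H_R$ and remaining edge sets $\bar H_L,\bar H_R$. Bob receives $G_B=H_L\cup H_R$. Alice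 sends a message to Bob and Bob responds with a message to Alice. Phase II: let $M_L$ match, for each $i\in[n_1]$, the vertex $a_{v_{i,k}}$ of the $i$-th sequence of $A_L$ (the vertices of $\mathrm{aug}(A_L)\cup\overline{\mathrm{aug}}(A_L)$) to $x_i$, and $M_R$ similarly match those of $A_R$ to $y_i$. Both players receive $G_2=M_L\cup M_R\cup\bar H_L\cup\bar H_R$, and Bob additionally receives $j_1$. Alice sends a message to Bob, and Bob outputs a set of edges. The output $\mathrm{out}(\pi,G)$ is the set of output edges belonging to $M^1_{j_1}$, defined as $\emptyset$ if Bob outputs any edge not in $G_A$. The value is $\mathrm{val}(\pi)=\mathbb E|\mathrm{out}(\pi,G)|$ over the input distribution (and randomness), and $\mathsf C(\pi)$ is the worst-case total number of bits communicated.
   Formalization: Asymptotics are for families with r_1→∞ (for bounded r_1 a zero-communication protocol has value ≥1−δ); k≥2, as sequences need it; in D_aug, for Y_i=1 the condition is a_{v_{i,k}}∈\overline{aug}(A), since the path's end can never lie in that set. *)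

theory Defs
  imports "HOL-Probability.Probability" "HOL-Library.Landau_Symbols" "HOL-Library.Extended_Nat"
begin

section \<open>Ruzsa--Szemeredi graphs\<close>

text \<open>
  Both sides of a bipartite graph on \<open>2n\<close> vertices are labelled \<open>0, \<dots>, n - 1\<close>; an edge is
  a pair (left label, right label). All indices start at \<open>0\<close>. The field \<open>rs_edge\<close> is the fixed
  ordering: \<open>rs_edge G i j\<close> is the \<open>i\<close>-th edge of the \<open>j\<close>-th matching.
\<close>

record rs_graph =
  rs_n :: nat
  rs_r :: nat
  rs_t :: nat
  rs_edge :: "nat \<Rightarrow> nat \<Rightarrow> nat \<times> nat"

definition rs_matching :: "rs_graph \<Rightarrow> nat \<Rightarrow> (nat \<times> nat) set" where
  "rs_matching G j = (\<lambda>i. rs_edge G i j) ` {..<rs_r G}"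

definition rs_edges :: "rs_graph \<Rightarrow> (nat \<times> nat) set" where
  "rs_edges G = (\<Union>j<rs_t G. rs_matching G j)"

definition bip_matching :: "(nat \<times> nat) set \<Rightarrow> bool" where
  "bip_matching M \<longleftrightarrow> inj_on fst M \<and> inj_on snd M"

definition induced_matching :: "(nat \<times> nat) set \<Rightarrow> (nat \<times> nat) set \<Rightarrow> bool" where
  "induced_matching E M \<longleftrightarrow> M \<subseteq> E \<and> bip_matching M \<and> E \<inter> (fst ` M \<times> snd ` M) = M"

definition is_rs_graph :: "rs_graph \<Rightarrow> bool" where
  "is_rs_graph G \<longleftrightarrow>
     rs_edges G \<subseteq> {..<rs_n G} \<times> {..<rs_n G} \<and>
     (\<forall>j<rs_t G. inj_on (\<lambda>i. rs_edge G i j) {..<rs_r G} \<and>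
        induced_matching (rs_edges G) (rs_matching G j)) \<and>
     (\<forall>j<rs_t G. \<forall>j'<rs_t G. j \<noteq> j' \<longrightarrow> rs_matching G j \<inter> rs_matching G j' = {})"

definition mate :: "(nat \<times> nat) set \<Rightarrow> nat \<Rightarrow> nat" where
  "mate M u = (THE v. (u, v) \<in> M)"


section \<open>Encoded RS graphs\<close>

text \<open>Edges of the graphs below are two-element sets of vertices.\<close>

datatype rs_vertex = LV nat | RV nat

datatype enc_vertex = AV rs_vertex | BV rs_vertex

definition enc_vertices :: "rs_graph \<Rightarrow> enc_vertex set" where
  "enc_vertices G = (let V = LV ` {..<rs_n G} \<union> RV ` {..<rs_n G} in AV ` V \<union> BV ` V)"

definition enc_edge :: "bool \<Rightarrow> nat \<times> nat \<Rightarrow> enc_vertex set set" where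
  "enc_edge b e =
     (if b then {{AV (LV (fst e)), BV (RV (snd e))}, {BV (LV (fst e)), AV (RV (snd e))}}
      else {{AV (LV (fst e)), AV (RV (snd e))}, {BV (LV (fst e)), BV (RV (snd e))}})"

definition rep :: "rs_graph \<Rightarrow> (nat \<times> nat \<Rightarrow> bool) \<Rightarrow> nat \<Rightarrow> enc_vertex set set" where
  "rep G X j = (\<Union>i<rs_r G. enc_edge (X (i, j)) (rs_edge G i j))"

definition encoded_rs :: "rs_graph \<Rightarrow> (nat \<times> nat \<Rightarrow> bool) \<Rightarrow> enc_vertex set set" where
  "encoded_rs G X = (\<Union>j<rs_t G. rep G X j)"


section \<open>Augmenting paths and augmentation graphs\<close>

definition augmenting_edges :: "rs_graph \<Rightarrow> nat \<Rightarrow> nat list \<Rightarrow> enc_vertex set set" where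
  "augmenting_edges G j us =
     (\<Union>i<length us - 1.
        let v = RV (mate (rs_matching G j) (us ! i)); u = LV (us ! Suc i)
        in {{AV v, AV u}, {BV v, BV u}})"

definition follow :: "'v set set \<Rightarrow> 'v \<Rightarrow> 'v" where
  "follow M w = (THE w'. {w, w'} \<in> M)"

primrec alternating_walk :: "nat \<Rightarrow> 'v set set \<Rightarrow> 'v set set \<Rightarrow> 'v \<Rightarrow> 'v list" where
  "alternating_walk 0 M N w = [w]"
| "alternating_walk (Suc m) M N w = w # alternating_walk m N M (follow M w)"

definition aug_start :: "nat list \<Rightarrow> enc_vertex" where
  "aug_start us = AV (LV (hd us))"

text \<open>For a \<open>k\<close>-sequence the path has \<open>k\<close> matching edges and \<open>k - 1\<close> augmenting edges.\<close>

definition aug_path ::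
  "rs_graph \<Rightarrow> (nat \<times> nat \<Rightarrow> bool) \<Rightarrow> nat \<Rightarrow> nat list \<Rightarrow> enc_vertex list" where
  "aug_path G X j us =
     alternating_walk (2 * length us - 1) (rep G X j) (augmenting_edges G j us) (aug_start us)"

definition aug_end :: "rs_graph \<Rightarrow> (nat \<times> nat \<Rightarrow> bool) \<Rightarrow> nat \<Rightarrow> nat list \<Rightarrow> enc_vertex" where
  "aug_end G X j us = last (aug_path G X j us)"

text \<open>The vertex \<open>a\<^bsub>v\<^esub>\<close> for \<open>v\<close> the partner of the last vertex of the sequence.\<close>

definition aug_target :: "rs_graph \<Rightarrow> nat \<Rightarrow> nat list \<Rightarrow> enc_vertex" where
  "aug_target G j us = AV (RV (mate (rs_matching G j) (last us)))"

definition aug_set ::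
  "rs_graph \<Rightarrow> (nat \<times> nat \<Rightarrow> bool) \<Rightarrow> nat \<Rightarrow> nat list list \<Rightarrow> enc_vertex set" where
  "aug_set G X j U = {aug_target G j us | us. us \<in> set U \<and> aug_end G X j us = aug_target G j us}"

definition aug_bar_set ::
  "rs_graph \<Rightarrow> (nat \<times> nat \<Rightarrow> bool) \<Rightarrow> nat \<Rightarrow> nat list list \<Rightarrow> enc_vertex set" where
  "aug_bar_set G X j U = {aug_target G j us | us. us \<in> set U \<and> aug_end G X j us \<noteq> aug_target G j us}"

text \<open>
  \<open>PV w\<close> is the new vertex matched to the vertex \<open>w\<close> missed by \<open>rep\<close>, and \<open>QV i\<close> the new
  vertex matched to the start of the \<open>i\<close>-th path.
\<close>

datatype aug_vertex = HV enc_vertex | PV enc_vertex | QV nat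

text \<open>
  An augmentation graph is kept together with its decomposition into the encoded part \<open>ag_enc\<close>
  and the remaining edges \<open>ag_rest\<close>, and with the list \<open>ag_targets\<close> of the vertices
  \<open>aug_target\<close> in the order of the sequences. Every vertex has an incident edge, so the edges
  determine the vertex set.
\<close>

record aug_graph =
  ag_enc :: "aug_vertex set set"
  ag_rest :: "aug_vertex set set"
  ag_targets :: "aug_vertex list"

definition aug_graph_of ::
  "rs_graph \<Rightarrow> (nat \<times> nat \<Rightarrow> bool) \<Rightarrow> nat \<Rightarrow> nat list list \<Rightarrow> aug_graph" where
  "aug_graph_of G X j U =
     \<lparr> ag_enc = (`) HV ` encoded_rs G X,
       ag_rest = (`) HV ` (\<Union>us\<in>set U. augmenting_edges G j us)
         \<union> {{PV w, HV w} | w. w \<in> enc_vertices G - \<Union>(rep G X j)}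
         \<union> {{QV i, HV (aug_start (U ! i))} | i. i < length U},
       ag_targets = map (\<lambda>us. HV (aug_target G j us)) U \<rparr>"

definition valid_seqs :: "rs_graph \<Rightarrow> nat \<Rightarrow> nat \<Rightarrow> nat \<Rightarrow> nat list list \<Rightarrow> bool" where
  "valid_seqs G j l k U \<longleftrightarrow>
     length U = l \<and> (\<forall>us\<in>set U. length us = k) \<and>
     distinct (concat U) \<and> set (concat U) \<subseteq> fst ` rs_matching G j"

text \<open>
  \<open>Y\<close> stands for its first \<open>l\<close> entries. The target of the \<open>i\<close>-th sequence is required to lie
  in \<open>aug_set\<close> or \<open>aug_bar_set\<close> (and not the end of the path, which never is an element of
  \<open>aug_bar_set\<close>).
\<close>

definition aug_instances ::
  "rs_graph \<Rightarrow> (nat \<Rightarrow> bool) \<Rightarrow> nat \<Rightarrow> nat \<Rightarrow> nat \<Rightarrow> ((nat \<times> nat \<Rightarrow> bool) \<times> nat list list) set" where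
  "aug_instances G Y l k j =
     {(X, U). X \<in> ({..<rs_r G} \<times> {..<rs_t G}) \<rightarrow>\<^sub>E UNIV \<and> valid_seqs G j l k U \<and>
        (\<forall>i<l. aug_target G j (U ! i) \<in> (if Y i then aug_bar_set G X j U else aug_set G X j U))}"

definition D_aug :: "rs_graph \<Rightarrow> (nat \<Rightarrow> bool) \<Rightarrow> nat \<Rightarrow> nat \<Rightarrow> aug_graph pmf" where
  "D_aug G Y l k =
     do {
       j \<leftarrow> pmf_of_set {..<rs_t G};
       (X, U) \<leftarrow> pmf_of_set (aug_instances G Y l k j);
       return_pmf (aug_graph_of G X j U)
     }"


section \<open>The Hidden-Matching game\<close>

text \<open>
  \<open>XV i\<close> and \<open>YV i\<close> are the left and right vertex \<open>i\<close> of the first RS graph; \<open>GL\<close> and \<open>GR\<close>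
  make the vertex sets of the two augmentation graphs disjoint.
\<close>

datatype game_vertex = XV nat | YV nat | GL aug_vertex | GR aug_vertex

text \<open>Sequences of \<open>k\<close> vertices are used only for \<open>k \<ge> 2\<close>; uniform indices need \<open>t \<ge> 1\<close>.\<close>

definition hm_params :: "real \<Rightarrow> nat \<Rightarrow> rs_graph \<Rightarrow> rs_graph \<Rightarrow> bool" where
  "hm_params \<delta> k G1 G2 \<longleftrightarrow>
     0 < \<delta> \<and> \<delta> < 1 \<and> k \<ge> 2 \<and> rs_n G1 \<ge> 1 \<and>
     is_rs_graph G1 \<and> rs_t G1 \<ge> 1 \<and> is_rs_graph G2 \<and> rs_t G2 \<ge> 1 \<and>
     real (rs_r G2) = (real k + \<delta>) * real (rs_n G1)"

record hm_input =
  in_A :: "(nat \<times> nat) set"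
  in_j :: nat
  in_L :: aug_graph
  in_R :: aug_graph

definition subsampled_graph :: "real \<Rightarrow> rs_graph \<Rightarrow> (nat \<times> nat) set pmf" where
  "subsampled_graph \<delta> G =
     map_pmf (\<lambda>keep. {e \<in> rs_edges G. keep e})
       (Pi_pmf (rs_edges G) False (\<lambda>_. bernoulli_pmf (1 - \<delta>)))"

definition hm_dist :: "real \<Rightarrow> nat \<Rightarrow> rs_graph \<Rightarrow> rs_graph \<Rightarrow> hm_input pmf" where
  "hm_dist \<delta> k G1 G2 =
     do {
       GA \<leftarrow> subsampled_graph \<delta> G1;
       j \<leftarrow> pmf_of_set {..<rs_t G1};
       AL \<leftarrow> D_aug G2 (\<lambda>i. i \<in> fst ` rs_matching G1 j) (rs_n G1) k;
       AR \<leftarrow> D_aug G2 (\<lambda>i. i \<in> snd ` rs_matching G1 j) (rs_n G1) k;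
       return_pmf \<lparr> in_A = GA, in_j = j, in_L = AL, in_R = AR \<rparr>
     }"

definition graph_B :: "hm_input \<Rightarrow> game_vertex set set" where
  "graph_B I = (`) GL ` ag_enc (in_L I) \<union> (`) GR ` ag_enc (in_R I)"

definition graph_2 :: "hm_input \<Rightarrow> game_vertex set set" where
  "graph_2 I =
     {{GL (ag_targets (in_L I) ! i), XV i} | i. i < length (ag_targets (in_L I))}
     \<union> {{GR (ag_targets (in_R I) ! i), YV i} | i. i < length (ag_targets (in_R I))}
     \<union> (`) GL ` ag_rest (in_L I) \<union> (`) GR ` ag_rest (in_R I)"

text \<open>
  A protocol draws independent seeds: a public one, one private to Alice and one private to Bob.
  Deterministic protocols are those with constant seeds. \<open>p_alice1\<close>, \<open>p_bob1\<close> and \<open>p_alice2\<close> are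
  the three messages as bit strings, \<open>p_bob2\<close> is the output; edges of the first RS graph are
  given as pairs of labels. A player's own earlier messages can be recomputed from the arguments.
\<close>

record ('p, 'a, 'b) protocol =
  p_pub :: "'p pmf"
  p_privA :: "'a pmf"
  p_privB :: "'b pmf"
  p_alice1 :: "'p \<Rightarrow> 'a \<Rightarrow> (nat \<times> nat) set \<Rightarrow> bool list"
  p_bob1 :: "'p \<Rightarrow> 'b \<Rightarrow> game_vertex set set \<Rightarrow> bool list \<Rightarrow> bool list"
  p_alice2 :: "'p \<Rightarrow> 'a \<Rightarrow> (nat \<times> nat) set \<Rightarrow> bool list \<Rightarrow> game_vertex set set \<Rightarrow> bool list"
  p_bob2 :: "'p \<Rightarrow> 'b \<Rightarrow> game_vertex set set \<Rightarrow> bool list \<Rightarrow> bool list \<Rightarrow>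
    game_vertex set set \<Rightarrow> nat \<Rightarrow> (nat \<times> nat) set"

definition seeds :: "('p, 'a, 'b) protocol \<Rightarrow> ('p \<times> 'a \<times> 'b) pmf" where
  "seeds \<pi> = pair_pmf (p_pub \<pi>) (pair_pmf (p_privA \<pi>) (p_privB \<pi>))"

definition transcript ::
  "('p, 'a, 'b) protocol \<Rightarrow> 'p \<times> 'a \<times> 'b \<Rightarrow> hm_input \<Rightarrow> bool list \<times> bool list \<times> bool list" where
  "transcript \<pi> s I =
     (case s of (p, a, b) \<Rightarrow>
        let m1 = p_alice1 \<pi> p a (in_A I);
            m2 = p_bob1 \<pi> p b (graph_B I) m1;
            m3 = p_alice2 \<pi> p a (in_A I) m2 (graph_2 I)
        in (m1, m2, m3))"

definition bits :: "bool list \<times> bool list \<times> bool list \<Rightarrow> nat" where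
  "bits T = (case T of (m1, m2, m3) \<Rightarrow> length m1 + length m2 + length m3)"

definition bob_output ::
  "('p, 'a, 'b) protocol \<Rightarrow> 'p \<times> 'a \<times> 'b \<Rightarrow> hm_input \<Rightarrow> (nat \<times> nat) set" where
  "bob_output \<pi> s I =
     (case s of (p, a, b) \<Rightarrow> case transcript \<pi> s I of (m1, m2, m3) \<Rightarrow>
        p_bob2 \<pi> p b (graph_B I) m1 m3 (graph_2 I) (in_j I))"

definition hm_out ::
  "rs_graph \<Rightarrow> ('p, 'a, 'b) protocol \<Rightarrow> 'p \<times> 'a \<times> 'b \<Rightarrow> hm_input \<Rightarrow> (nat \<times> nat) set" where
  "hm_out G1 \<pi> s I =
     (if bob_output \<pi> s I \<subseteq> in_A I then bob_output \<pi> s I \<inter> rs_matching G1 (in_j I) else {})"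

definition hm_val ::
  "real \<Rightarrow> nat \<Rightarrow> rs_graph \<Rightarrow> rs_graph \<Rightarrow> ('p, 'a, 'b) protocol \<Rightarrow> real" where
  "hm_val \<delta> k G1 G2 \<pi> =
     measure_pmf.expectation (pair_pmf (seeds \<pi>) (hm_dist \<delta> k G1 G2))
       (\<lambda>(s, I). real (card (hm_out G1 \<pi> s I)))"

text \<open>The supremum is taken in the extended naturals: infinitely many seeds may be possible.\<close>

definition comm_cost ::
  "real \<Rightarrow> nat \<Rightarrow> rs_graph \<Rightarrow> rs_graph \<Rightarrow> ('p, 'a, 'b) protocol \<Rightarrow> enat" where
  "comm_cost \<delta> k G1 G2 \<pi> =
     (SUP (s, I) \<in> set_pmf (seeds \<pi>) \<times> set_pmf (hm_dist \<delta> k G1 G2).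
        enat (bits (transcript \<pi> s I)))"

end

theory Submission
  imports Defs "HOL-Real_Asymp.Real_Asymp"
begin

text \<open>
  The end of an augmenting path is the parity of the code bits along it. Bob's message is one of at
  most \<open>4\<^sup>C\<close> strings, and for each fixed string the advantage of a test for \<open>Y\<close> averages, over the
  independent columns \<open>j\<close> of the code, quantities at most \<open>1\<close> of mean \<open>0\<close>. A union bound over the
  strings therefore only needs an exponential moment of these quantities. In their expansion into
  characters, the level-\<open>km\<close> part has squared norm at most \<open>(l choose m)\<^sup>2 / (r choose km)\<close>, since the
  union of \<open>m\<close> random blocks is a uniform \<open>km\<close>-set. For \<open>k = 2\<close> these weights have a bounded sum, which
  suffices as then \<open>C = o(t)\<close>; for \<open>k \<ge> 3\<close> hypercontractivity, with a moment depending on the level,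
  gives tails of order \<open>exp (- 2 \<theta>)\<close> for \<open>\<theta>\<close> proportional to \<open>r powr (1 - 2 / k)\<close>.

  Hence the messages and the second-phase graph are nearly independent of the index \<open>j\<^sub>1\<close>. The set
  most likely to survive given the messages then serves for all \<open>t\<^sub>1\<close> matchings at once, and a second
  union bound shows that \<open>o(t\<^sub>1 r\<^sub>1)\<close> bits cannot certify a constant fraction of most matchings.
\<close>

section \<open>Averages over finite sets\<close>

definition avg :: "'a set \<Rightarrow> ('a \<Rightarrow> real) \<Rightarrow> real" where
  "avg A f = (\<Sum>x\<in>A. f x) / card A"

lemma avg_cong: "(\<And>x. x \<in> A \<Longrightarrow> f x = g x) \<Longrightarrow> avg A f = avg A g"
  by (simp add: avg_def)

lemma avg_mono: "(\<And>x. x \<in> A \<Longrightarrow> f x \<le> g x) \<Longrightarrow> avg A f \<le> avg A g"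
  unfolding avg_def by (intro divide_right_mono sum_mono) auto

lemma avg_nonneg: "(\<And>x. x \<in> A \<Longrightarrow> 0 \<le> f x) \<Longrightarrow> 0 \<le> avg A f"
  unfolding avg_def by (intro divide_nonneg_nonneg sum_nonneg) auto

lemma abs_avg_le: "\<bar>avg A f\<bar> \<le> avg A (\<lambda>x. \<bar>f x\<bar>)"
  by (simp add: avg_def divide_right_mono)

lemma avg_add: "avg A (\<lambda>x. f x + g x) = avg A f + avg A g"
  by (simp add: avg_def sum.distrib add_divide_distrib)

lemma avg_diff: "avg A (\<lambda>x. f x - g x) = avg A f - avg A g"
  by (simp add: avg_def sum_subtractf diff_divide_distrib)

lemma avg_cmult: "avg A (\<lambda>x. c * f x) = c * avg A f"
  by (simp add: avg_def sum_distrib_left)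

lemma avg_divide: "avg A (\<lambda>x. f x / c) = avg A f / c"
  by (simp add: avg_def sum_divide_distrib[symmetric])

lemma avg_sum: "avg A (\<lambda>x. \<Sum>i\<in>J. f i x) = (\<Sum>i\<in>J. avg A (f i))"
  unfolding avg_def sum_divide_distrib[symmetric] by (subst sum.swap) (rule refl)

lemma avg_const: "finite A \<Longrightarrow> A \<noteq> {} \<Longrightarrow> avg A (\<lambda>_. c) = c"
  by (simp add: avg_def)

lemma avg_swap: "avg A (\<lambda>x. avg B (f x)) = avg B (\<lambda>y. avg A (\<lambda>x. f x y))"
  unfolding avg_def sum_divide_distrib[symmetric] by (subst sum.swap) (simp add: mult.commute)

lemma avg_Times: "avg (A \<times> B) f = avg A (\<lambda>x. avg B (\<lambda>y. f (x, y)))"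
  unfolding avg_def sum_divide_distrib[symmetric] sum.cartesian_product
  by (simp add: card_cartesian_product case_prod_unfold mult.commute)

lemma avg_reindex: "bij_betw h A B \<Longrightarrow> avg A (\<lambda>x. f (h x)) = avg B f"
  using sum.reindex_bij_betw[of h A B f] by (simp add: avg_def bij_betw_same_card)

lemma avg_prod_PiE:
  assumes "finite J" "\<And>j. j \<in> J \<Longrightarrow> finite (B j)"
  shows "avg (PiE J B) (\<lambda>h. \<Prod>j\<in>J. f j (h j)) = (\<Prod>j\<in>J. avg (B j) (f j))"
  using prod_sum_PiE[OF assms, where f = f] assms by (simp add: avg_def card_PiE prod_dividef)

lemma avg_PiE_component:
  assumes index: "finite J" "i \<in> J" and fibres: "\<And>j. j \<in> J \<Longrightarrow> finite (B j) \<and> B j \<noteq> {}"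
  shows "avg (PiE J B) (\<lambda>h. f (h i)) = avg (B i) f"
proof -
  have single: "(\<Prod>j\<in>J. if j = i then g j else 1) = g i" for g :: "'a \<Rightarrow> real"
    using index by simp
  have "avg (PiE J B) (\<lambda>h. f (h i)) = avg (PiE J B) (\<lambda>h. \<Prod>j\<in>J. (if j = i then f else (\<lambda>_. 1)) (h j))"
    using single[of "\<lambda>j. f (_ j)"] by (simp add: if_distribR)
  also have "\<dots> = (\<Prod>j\<in>J. avg (B j) (if j = i then f else (\<lambda>_. 1)))"
    using index fibres by (intro avg_prod_PiE) auto
  also have "\<dots> = (\<Prod>j\<in>J. if j = i then avg (B j) f else 1)"
    using fibres by (intro prod.cong refl) (simp add: avg_const)
  finally show ?thesis using single[of "\<lambda>j. avg (B j) f"] by simp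
qed

abbreviation pmf_mean :: "'a pmf \<Rightarrow> ('a \<Rightarrow> real) \<Rightarrow> real" (\<open>\<E>\<close>) where
  "\<E> \<equiv> measure_pmf.expectation"

lemma expectation_pmf_of_set:
  "finite A \<Longrightarrow> A \<noteq> {} \<Longrightarrow> \<E> (pmf_of_set A) f = avg A f"
  by (simp add: integral_pmf_of_set avg_def)

section \<open>Binomial coefficients\<close>

lemma choose_Suc_mult_Suc: "(n choose Suc k) * Suc k = (n choose k) * (n - k)"
  by (metis binomial_absorb_comp binomial_absorption mult.commute)

lemma choose_mult_choose_le: "(a choose i) * (b choose j) \<le> (a + b) choose (i + j)"
proof -
  have "(a choose i) * (b choose (i + j - i)) \<le> (\<Sum>k\<le>i + j. (a choose k) * (b choose (i + j - k)))"
    by (rule member_le_sum) auto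
  then show ?thesis by (simp add: vandermonde)
qed

lemma choose_power_le: "(l choose m) ^ k \<le> k * l choose (k * m)"
proof (induction k)
  case 0
  show ?case by simp
next
  case (Suc k)
  have "(l choose m) * (l choose m) ^ k \<le> (l choose m) * (k * l choose (k * m))"
    using Suc by simp
  also have "\<dots> \<le> (l + k * l) choose (m + k * m)" by (rule choose_mult_choose_le)
  finally show ?case by simp
qed

lemma choose_mult_power_le:
  assumes "a \<le> b"
  shows "(a choose d) * b ^ d \<le> (b choose d) * a ^ d"
proof (induction d)
  case 0
  show ?case by simp
next
  case (Suc d)
  have "(a - d) * b \<le> (b - d) * a"
    using mult_le_mono2[OF assms, of d]
    by (simp add: diff_mult_distrib mult.commute[of a b] diff_le_mono2)
  then have "((a choose d) * b ^ d) * ((a - d) * b) \<le> ((b choose d) * a ^ d) * ((b - d) * a)"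
    by (rule mult_le_mono[OF Suc.IH])
  moreover have "Suc d * ((n choose Suc d) * c ^ Suc d) = ((n choose d) * c ^ d) * ((n - d) * c)" for n c
  proof -
    have "Suc d * ((n choose Suc d) * c ^ Suc d) = ((n choose Suc d) * Suc d) * (c ^ d * c)"
      by (simp only: power_Suc ac_simps)
    then show ?thesis unfolding choose_Suc_mult_Suc by (simp only: ac_simps)
  qed
  ultimately show ?case by (metis Suc_mult_le_cancel1)
qed

lemma choose_double_le: "2 * s choose (2 * i) \<le> (s choose i) * (2 * s - 1) ^ i"
proof (induction i)
  case 0
  show ?case by simp
next
  case (Suc i)
  have "(2 * s choose (2 * Suc i)) * (2 * Suc i) = (2 * s choose Suc (2 * i)) * (2 * s - Suc (2 * i))"
    using choose_Suc_mult_Suc[of "2 * s" "Suc (2 * i)"] by simp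
  moreover have "(2 * s choose Suc (2 * i)) * (2 * i + 1) = (2 * s choose (2 * i)) * (2 * s - 2 * i)"
    using choose_Suc_mult_Suc[of "2 * s" "2 * i"] by simp
  ultimately have "(2 * s choose (2 * Suc i)) * (2 * Suc i) * (2 * i + 1)
      = (2 * s choose (2 * i)) * (2 * s - 2 * i) * (2 * s - Suc (2 * i))"
    by (metis mult.assoc mult.commute)
  also have "\<dots> \<le> ((s choose i) * (2 * s - 1) ^ i) * (2 * s - 2 * i) * (2 * s - 1)"
    by (intro mult_le_mono Suc.IH) auto
  also have "\<dots> = 2 * ((s choose i) * (s - i)) * (2 * s - 1) ^ Suc i"
    unfolding diff_mult_distrib2[symmetric] by (simp only: power_Suc ac_simps)
  also have "\<dots> = ((s choose Suc i) * (2 * s - 1) ^ Suc i) * (2 * Suc i)"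
    unfolding choose_Suc_mult_Suc[symmetric] by (simp only: ac_simps)
  finally have "((2 * s choose (2 * Suc i)) * (2 * i + 1)) * (2 * Suc i)
      \<le> ((s choose Suc i) * (2 * s - 1) ^ Suc i) * (2 * Suc i)"
    by (simp only: ac_simps)
  then have "(2 * s choose (2 * Suc i)) * (2 * i + 1) \<le> (s choose Suc i) * (2 * s - 1) ^ Suc i"
    by (rule mult_right_le_imp_le) simp
  moreover have "(2 * s choose (2 * Suc i)) * 1 \<le> (2 * s choose (2 * Suc i)) * (2 * i + 1)"
    by (intro mult_le_mono2) simp
  ultimately show ?case by linarith
qed

section \<open>Hypercontractivity for even moments on the discrete cube\<close>

lemma even_part_binomial:
  fixes g h :: real
  shows "(g + h) ^ (2 * s) + (g - h) ^ (2 * s)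
    = 2 * (\<Sum>i\<le>s. real (2 * s choose (2 * i)) * (h\<^sup>2) ^ i * (g\<^sup>2) ^ (s - i))"
proof -
  have "(g + h) ^ (2 * s) + (g - h) ^ (2 * s)
      = (\<Sum>i\<le>2 * s. real (2 * s choose i) * g ^ (2 * s - i) * (h ^ i + (- h) ^ i))"
    using binomial_ring[of h g "2 * s"] binomial_ring[of "- h" g "2 * s"]
    by (simp add: sum.distrib[symmetric] algebra_simps)
  also have "\<dots> =
      (\<Sum>i\<in>{i. i \<le> 2 * s \<and> even i}. real (2 * s choose i) * g ^ (2 * s - i) * (h ^ i + (- h) ^ i))"
    by (intro sum.mono_neutral_right) (auto simp: power_minus_odd)
  also have "\<dots> =
      (\<Sum>i\<le>s. real (2 * s choose (2 * i)) * g ^ (2 * s - 2 * i) * (h ^ (2 * i) + (- h) ^ (2 * i)))"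
    by (rule sum.reindex_bij_witness[of _ "\<lambda>i. 2 * i" "\<lambda>i. i div 2"]) auto
  also have "\<dots> = 2 * (\<Sum>i\<le>s. real (2 * s choose (2 * i)) * (h\<^sup>2) ^ i * (g\<^sup>2) ^ (s - i))"
    unfolding sum_distrib_left
    by (intro sum.cong refl) (simp add: power_mult[symmetric] diff_mult_distrib2)
  finally show ?thesis .
qed

lemma two_point_hypercontractive:
  fixes g h :: real
  shows "((g + h) ^ (2 * s) + (g - h) ^ (2 * s)) / 2 \<le> (g\<^sup>2 + real (2 * s - 1) * h\<^sup>2) ^ s"
proof -
  have "((g + h) ^ (2 * s) + (g - h) ^ (2 * s)) / 2
      = (\<Sum>i\<le>s. real (2 * s choose (2 * i)) * (h\<^sup>2) ^ i * (g\<^sup>2) ^ (s - i))"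
    unfolding even_part_binomial by simp
  also have "\<dots> \<le> (\<Sum>i\<le>s. real ((s choose i) * (2 * s - 1) ^ i) * (h\<^sup>2) ^ i * (g\<^sup>2) ^ (s - i))"
    by (intro sum_mono mult_right_mono of_nat_mono choose_double_le) auto
  also have "\<dots> = (real (2 * s - 1) * h\<^sup>2 + g\<^sup>2) ^ s"
    unfolding binomial_ring
    by (intro sum.cong refl) (simp only: power_mult_distrib of_nat_mult of_nat_power ac_simps)
  finally show ?thesis by (simp only: add.commute)
qed

lemma convex_on_power_nonneg: "convex_on {0::real..} (\<lambda>x. x ^ n)"
  by (cases "even n") (auto intro: convex_power_odd convex_on_subset[OF convex_power_even])

lemma avg_power_add_le_pos:
  assumes G_bounds: "\<And>x. x \<in> A \<Longrightarrow> 0 \<le> G x" "avg A (\<lambda>x. G x ^ s) \<le> a ^ s" "0 < a"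
    and H_bounds: "\<And>x. x \<in> A \<Longrightarrow> 0 \<le> H x" "avg A (\<lambda>x. H x ^ s) \<le> b ^ s" "0 < b"
  shows "avg A (\<lambda>x. (G x + H x) ^ s) \<le> (a + b) ^ s"
proof -
  define u where "u = a / (a + b)"
  have u_bounds: "0 \<le> u" "u \<le> 1" "1 - u = b / (a + b)"
    using G_bounds(3) H_bounds(3) by (auto simp: u_def field_simps)
  have "(G x + H x) ^ s \<le> (a + b) ^ s * (u * (G x ^ s / a ^ s) + (1 - u) * (H x ^ s / b ^ s))"
    if "x \<in> A" for x
  proof -
    have "G x + H x = (a + b) * (u * (G x / a) + (1 - u) * (H x / b))"
      unfolding u_bounds(3) using G_bounds(3) H_bounds(3)
      by (simp add: u_def add_divide_distrib[symmetric])
    moreover have "(u * (G x / a) + (1 - u) * (H x / b)) ^ s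
        \<le> u * (G x / a) ^ s + (1 - u) * (H x / b) ^ s"
      using convex_onD[OF convex_on_power_nonneg[of s] u_bounds(1,2), of "H x / b" "G x / a"]
        G_bounds(1)[OF that] G_bounds(3) H_bounds(1)[OF that] H_bounds(3) by (simp add: add.commute)
    ultimately show ?thesis
      using G_bounds(3) H_bounds(3) by (simp add: power_mult_distrib power_divide mult_left_mono)
  qed
  then have "avg A (\<lambda>x. (G x + H x) ^ s)
      \<le> avg A (\<lambda>x. (a + b) ^ s * (u * (G x ^ s / a ^ s) + (1 - u) * (H x ^ s / b ^ s)))"
    by (rule avg_mono)
  also have "\<dots> = (a + b) ^ s * (u * (avg A (\<lambda>x. G x ^ s) / a ^ s)
      + (1 - u) * (avg A (\<lambda>x. H x ^ s) / b ^ s))"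
    by (simp only: avg_add avg_cmult avg_divide)
  also have "\<dots> \<le> (a + b) ^ s * (u * 1 + (1 - u) * 1)"
    using u_bounds G_bounds(2,3) H_bounds(2,3)
    by (intro mult_left_mono add_mono) (auto simp: divide_le_eq)
  finally show ?thesis by simp
qed

lemma avg_power_le_0_imp_0:
  assumes "finite A" "\<And>x. x \<in> A \<Longrightarrow> 0 \<le> F x" "avg A (\<lambda>x. F x ^ s) \<le> 0" "x \<in> A"
  shows "F x = 0"
proof -
  have "A \<noteq> {}" using assms(4) by blast
  then have "(\<Sum>x\<in>A. F x ^ s) \<le> 0"
    using assms(1,3) by (simp add: avg_def divide_le_0_iff card_gt_0_iff)
  moreover have "0 \<le> F x ^ s" "F x ^ s \<le> (\<Sum>x\<in>A. F x ^ s)"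
    using assms by (auto intro!: member_le_sum)
  ultimately have "F x ^ s = 0" by linarith
  then show ?thesis by simp
qed

lemma avg_power_add_le:
  assumes A_finite_nonempty: "finite A" "A \<noteq> {}"
    and G_bounds: "\<And>x. x \<in> A \<Longrightarrow> 0 \<le> G x" "avg A (\<lambda>x. G x ^ s) \<le> a ^ s" "0 \<le> a"
    and H_bounds: "\<And>x. x \<in> A \<Longrightarrow> 0 \<le> H x" "avg A (\<lambda>x. H x ^ s) \<le> b ^ s" "0 \<le> b"
  shows "avg A (\<lambda>x. (G x + H x) ^ s) \<le> (a + b) ^ s"
proof -
  consider (exponent_0) "s = 0" | (left_0) "0 < s" "a = 0" | (right_0) "0 < s" "b = 0"
    | (pos) "0 < a" "0 < b"
    using G_bounds(3) H_bounds(3) by force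
  then show ?thesis
  proof cases
    case exponent_0
    then show ?thesis using A_finite_nonempty by (simp add: avg_const)
  next
    case left_0
    then have "G x = 0" if "x \<in> A" for x
      using avg_power_le_0_imp_0[OF A_finite_nonempty(1) G_bounds(1) _ that] G_bounds(2)
      by (simp add: zero_power)
    then show ?thesis using H_bounds(2) left_0 by (simp cong: avg_cong)
  next
    case right_0
    then have "H x = 0" if "x \<in> A" for x
      using avg_power_le_0_imp_0[OF A_finite_nonempty(1) H_bounds(1) _ that] H_bounds(2)
      by (simp add: zero_power)
    then show ?thesis using G_bounds(2) right_0 by (simp cong: avg_cong)
  next
    case pos
    then show ?thesis using G_bounds H_bounds by (intro avg_power_add_le_pos)
  qed
qed

definition walsh :: "'a set \<Rightarrow> 'a set \<Rightarrow> real" where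
  "walsh S x = (- 1) ^ card (S \<inter> x)"

definition walsh_poly :: "'a set \<Rightarrow> ('a set \<Rightarrow> real) \<Rightarrow> 'a set \<Rightarrow> real" where
  "walsh_poly I c x = (\<Sum>S\<in>Pow I. c S * walsh S x)"

lemma walsh_empty [simp]: "walsh {} x = 1"
  by (simp add: walsh_def)

lemma walsh_square: "(walsh S x)\<^sup>2 = 1"
  by (simp add: walsh_def power_mult[symmetric] mult.commute)

lemma walsh_insert:
  assumes "finite S" "a \<notin> S" "a \<notin> x"
  shows "walsh (insert a S) x = walsh S x" "walsh S (insert a x) = walsh S x"
    "walsh (insert a S) (insert a x) = - walsh S x"
  using assms by (simp_all add: walsh_def)

lemma walsh_Un_disjoint:
  assumes "finite S" "finite T" "S \<inter> T = {}"
  shows "walsh (S \<union> T) x = walsh S x * walsh T x"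
proof -
  have "card ((S \<union> T) \<inter> x) = card (S \<inter> x) + card (T \<inter> x)"
    unfolding Int_Un_distrib2 using assms by (intro card_Un_disjoint) auto
  then show ?thesis by (simp add: walsh_def power_add)
qed

lemma walsh_Diff:
  assumes "finite I" "S \<subseteq> I"
  shows "walsh (I - S) x = walsh I x * walsh S x"
proof -
  have "walsh I x = walsh S x * walsh (I - S) x"
    using walsh_Un_disjoint[of S "I - S" x] assms finite_subset by (auto simp: Un_absorb1)
  then show ?thesis using walsh_square[of S x] by (simp add: power2_eq_square)
qed

lemma sum_Pow_insert:
  assumes "finite I" "a \<notin> I"
  shows "(\<Sum>x\<in>Pow (insert a I). f x) = (\<Sum>x\<in>Pow I. f x) + (\<Sum>x\<in>Pow I. f (insert a x))"
proof -
  have "(\<Sum>x\<in>Pow (insert a I). f x) = (\<Sum>x\<in>Pow I. f x) + (\<Sum>x\<in>insert a ` Pow I. f x)"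
    unfolding Pow_insert using assms by (intro sum.union_disjoint) auto
  also have "(\<Sum>x\<in>insert a ` Pow I. f x) = (\<Sum>x\<in>Pow I. f (insert a x))"
    by (subst sum.reindex) (use assms in \<open>auto intro!: inj_onI simp: insert_ident\<close>)
  finally show ?thesis .
qed

lemma avg_Pow_insert:
  assumes "finite I" "a \<notin> I"
  shows "avg (Pow (insert a I)) f = avg (Pow I) (\<lambda>x. (f x + f (insert a x)) / 2)"
  using assms by (simp add: avg_def sum_Pow_insert card_Pow sum.distrib sum_divide_distrib[symmetric])

lemma avg_Pow_const: "finite I \<Longrightarrow> avg (Pow I) (\<lambda>_. c) = c"
  by (intro avg_const) auto

lemma avg_walsh:
  assumes "finite I" "S \<subseteq> I" "S \<noteq> {}"
  shows "avg (Pow I) (walsh S) = 0"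
proof -
  obtain a where a_mem: "a \<in> S" using assms by blast
  define S' J where "S' = S - {a}" and "J = I - {a}"
  have S_insert: "S = insert a S'" "finite S'" "a \<notin> S'" and I_insert: "I = insert a J" "finite J" "a \<notin> J"
    using assms a_mem finite_subset by (auto simp: S'_def J_def)
  have "walsh S x + walsh S (insert a x) = 0" if "x \<in> Pow J" for x
  proof -
    have "a \<notin> x" using that I_insert(3) by blast
    then show ?thesis unfolding S_insert(1) by (simp add: walsh_insert(1,3)[OF S_insert(2,3)])
  qed
  then have "avg (Pow I) (walsh S) = avg (Pow J) (\<lambda>x. 0 / 2)"
    unfolding I_insert(1) avg_Pow_insert[OF I_insert(2,3)] by (intro avg_cong) simp
  then show ?thesis by (simp add: avg_def)
qed

lemma walsh_poly_insert:
  assumes I_insert: "finite I" "a \<notin> I" and x_subset: "x \<subseteq> I"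
  shows "walsh_poly (insert a I) c x = walsh_poly I c x + walsh_poly I (\<lambda>S. c (insert a S)) x"
    and "walsh_poly (insert a I) c (insert a x) = walsh_poly I c x - walsh_poly I (\<lambda>S. c (insert a S)) x"
proof -
  have walsh_values: "walsh (insert a S) x = walsh S x" "walsh S (insert a x) = walsh S x"
    "walsh (insert a S) (insert a x) = - walsh S x" if "S \<in> Pow I" for S
    using walsh_insert[of S a x] that I_insert x_subset finite_subset by auto
  then show "walsh_poly (insert a I) c x = walsh_poly I c x + walsh_poly I (\<lambda>S. c (insert a S)) x"
    and "walsh_poly (insert a I) c (insert a x) = walsh_poly I c x - walsh_poly I (\<lambda>S. c (insert a S)) x"
    unfolding walsh_poly_def sum_Pow_insert[OF I_insert] by (simp_all add: sum_negf)
qed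

theorem hypercontractive:
  assumes "finite I"
  shows "avg (Pow I) (\<lambda>x. walsh_poly I c x ^ (2 * s))
    \<le> (\<Sum>S\<in>Pow I. real (2 * s - 1) ^ card S * (c S)\<^sup>2) ^ s"
  using assms
proof (induction I arbitrary: c rule: finite_induct)
  case empty
  show ?case by (simp add: avg_def walsh_poly_def power_mult)
next
  case (insert a I)
  define g h where "g = walsh_poly I c" and "h = walsh_poly I (\<lambda>S. c (insert a S))"
  define K where "K = real (2 * s - 1)"
  define A B where "A = (\<Sum>S\<in>Pow I. K ^ card S * (c S)\<^sup>2)"
    and "B = (\<Sum>S\<in>Pow I. K ^ card S * (c (insert a S))\<^sup>2)"
  have nonneg: "0 \<le> K" "0 \<le> A" "0 \<le> B" by (auto simp: K_def A_def B_def intro!: sum_nonneg)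
  have "avg (Pow (insert a I)) (\<lambda>x. walsh_poly (insert a I) c x ^ (2 * s))
      = avg (Pow I) (\<lambda>x. ((g x + h x) ^ (2 * s) + (g x - h x) ^ (2 * s)) / 2)"
    unfolding avg_Pow_insert[OF insert.hyps] g_def h_def
    using walsh_poly_insert[OF insert.hyps] by (intro avg_cong) simp
  also have "\<dots> \<le> avg (Pow I) (\<lambda>x. ((g x)\<^sup>2 + K * (h x)\<^sup>2) ^ s)"
    unfolding K_def by (intro avg_mono two_point_hypercontractive)
  also have "\<dots> \<le> (A + K * B) ^ s"
  proof (intro avg_power_add_le)
    show "avg (Pow I) (\<lambda>x. ((g x)\<^sup>2) ^ s) \<le> A ^ s"
      using insert.IH[of c] by (simp add: g_def A_def K_def power_mult)
    have "avg (Pow I) (\<lambda>x. ((h x)\<^sup>2) ^ s) \<le> B ^ s"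
      using insert.IH[of "\<lambda>S. c (insert a S)"] by (simp add: h_def B_def K_def power_mult)
    then show "avg (Pow I) (\<lambda>x. (K * (h x)\<^sup>2) ^ s) \<le> (K * B) ^ s"
      unfolding power_mult_distrib avg_cmult using nonneg(1) by (intro mult_left_mono) auto
  qed (use insert.hyps nonneg in auto)
  also have "A + K * B = (\<Sum>S\<in>Pow (insert a I). K ^ card S * (c S)\<^sup>2)"
  proof -
    have "K * (K ^ card S * (c (insert a S))\<^sup>2) = K ^ card (insert a S) * (c (insert a S))\<^sup>2"
      if "S \<in> Pow I" for S
      using that insert.hyps finite_subset[of S I] by (subst card_insert_disjoint) auto
    then have "K * B = (\<Sum>S\<in>Pow I. K ^ card (insert a S) * (c (insert a S))\<^sup>2)"
      unfolding B_def sum_distrib_left by (rule sum.cong[OF refl])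
    then show ?thesis unfolding sum_Pow_insert[OF insert.hyps] A_def by simp
  qed
  finally show ?case unfolding K_def .
qed

lemma hypercontractive_homogeneous:
  assumes "finite I" and "\<And>S. S \<subseteq> I \<Longrightarrow> card S \<noteq> d \<Longrightarrow> c S = 0"
  shows "avg (Pow I) (\<lambda>x. walsh_poly I c x ^ (2 * s)) \<le> (real (2 * s - 1) ^ d * (\<Sum>S\<in>Pow I. (c S)\<^sup>2)) ^ s"
proof -
  have "real (2 * s - 1) ^ card S * (c S)\<^sup>2 = real (2 * s - 1) ^ d * (c S)\<^sup>2" if "S \<in> Pow I" for S
    using assms(2)[of S] that by (cases "card S = d") auto
  then have "(\<Sum>S\<in>Pow I. real (2 * s - 1) ^ card S * (c S)\<^sup>2) = real (2 * s - 1) ^ d * (\<Sum>S\<in>Pow I. (c S)\<^sup>2)"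
    unfolding sum_distrib_left by (rule sum.cong[OF refl])
  then show ?thesis using hypercontractive[OF assms(1), of c s] by simp
qed

lemma walsh_poly_complement:
  assumes "finite I"
  shows "walsh_poly I (\<lambda>S. c (I - S)) x = walsh I x * walsh_poly I c x"
proof -
  have "walsh_poly I (\<lambda>S. c (I - S)) x = (\<Sum>S\<in>Pow I. c S * walsh (I - S) x)"
    unfolding walsh_poly_def
    by (rule sum.reindex_bij_witness[of _ "\<lambda>S. I - S" "\<lambda>S. I - S"]) (auto simp: double_diff)
  also have "\<dots> = (\<Sum>S\<in>Pow I. walsh I x * (c S * walsh S x))"
    using walsh_Diff[OF assms, of _ x] by (intro sum.cong) auto
  finally show ?thesis by (simp add: walsh_poly_def sum_distrib_left)
qed

text \<open>Multiplying by the full character exchanges the degrees \<open>d\<close> and \<open>card I - d\<close> without changing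
  even moments.\<close>

lemma hypercontractive_homogeneous_min:
  assumes finite_I: "finite I" and homogeneous: "\<And>S. S \<subseteq> I \<Longrightarrow> card S \<noteq> d \<Longrightarrow> c S = 0"
  shows "avg (Pow I) (\<lambda>x. walsh_poly I c x ^ (2 * s))
    \<le> (real (2 * s - 1) ^ min d (card I - d) * (\<Sum>S\<in>Pow I. (c S)\<^sup>2)) ^ s"
proof (cases "d \<le> card I - d")
  case True
  then show ?thesis using hypercontractive_homogeneous[OF finite_I homogeneous] by (simp add: min_def)
next
  case False
  let ?c = "\<lambda>S. c (I - S)"
  have "?c S = 0" if "S \<subseteq> I" "card S \<noteq> card I - d" for S
  proof -
    have "card (I - S) \<noteq> d"
      using that card_mono[OF finite_I that(1)]
        card_Diff_subset[OF finite_subset[OF that(1) finite_I] that(1)] by simp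
    then show ?thesis using homogeneous[of "I - S"] by simp
  qed
  then have "avg (Pow I) (\<lambda>x. walsh_poly I ?c x ^ (2 * s))
      \<le> (real (2 * s - 1) ^ (card I - d) * (\<Sum>S\<in>Pow I. (?c S)\<^sup>2)) ^ s"
    by (intro hypercontractive_homogeneous finite_I) auto
  moreover have "walsh_poly I ?c x ^ (2 * s) = walsh_poly I c x ^ (2 * s)" for x
    by (simp add: walsh_poly_complement[OF finite_I] power_mult_distrib power_mult walsh_square)
  moreover have "(\<Sum>S\<in>Pow I. (?c S)\<^sup>2) = (\<Sum>S\<in>Pow I. (c S)\<^sup>2)"
    by (rule sum.reindex_bij_witness[of _ "\<lambda>S. I - S" "\<lambda>S. I - S"]) (auto simp: double_diff)
  ultimately show ?thesis using False by (simp add: min_def)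
qed

section \<open>Parities over random disjoint blocks\<close>

definition disjoint_seqs :: "'a set \<Rightarrow> nat \<Rightarrow> nat \<Rightarrow> 'a list list set" where
  "disjoint_seqs I l k =
     {U. length U = l \<and> (\<forall>us\<in>set U. length us = k) \<and> distinct (concat U) \<and> set (concat U) \<subseteq> I}"

definition block :: "'a list list \<Rightarrow> nat set \<Rightarrow> 'a set" where
  "block U T = (\<Union>i\<in>T. set (U ! i))"

lemma finite_disjoint_seqs:
  assumes "finite I"
  shows "finite (disjoint_seqs I l k)"
proof (rule finite_subset)
  show "disjoint_seqs I l k \<subseteq> {U. set U \<subseteq> {us. set us \<subseteq> I \<and> length us = k} \<and> length U = l}"
    by (auto simp: disjoint_seqs_def)
  show "finite {U. set U \<subseteq> {us. set us \<subseteq> I \<and> length us = k} \<and> length U = l}"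
    using assms by (intro finite_lists_length_eq)
qed

lemma disjoint_seqs_nonempty:
  assumes "finite I" "k * l \<le> card I"
  shows "disjoint_seqs I l k \<noteq> {}"
  using assms
proof (induction l arbitrary: I)
  case 0
  then show ?case by (auto simp: disjoint_seqs_def)
next
  case (Suc l)
  then obtain A where A_subset: "A \<subseteq> I" "card A = k"
    using obtain_subset_with_card_n[of k I] by (metis le_add1 le_trans mult_Suc_right)
  then have "finite A" using Suc.prems finite_subset by blast
  then obtain us where us_enum: "set us = A" "distinct us" using finite_distinct_list by blast
  have "k * l \<le> card (I - A)"
    using Suc.prems A_subset \<open>finite A\<close> by (simp add: card_Diff_subset)
  then obtain U where "U \<in> disjoint_seqs (I - A) l k" using Suc by blast
  moreover have "length us = k" using us_enum A_subset distinct_card by metis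
  ultimately have "us # U \<in> disjoint_seqs I (Suc l) k"
    using us_enum A_subset by (auto simp: disjoint_seqs_def)
  then show ?case by blast
qed

lemma disjoint_seqs_nth:
  assumes U_seqs: "U \<in> disjoint_seqs I l k" and i_less: "i < l"
  shows "card (set (U ! i)) = k" "set (U ! i) \<subseteq> I" "length (U ! i) = k" "distinct (U ! i)"
proof -
  have "U ! i \<in> set U" using U_seqs i_less by (auto simp: disjoint_seqs_def)
  then show "distinct (U ! i)" "length (U ! i) = k" "set (U ! i) \<subseteq> I"
    using U_seqs by (auto simp: disjoint_seqs_def distinct_concat_iff)
  then show "card (set (U ! i)) = k" by (simp add: distinct_card)
qed

lemma disjoint_seqs_disjoint:
  assumes U_seqs: "U \<in> disjoint_seqs I l k" and distinct_indices: "i < l" "j < l" "i \<noteq> j"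
  shows "set (U ! i) \<inter> set (U ! j) = {}"
proof -
  have less: "set (U ! i) \<inter> set (U ! j) = {}" if "i < j" "j < l" for i j
  proof -
    have "length U = l" "distinct (concat U)" using U_seqs by (auto simp: disjoint_seqs_def)
    then have "distinct (concat (take i U) @ U ! i @ concat (drop (Suc i) U))"
      using that by (metis concat.simps(2) concat_append id_take_nth_drop less_trans)
    moreover have "U ! j \<in> set (drop (Suc i) U)"
      using that \<open>length U = l\<close> by (auto simp: in_set_conv_nth intro!: exI[of _ "j - Suc i"])
    ultimately show ?thesis by auto
  qed
  then show ?thesis
    using distinct_indices less[of i j] less[of j i]
    by (cases i j rule: linorder_cases) (simp_all add: Int_commute)
qed

lemma map_disjoint_seqs:
  assumes p_inj: "inj_on p I" "p ` I \<subseteq> J" and U_seqs: "U \<in> disjoint_seqs I l k"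
  shows "map (map p) U \<in> disjoint_seqs J l k"
proof -
  have concat_subset: "set (concat U) \<subseteq> I" and "distinct (concat U)"
    using U_seqs unfolding disjoint_seqs_def by auto
  then have "distinct (map p (concat U))" by (simp only: distinct_map inj_on_subset[OF p_inj(1)])
  moreover have "set (map p (concat U)) \<subseteq> J" using concat_subset p_inj(2) unfolding set_map by blast
  ultimately show ?thesis using U_seqs unfolding map_concat by (auto simp: disjoint_seqs_def)
qed

lemma bij_betw_map_disjoint_seqs:
  assumes perm: "bij_betw p I I"
  shows "bij_betw (map (map p)) (disjoint_seqs I l k) (disjoint_seqs I l k)"
proof -
  define q where "q = inv_into I p"
  have inverse_perm: "bij_betw q I I" unfolding q_def using perm by (rule bij_betw_inv_into)
  have inverse: "map (map f) (map (map g) U) = U"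
    if "\<And>u. u \<in> I \<Longrightarrow> f (g u) = u" "U \<in> disjoint_seqs I l k" for f g :: "'a \<Rightarrow> 'a" and U
    using that by (auto simp: disjoint_seqs_def intro!: map_idI)
  have stable: "map (map f) ` disjoint_seqs I l k \<subseteq> disjoint_seqs I l k" if "bij_betw f I I" for f
    using that map_disjoint_seqs[of f I I] by (auto simp: bij_betw_def)
  show ?thesis
  proof (rule bij_betw_byWitness[where f' = "map (map q)"])
    show "\<forall>U\<in>disjoint_seqs I l k. map (map q) (map (map p) U) = U"
      using perm by (intro ballI inverse) (auto simp: q_def bij_betw_inv_into_left)
    show "\<forall>U\<in>disjoint_seqs I l k. map (map p) (map (map q) U) = U"
      using perm by (intro ballI inverse) (auto simp: q_def bij_betw_inv_into_right)
  qed (intro stable perm inverse_perm)+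
qed

lemma card_block:
  assumes U_seqs: "U \<in> disjoint_seqs I l k" and T_subset: "T \<subseteq> {..<l}"
  shows "card (block U T) = k * card T"
proof -
  have "card (block U T) = (\<Sum>i\<in>T. card (set (U ! i)))"
    unfolding block_def using T_subset disjoint_seqs_disjoint[OF U_seqs] finite_subset[OF T_subset]
    by (intro card_UN_disjoint) (auto simp: subset_eq)
  also have "\<dots> = (\<Sum>i\<in>T. k)" using T_subset disjoint_seqs_nth(1)[OF U_seqs] by (intro sum.cong) auto
  finally show ?thesis by simp
qed

lemma block_subset:
  assumes "U \<in> disjoint_seqs I l k" "T \<subseteq> {..<l}"
  shows "block U T \<subseteq> I"
  using assms disjoint_seqs_nth(2)[OF assms(1)] by (auto simp: block_def)

lemma block_map:
  assumes "U \<in> disjoint_seqs I l k" "T \<subseteq> {..<l}"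
  shows "block (map (map p) U) T = p ` block U T"
proof -
  have "set (map (map p) U ! i) = p ` set (U ! i)" if "i \<in> T" for i
    using that assms by (auto simp: disjoint_seqs_def)
  then show ?thesis by (simp add: block_def image_UN)
qed

lemma ex_bij_betw_image:
  assumes "finite I" "S \<subseteq> I" "S' \<subseteq> I" "card S = card S'"
  shows "\<exists>p. bij_betw p I I \<and> p ` S = S'"
proof -
  have finite_sets: "finite S" "finite S'" using assms finite_subset by blast+
  then obtain f where bij_f: "bij_betw f S S'" using assms(4) finite_same_card_bij by blast
  have "card (I - S) = card (I - S')" using assms finite_sets by (simp add: card_Diff_subset)
  then obtain g where bij_g: "bij_betw g (I - S) (I - S')"
    using finite_same_card_bij[of "I - S" "I - S'"] assms(1) by auto
  let ?p = "\<lambda>u. if u \<in> S then f u else g u"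
  have "bij_betw ?p (S \<union> (I - S)) (S' \<union> (I - S'))"
    by (rule bij_betw_disjoint_Un[OF bij_f bij_g]) auto
  then have "bij_betw ?p I I" using assms(2,3) by (simp add: Un_absorb1)
  moreover have "?p ` S = S'" using bij_f by (simp add: bij_betw_def)
  ultimately show ?thesis by blast
qed

lemma avg_block_eq:
  assumes finite_I: "finite I" and T_subset: "T \<subseteq> {..<l}" and subsets: "S \<subseteq> I" "S' \<subseteq> I" "card S = card S'"
  shows "avg (disjoint_seqs I l k) (\<lambda>U. of_bool (block U T = S))
    = avg (disjoint_seqs I l k) (\<lambda>U. of_bool (block U T = S'))"
proof -
  obtain p where perm: "bij_betw p I I" "p ` S = S'" using ex_bij_betw_image[OF finite_I subsets] by blast
  have "block (map (map p) U) T = S' \<longleftrightarrow> block U T = S" if U_seqs: "U \<in> disjoint_seqs I l k" for U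
    unfolding block_map[OF U_seqs T_subset] perm(2)[symmetric]
    using inj_on_image_eq_iff[OF bij_betw_imp_inj_on[OF perm(1)]
        block_subset[OF U_seqs T_subset] subsets(1)] .
  then have "avg (disjoint_seqs I l k) (\<lambda>U. of_bool (block U T = S))
      = avg (disjoint_seqs I l k) (\<lambda>U. of_bool (block (map (map p) U) T = S'))"
    by (intro avg_cong) simp
  also have "\<dots> = avg (disjoint_seqs I l k) (\<lambda>U. of_bool (block U T = S'))"
    by (rule avg_reindex[OF bij_betw_map_disjoint_seqs[OF perm(1)]])
  finally show ?thesis .
qed

lemma avg_block_eq_le:
  assumes finite_I: "finite I" and T_subset: "T \<subseteq> {..<l}" and S_subset: "S \<subseteq> I" "card S = k * card T"
  shows "avg (disjoint_seqs I l k) (\<lambda>U. of_bool (block U T = S)) \<le> 1 / (card I choose (k * card T))"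
proof -
  let ?D = "{S'. S' \<subseteq> I \<and> card S' = k * card T}"
  have "(card I choose (k * card T)) * avg (disjoint_seqs I l k) (\<lambda>U. of_bool (block U T = S))
      = (\<Sum>S'\<in>?D. avg (disjoint_seqs I l k) (\<lambda>U. of_bool (block U T = S)))"
    by (simp add: n_subsets[OF finite_I])
  also have "\<dots> = (\<Sum>S'\<in>?D. avg (disjoint_seqs I l k) (\<lambda>U. of_bool (block U T = S')))"
    using S_subset by (intro sum.cong refl avg_block_eq[OF finite_I T_subset]) auto
  also have "\<dots> = avg (disjoint_seqs I l k) (\<lambda>U. \<Sum>S'\<in>?D. of_bool (block U T = S'))"
    by (rule avg_sum[symmetric])
  also have "\<dots> \<le> avg (disjoint_seqs I l k) (\<lambda>_. 1)"
    using finite_I by (intro avg_mono) (simp add: of_bool_def)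
  also have "\<dots> \<le> 1" by (simp add: avg_def)
  finally show ?thesis
    using S_subset card_mono[OF finite_I S_subset(1)] by (simp add: pos_le_divide_eq mult.commute)
qed

definition parity_sign :: "bool \<Rightarrow> real" where
  "parity_sign b = (if b then - 1 else 1)"

lemma abs_parity_sign: "\<bar>parity_sign b\<bar> = 1"
  by (simp add: parity_sign_def)

definition has_parities :: "nat \<Rightarrow> (nat \<Rightarrow> bool) \<Rightarrow> 'a list list \<Rightarrow> 'a set \<Rightarrow> bool" where
  "has_parities l Y U x \<longleftrightarrow> (\<forall>i<l. odd (card (set (U ! i) \<inter> x)) = Y i)"

text \<open>The density, with respect to a uniform \<open>x\<close>, of \<open>x\<close> conditioned on the parities \<open>Y\<close>.\<close>

definition parity_density :: "nat \<Rightarrow> (nat \<Rightarrow> bool) \<Rightarrow> 'a list list \<Rightarrow> 'a set \<Rightarrow> real" where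
  "parity_density l Y U x = 2 ^ l * of_bool (has_parities l Y U x)"

lemma parity_density_nonneg: "0 \<le> parity_density l Y U x"
  by (simp add: parity_density_def)

lemma walsh_block:
  assumes U_seqs: "U \<in> disjoint_seqs I l k" and T_subset: "T \<subseteq> {..<l}"
  shows "walsh (block U T) x = (\<Prod>i\<in>T. walsh (set (U ! i)) x)"
  using finite_subset[OF T_subset finite_lessThan] T_subset
proof (induction T rule: finite_induct)
  case empty
  then show ?case by (simp add: block_def)
next
  case (insert i T)
  have "set (U ! i) \<inter> block U T = {}"
    using disjoint_seqs_disjoint[OF U_seqs] insert.prems insert.hyps by (fastforce simp: block_def)
  then have "walsh (set (U ! i) \<union> block U T) x = walsh (set (U ! i)) x * walsh (block U T) x"
    using insert.hyps by (intro walsh_Un_disjoint) (auto simp: block_def)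
  then show ?case using insert by (simp add: block_def)
qed

lemma parity_density_eq_prod:
  "parity_density l Y U x = (\<Prod>i<l. parity_sign (Y i) * walsh (set (U ! i)) x + 1)"
proof -
  have "(\<Prod>i<l. parity_sign (Y i) * walsh (set (U ! i)) x + 1)
      = (\<Prod>i<l. 2 * of_bool (odd (card (set (U ! i) \<inter> x)) = Y i))"
    by (intro prod.cong refl) (simp add: parity_sign_def walsh_def)
  also have "\<dots> = 2 ^ l * (\<Prod>i<l. of_bool (odd (card (set (U ! i) \<inter> x)) = Y i))"
    by (simp add: prod.distrib)
  also have "(\<Prod>i<l. of_bool (odd (card (set (U ! i) \<inter> x)) = Y i))
      = (of_bool (has_parities l Y U x) :: real)"
    by (auto simp: has_parities_def of_bool_def prod_zero_iff)
  finally show ?thesis by (simp add: parity_density_def)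
qed

lemma parity_density_expansion:
  assumes U_seqs: "U \<in> disjoint_seqs I l k"
  shows "parity_density l Y U x - 1
    = (\<Sum>m = 1..l. \<Sum>T | T \<subseteq> {..<l} \<and> card T = m. (\<Prod>i\<in>T. parity_sign (Y i)) * walsh (block U T) x)"
proof -
  define monomial where "monomial T = (\<Prod>i\<in>T. parity_sign (Y i)) * walsh (block U T) x" for T
  have "parity_density l Y U x = (\<Sum>T\<in>Pow {..<l}. \<Prod>i\<in>T. parity_sign (Y i) * walsh (set (U ! i)) x)"
    unfolding parity_density_eq_prod by (subst prod_add) simp_all
  also have "\<dots> = (\<Sum>T\<in>Pow {..<l}. monomial T)"
    by (intro sum.cong refl) (simp add: monomial_def prod.distrib walsh_block[OF U_seqs])
  also have "\<dots> = monomial {} + (\<Sum>T\<in>Pow {..<l} - {{}}. monomial T)"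
    by (rule sum.remove) auto
  also have "(\<Sum>T\<in>Pow {..<l} - {{}}. monomial T)
      = (\<Sum>m = 1..l. \<Sum>T | T \<in> Pow {..<l} - {{}} \<and> card T = m. monomial T)"
  proof (rule sum.group[symmetric])
    have "1 \<le> card T" "card T \<le> l" if "T \<in> Pow {..<l} - {{}}" for T
      using that card_mono[of "{..<l}" T] finite_subset[of T "{..<l}"]
      by (auto simp: Suc_le_eq card_gt_0_iff)
    then show "card ` (Pow {..<l} - {{}}) \<subseteq> {1..l}" by (intro image_subsetI) simp
  qed auto
  also have "\<dots> = (\<Sum>m = 1..l. \<Sum>T | T \<subseteq> {..<l} \<and> card T = m. monomial T)"
    by (intro sum.cong refl) auto
  finally show ?thesis by (simp add: monomial_def block_def)
qed

lemma avg_parity_density: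
  assumes finite_I: "finite I" and k_pos: "1 \<le> k" and U_seqs: "U \<in> disjoint_seqs I l k"
  shows "avg (Pow I) (parity_density l Y U) = 1"
proof -
  have "avg (Pow I) (\<lambda>x. parity_density l Y U x - 1)
      = (\<Sum>m = 1..l. \<Sum>T | T \<subseteq> {..<l} \<and> card T = m.
          (\<Prod>i\<in>T. parity_sign (Y i)) * avg (Pow I) (walsh (block U T)))"
    unfolding parity_density_expansion[OF U_seqs] avg_sum avg_cmult ..
  also have "\<dots> = 0"
  proof (intro sum.neutral ballI)
    fix m T assume "m \<in> {1..l}" "T \<in> {T. T \<subseteq> {..<l} \<and> card T = m}"
    then have "block U T \<subseteq> I" "block U T \<noteq> {}"
      using block_subset[OF U_seqs, of T] card_block[OF U_seqs, of T] k_pos by auto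
    then show "(\<Prod>i\<in>T. parity_sign (Y i)) * avg (Pow I) (walsh (block U T)) = 0"
      using avg_walsh[OF finite_I] by simp
  qed
  finally show ?thesis by (simp add: avg_diff avg_Pow_const[OF finite_I])
qed

definition deficit :: "'a set \<Rightarrow> nat \<Rightarrow> nat \<Rightarrow> (nat \<Rightarrow> bool) \<Rightarrow> ('a list list \<Rightarrow> real) \<Rightarrow> 'a set \<Rightarrow> real" where
  "deficit I l k Y w x = avg (disjoint_seqs I l k) (\<lambda>U. w U * (1 - parity_density l Y U x))"

lemma deficit_le_1:
  assumes "\<And>U. 0 \<le> w U \<and> w U \<le> 1"
  shows "deficit I l k Y w x \<le> 1"
proof -
  have "w U * (1 - parity_density l Y U x) \<le> 1 * 1" for U
  proof (cases "parity_density l Y U x \<le> 1")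
    case True
    then show ?thesis using assms parity_density_nonneg[of l Y U x] by (intro mult_mono) auto
  next
    case False
    then have "w U * (1 - parity_density l Y U x) \<le> 0" using assms by (intro mult_nonneg_nonpos) auto
    then show ?thesis by simp
  qed
  then have "deficit I l k Y w x \<le> avg (disjoint_seqs I l k) (\<lambda>_. 1)"
    unfolding deficit_def by (intro avg_mono) simp
  also have "\<dots> \<le> 1" by (simp add: avg_def)
  finally show ?thesis .
qed

lemma avg_deficit:
  assumes "finite I" "1 \<le> k"
  shows "avg (Pow I) (deficit I l k Y w) = 0"
proof -
  have "avg (Pow I) (deficit I l k Y w)
      = avg (disjoint_seqs I l k) (\<lambda>U. w U * (1 - avg (Pow I) (parity_density l Y U)))"
    unfolding deficit_def[abs_def] avg_swap[of "Pow I"]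
    by (simp add: avg_cmult avg_diff avg_Pow_const[OF assms(1)])
  also have "\<dots> = avg (disjoint_seqs I l k) (\<lambda>U. 0)"
    by (intro avg_cong) (simp add: avg_parity_density[OF assms])
  finally show ?thesis by (simp add: avg_def)
qed

locale random_blocks =
  fixes I :: "'a set" and l k :: nat and Y :: "nat \<Rightarrow> bool" and w :: "'a list list \<Rightarrow> real"
  assumes finite_I: "finite I" and k_pos: "1 \<le> k" and blocks_fit: "k * l \<le> card I"
    and w_bounds: "\<And>U. 0 \<le> w U \<and> w U \<le> 1"
begin

definition level_coef :: "nat \<Rightarrow> 'a set \<Rightarrow> real" where
  "level_coef m S = avg (disjoint_seqs I l k) (\<lambda>U. \<Sum>T | T \<subseteq> {..<l} \<and> card T = m.
     - w U * (\<Prod>i\<in>T. parity_sign (Y i)) * of_bool (block U T = S))"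

definition level :: "nat \<Rightarrow> 'a set \<Rightarrow> real" where
  "level m = walsh_poly I (level_coef m)"

definition level_weight :: "nat \<Rightarrow> real" where
  "level_weight m = (real (l choose m))\<^sup>2 / real (card I choose (k * m))"

lemma level_eq_avg:
  "level m x = avg (disjoint_seqs I l k) (\<lambda>U. \<Sum>T | T \<subseteq> {..<l} \<and> card T = m.
     - w U * (\<Prod>i\<in>T. parity_sign (Y i)) * walsh (block U T) x)"
proof -
  let ?a = "\<lambda>U T. - w U * (\<Prod>i\<in>T. parity_sign (Y i))"
  have "level m x = avg (disjoint_seqs I l k) (\<lambda>U. \<Sum>S\<in>Pow I. walsh S x *
      (\<Sum>T | T \<subseteq> {..<l} \<and> card T = m. ?a U T * of_bool (block U T = S)))"
    unfolding level_def walsh_poly_def level_coef_def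
    by (simp only: avg_sum avg_cmult mult.commute[of _ "walsh _ x"])
  also have "\<dots> = avg (disjoint_seqs I l k)
      (\<lambda>U. \<Sum>T | T \<subseteq> {..<l} \<and> card T = m. ?a U T * walsh (block U T) x)"
  proof (intro avg_cong)
    fix U assume U_seqs: "U \<in> disjoint_seqs I l k"
    have "(\<Sum>S\<in>Pow I. walsh S x * (?a U T * of_bool (block U T = S))) = ?a U T * walsh (block U T) x"
      if "T \<subseteq> {..<l}" for T
    proof -
      have "(\<Sum>S\<in>Pow I. walsh S x * (?a U T * of_bool (block U T = S)))
          = (\<Sum>S\<in>Pow I. if block U T = S then ?a U T * walsh S x else 0)"
        by (intro sum.cong) auto
      then show ?thesis using finite_I block_subset[OF U_seqs that] by simp
    qed
    then show "(\<Sum>S\<in>Pow I. walsh S x * (\<Sum>T | T \<subseteq> {..<l} \<and> card T = m. ?a U T * of_bool (block U T = S)))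
        = (\<Sum>T | T \<subseteq> {..<l} \<and> card T = m. ?a U T * walsh (block U T) x)"
      unfolding sum_distrib_left by (subst sum.swap) (intro sum.cong, auto)
  qed
  finally show ?thesis .
qed

lemma deficit_eq_sum_level: "deficit I l k Y w x = (\<Sum>m = 1..l. level m x)"
proof -
  have "w U * (1 - parity_density l Y U x) = (\<Sum>m = 1..l. \<Sum>T | T \<subseteq> {..<l} \<and> card T = m.
      - w U * (\<Prod>i\<in>T. parity_sign (Y i)) * walsh (block U T) x)" if "U \<in> disjoint_seqs I l k" for U
  proof -
    have "w U * (1 - parity_density l Y U x) = - w U * (parity_density l Y U x - 1)"
      by (simp add: algebra_simps)
    then show ?thesis
      unfolding parity_density_expansion[OF that] sum_distrib_left by (simp only: mult.assoc)
  qed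
  then show ?thesis
    unfolding deficit_def level_eq_avg avg_sum[symmetric] by (intro avg_cong)
qed

lemma level_coef_eq_0:
  assumes "card S \<noteq> k * m"
  shows "level_coef m S = 0"
proof -
  have "level_coef m S = avg (disjoint_seqs I l k) (\<lambda>_. 0)"
    unfolding level_coef_def
    using assms card_block by (intro avg_cong sum.neutral) fastforce
  then show ?thesis by (simp add: avg_def)
qed

lemma abs_level_coef_le_avg:
  "\<bar>level_coef m S\<bar>
      \<le> avg (disjoint_seqs I l k) (\<lambda>U. \<Sum>T | T \<subseteq> {..<l} \<and> card T = m. of_bool (block U T = S))"
proof -
  have "\<bar>level_coef m S\<bar> \<le> avg (disjoint_seqs I l k)
      (\<lambda>U. \<Sum>T | T \<subseteq> {..<l} \<and> card T = m. \<bar>- w U * (\<Prod>i\<in>T. parity_sign (Y i)) * of_bool (block U T = S)\<bar>)"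
    unfolding level_coef_def by (intro order_trans[OF abs_avg_le] avg_mono sum_abs)
  also have "\<dots> \<le> avg (disjoint_seqs I l k) (\<lambda>U. \<Sum>T | T \<subseteq> {..<l} \<and> card T = m. of_bool (block U T = S))"
  proof (intro avg_mono sum_mono)
    fix U T
    have "\<bar>\<Prod>i\<in>T. parity_sign (Y i)\<bar> = 1" by (simp add: abs_prod abs_parity_sign)
    then show "\<bar>- w U * (\<Prod>i\<in>T. parity_sign (Y i)) * of_bool (block U T = S)\<bar> \<le> of_bool (block U T = S)"
      using w_bounds[of U] by (simp add: abs_mult)
  qed
  finally show ?thesis .
qed

lemma abs_level_coef_le:
  assumes S_subset: "S \<subseteq> I"
  shows "\<bar>level_coef m S\<bar> \<le> real (l choose m) / real (card I choose (k * m))"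
proof (cases "card S = k * m")
  case True
  have "\<bar>level_coef m S\<bar>
      \<le> (\<Sum>T | T \<subseteq> {..<l} \<and> card T = m. avg (disjoint_seqs I l k) (\<lambda>U. of_bool (block U T = S)))"
    using abs_level_coef_le_avg[of m S] unfolding avg_sum .
  also have "\<dots> \<le> (\<Sum>T | T \<subseteq> {..<l} \<and> card T = m. 1 / real (card I choose (k * m)))"
    using avg_block_eq_le[OF finite_I _ S_subset] True by (intro sum_mono) auto
  finally show ?thesis by (simp add: n_subsets)
qed (simp add: level_coef_eq_0)

lemma sum_abs_level_coef_le: "(\<Sum>S\<in>Pow I. \<bar>level_coef m S\<bar>) \<le> real (l choose m)"
proof -
  have "(\<Sum>S\<in>Pow I. \<bar>level_coef m S\<bar>)
      \<le> avg (disjoint_seqs I l k) (\<lambda>U. \<Sum>S\<in>Pow I. \<Sum>T | T \<subseteq> {..<l} \<and> card T = m. of_bool (block U T = S))"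
    unfolding avg_sum by (intro sum_mono) (rule abs_level_coef_le_avg[unfolded avg_sum])
  also have "\<dots> \<le> avg (disjoint_seqs I l k) (\<lambda>U. real (l choose m))"
  proof (intro avg_mono)
    fix U
    have "(\<Sum>S\<in>Pow I. \<Sum>T | T \<subseteq> {..<l} \<and> card T = m. of_bool (block U T = S) :: real)
        = (\<Sum>T | T \<subseteq> {..<l} \<and> card T = m. \<Sum>S\<in>Pow I. of_bool (block U T = S))"
      by (rule sum.swap)
    also have "\<dots> \<le> (\<Sum>T | T \<subseteq> {..<l} \<and> card T = m. 1)"
      using finite_I by (intro sum_mono) (simp add: of_bool_def)
    finally show "(\<Sum>S\<in>Pow I. \<Sum>T | T \<subseteq> {..<l} \<and> card T = m. of_bool (block U T = S)) \<le> real (l choose m)"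
      by (simp add: n_subsets)
  qed
  also have "\<dots> \<le> real (l choose m)" by (simp add: avg_def)
  finally show ?thesis .
qed

lemma sum_level_coef_square_le: "(\<Sum>S\<in>Pow I. (level_coef m S)\<^sup>2) \<le> level_weight m"
proof -
  let ?b = "real (l choose m) / real (card I choose (k * m))"
  have "(\<Sum>S\<in>Pow I. (level_coef m S)\<^sup>2) = (\<Sum>S\<in>Pow I. \<bar>level_coef m S\<bar> * \<bar>level_coef m S\<bar>)"
    by (simp add: power2_eq_square)
  also have "\<dots> \<le> (\<Sum>S\<in>Pow I. ?b * \<bar>level_coef m S\<bar>)"
    by (intro sum_mono mult_right_mono abs_level_coef_le) auto
  also have "\<dots> = ?b * (\<Sum>S\<in>Pow I. \<bar>level_coef m S\<bar>)"
    by (simp add: sum_distrib_left)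
  also have "\<dots> \<le> ?b * real (l choose m)"
    by (intro mult_left_mono sum_abs_level_coef_le) auto
  finally show ?thesis by (simp add: level_weight_def power2_eq_square)
qed

lemma moment_level:
  "avg (Pow I) (\<lambda>x. level m x ^ (2 * s))
    \<le> (real (2 * s - 1) ^ min (k * m) (card I - k * m) * level_weight m) ^ s"
proof -
  have "avg (Pow I) (\<lambda>x. level m x ^ (2 * s))
      \<le> (real (2 * s - 1) ^ min (k * m) (card I - k * m) * (\<Sum>S\<in>Pow I. (level_coef m S)\<^sup>2)) ^ s"
    unfolding level_def using level_coef_eq_0 by (intro hypercontractive_homogeneous_min finite_I)
  also have "\<dots> \<le> (real (2 * s - 1) ^ min (k * m) (card I - k * m) * level_weight m) ^ s"
    by (intro power_mono mult_left_mono mult_nonneg_nonneg sum_nonneg sum_level_coef_square_le) auto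
  finally show ?thesis .
qed

lemma second_moment_deficit: "avg (Pow I) (\<lambda>x. (deficit I l k Y w x)\<^sup>2) \<le> (\<Sum>m = 1..l. level_weight m)"
proof -
  let ?c = "\<lambda>S. \<Sum>m = 1..l. level_coef m S"
  have "deficit I l k Y w x = walsh_poly I ?c x" for x
    unfolding deficit_eq_sum_level level_def walsh_poly_def sum_distrib_right by (rule sum.swap)
  then have "avg (Pow I) (\<lambda>x. (deficit I l k Y w x)\<^sup>2) \<le> (\<Sum>S\<in>Pow I. (?c S)\<^sup>2)"
    using hypercontractive[OF finite_I, of ?c 1] by simp
  also have "\<dots> = (\<Sum>S\<in>Pow I. \<Sum>m = 1..l. (level_coef m S)\<^sup>2)"
  proof (intro sum.cong refl)
    fix S
    have single: "(\<Sum>m = 1..l. f (level_coef m S)) = (if n \<in> {1..l} then f (level_coef n S) else 0)"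
      if "card S = k * n" "f 0 = 0" for n and f :: "real \<Rightarrow> real"
    proof -
      have "level_coef m S = 0" if "m \<noteq> n" for m
        using level_coef_eq_0[of S m] \<open>card S = k * n\<close> that k_pos by simp
      then have "(\<Sum>m = 1..l. f (level_coef m S)) = (\<Sum>m = 1..l. if m = n then f (level_coef m S) else 0)"
        using \<open>f 0 = 0\<close> by (intro sum.cong) auto
      then show ?thesis by simp
    qed
    show "(?c S)\<^sup>2 = (\<Sum>m = 1..l. (level_coef m S)\<^sup>2)"
    proof (cases "\<exists>n. card S = k * n")
      case True
      then obtain n where "card S = k * n" by blast
      then show ?thesis using single[of n "\<lambda>a. a"] single[of n "\<lambda>a. a\<^sup>2"] by simp
    next
      case False
      then show ?thesis by (simp add: level_coef_eq_0)
    qed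
  qed
  also have "\<dots> = (\<Sum>m = 1..l. \<Sum>S\<in>Pow I. (level_coef m S)\<^sup>2)" by (rule sum.swap)
  also have "\<dots> \<le> (\<Sum>m = 1..l. level_weight m)" by (intro sum_mono sum_level_coef_square_le)
  finally show ?thesis .
qed

end

section \<open>Exponential moments of the deficit\<close>

definition deficit_moment_le :: "real \<Rightarrow> real \<Rightarrow> 'a set \<Rightarrow> nat \<Rightarrow> nat \<Rightarrow> bool" where
  "deficit_moment_le \<theta> \<epsilon> I l k \<longleftrightarrow>
     (\<forall>Y w. (\<forall>U. 0 \<le> w U \<and> w U \<le> 1) \<longrightarrow> avg (Pow I) (\<lambda>x. exp (\<theta> * deficit I l k Y w x)) \<le> exp (\<theta> * \<epsilon>))"

lemma exp_le_quadratic: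
  fixes x :: real
  assumes "x \<le> 1"
  shows "exp x \<le> 1 + x + x\<^sup>2"
proof (cases "0 \<le> x")
  case True
  then show ?thesis using exp_bound[of x] assms by simp
next
  case False
  define u where "u = - x"
  have u_pos: "u > 0" using False by (simp add: u_def)
  then have pos: "0 < 1 + u + u\<^sup>2 / 2" by (simp add: add_pos_nonneg)
  have "exp (- u) \<le> 1 / (1 + u + u\<^sup>2 / 2)"
    using exp_lower_Taylor_quadratic[of u] u_pos pos by (simp add: exp_minus inverse_eq_divide frac_le)
  also have "\<dots> \<le> 1 - u + u\<^sup>2"
  proof -
    have "(1 - u + u\<^sup>2) * (1 + u + u\<^sup>2 / 2) = 1 + (u\<^sup>2 / 2 + u ^ 3 / 2 + u ^ 4 / 2)"
      by (simp add: field_simps power2_eq_square power3_eq_cube power4_eq_xxxx)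
    then show ?thesis using pos u_pos by (simp add: pos_divide_le_eq)
  qed
  finally show ?thesis by (simp add: u_def)
qed

lemma sum_power_le_geometric:
  fixes q :: real
  assumes "0 \<le> q" "q < 1"
  shows "(\<Sum>m = 1..l. q ^ m) \<le> q / (1 - q)"
proof -
  have "(\<Sum>m = 1..l. q ^ m) = (\<Sum>m<l. q * q ^ m)"
    by (rule sum.reindex_bij_witness[of _ Suc "\<lambda>m. m - 1"]) (auto simp flip: power_Suc)
  also have "\<dots> = q * ((1 - q ^ l) / (1 - q))"
    using assms by (simp add: sum_distrib_left[symmetric] sum_gp_strict)
  also have "\<dots> \<le> q * (1 / (1 - q))"
    using assms by (intro mult_left_mono divide_right_mono) auto
  finally show ?thesis by simp
qed

lemma choose_le_power_min:
  assumes "m \<le> l"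
  shows "l choose m \<le> l ^ min m (l - m)"
  using binomial_le_pow[of m l] binomial_le_pow[of "l - m" l] binomial_symmetric[of m l] assms
  by (simp add: min_def)

lemma choose_square_le_powr:
  assumes k_pos: "1 \<le> k" and fit: "k * l \<le> r" and m_le: "m \<le> l" and r_pos: "1 \<le> r"
  shows "(real (l choose m))\<^sup>2 \<le> (real r powr (2 / real k)) ^ min (k * m) (r - k * m)"
proof -
  define \<mu> d where "\<mu> = min m (l - m)" and "d = min (k * m) (r - k * m)"
  have "k * \<mu> \<le> k * (l - m)" by (simp add: \<mu>_def)
  then have "k * \<mu> \<le> d" using fit by (simp add: \<mu>_def d_def diff_mult_distrib2)
  then have "real k * real \<mu> \<le> real d" by (metis of_nat_le_iff of_nat_mult)
  then have exponent: "real (2 * \<mu>) \<le> 2 / real k * real d" using k_pos by (simp add: field_simps)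
  have "1 * l \<le> k * l" using k_pos by (intro mult_le_mono1)
  then have "l \<le> r" using fit by linarith
  then have "l ^ \<mu> \<le> r ^ \<mu>" by (intro power_mono) auto
  then have "l choose m \<le> r ^ \<mu>" using choose_le_power_min[OF m_le] by (simp add: \<mu>_def)
  then have "real (l choose m) \<le> real r ^ \<mu>" by (metis of_nat_le_iff of_nat_power)
  then have "(real (l choose m))\<^sup>2 \<le> (real r ^ \<mu>)\<^sup>2" by (intro power_mono) auto
  also have "\<dots> = real r powr real (2 * \<mu>)"
    using r_pos powr_realpow[of "real r" "2 * \<mu>"] by (simp add: power_mult[symmetric] mult.commute)
  also have "\<dots> \<le> real r powr (2 / real k * real d)" using r_pos exponent by (intro powr_mono) auto
  also have "\<dots> = (real r powr (2 / real k)) ^ d"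
    unfolding powr_powr[symmetric] using r_pos by (intro powr_realpow) simp
  finally show ?thesis unfolding d_def .
qed

lemma exp_le_choose:
  assumes "exp c * real n \<le> real r" "n \<le> d" "2 * d \<le> r"
  shows "exp (c * real n) \<le> real (r choose d)"
proof (cases "n = 0")
  case True
  have "1 \<le> r choose d" using assms(3) by (simp add: Suc_le_eq)
  then show ?thesis using True by simp
next
  case False
  then have "exp c \<le> real r / real n" using assms(1) by (simp add: pos_le_divide_eq)
  then have "exp c ^ n \<le> (real r / real n) ^ n" by (intro power_mono) auto
  also have "\<dots> \<le> real (r choose n)" using assms by (intro binomial_ge_n_over_k_pow_k) simp
  also have "\<dots> \<le> real (r choose d)" using assms by (intro of_nat_mono binomial_mono) auto
  finally show ?thesis by (simp add: exp_of_nat2_mult)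
qed

lemma exp_sum_le_excess:
  fixes a \<eta> :: "'i \<Rightarrow> real"
  assumes finite_J: "finite J" and \<theta>_nonneg: "0 \<le> \<theta>" and sum_le_1: "(\<Sum>m\<in>J. a m) \<le> 1"
    and \<eta>_pos: "\<And>m. m \<in> J \<Longrightarrow> 0 < \<eta> m"
  shows "exp (\<theta> * (\<Sum>m\<in>J. a m))
    \<le> exp (\<theta> * (\<Sum>m\<in>J. \<eta> m)) + exp \<theta> * (\<Sum>m\<in>J. a m ^ (2 * s m) / \<eta> m ^ (2 * s m))"
proof -
  have excess_nonneg: "0 \<le> a m ^ (2 * s m) / \<eta> m ^ (2 * s m)" for m by (simp add: power_mult)
  show ?thesis
  proof (cases "\<forall>m\<in>J. a m \<le> \<eta> m")
    case True
    then have "exp (\<theta> * (\<Sum>m\<in>J. a m)) \<le> exp (\<theta> * (\<Sum>m\<in>J. \<eta> m))"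
      using \<theta>_nonneg by (simp add: mult_left_mono sum_mono)
    moreover have "0 \<le> exp \<theta> * (\<Sum>m\<in>J. a m ^ (2 * s m) / \<eta> m ^ (2 * s m))"
      by (intro mult_nonneg_nonneg sum_nonneg excess_nonneg) simp
    ultimately show ?thesis by linarith
  next
    case False
    then obtain m where exceeds: "m \<in> J" "\<eta> m < a m" by force
    then have "\<eta> m ^ (2 * s m) \<le> a m ^ (2 * s m)" using \<eta>_pos[of m] by (intro power_mono) auto
    then have "1 \<le> a m ^ (2 * s m) / \<eta> m ^ (2 * s m)" using \<eta>_pos[OF exceeds(1)] by simp
    also have "\<dots> \<le> (\<Sum>m\<in>J. a m ^ (2 * s m) / \<eta> m ^ (2 * s m))"
      using exceeds(1) finite_J excess_nonneg by (intro member_le_sum) auto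
    finally have "exp \<theta> * 1 \<le> exp \<theta> * (\<Sum>m\<in>J. a m ^ (2 * s m) / \<eta> m ^ (2 * s m))"
      by (intro mult_left_mono) auto
    moreover have "exp (\<theta> * (\<Sum>m\<in>J. a m)) \<le> exp \<theta>" using mult_left_mono[OF sum_le_1 \<theta>_nonneg] by simp
    moreover have "0 < exp (\<theta> * (\<Sum>m\<in>J. \<eta> m))" by simp
    ultimately show ?thesis by linarith
  qed
qed

lemma exp_moment_sum_le:
  assumes A_finite_nonempty: "finite A" "A \<noteq> {}" and finite_J: "finite J" and \<theta>_nonneg: "0 \<le> \<theta>"
    and sum_le_1: "\<And>x. x \<in> A \<Longrightarrow> (\<Sum>m\<in>J. f m x) \<le> 1"
    and \<eta>_pos: "\<And>m. m \<in> J \<Longrightarrow> 0 < \<eta> m"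
    and moment: "\<And>m. m \<in> J \<Longrightarrow> \<exists>s. avg A (\<lambda>x. f m x ^ (2 * s)) \<le> \<eta> m ^ (2 * s) * exp (- 2 * \<theta>)"
  shows "avg A (\<lambda>x. exp (\<theta> * (\<Sum>m\<in>J. f m x))) \<le> exp (\<theta> * (\<Sum>m\<in>J. \<eta> m)) + card J * exp (- \<theta>)"
proof -
  obtain s where moment_s: "\<And>m. m \<in> J \<Longrightarrow> avg A (\<lambda>x. f m x ^ (2 * s m)) \<le> \<eta> m ^ (2 * s m) * exp (- 2 * \<theta>)"
    using moment by metis
  have "avg A (\<lambda>x. exp (\<theta> * (\<Sum>m\<in>J. f m x)))
      \<le> avg A (\<lambda>x. exp (\<theta> * (\<Sum>m\<in>J. \<eta> m)) + exp \<theta> * (\<Sum>m\<in>J. f m x ^ (2 * s m) / \<eta> m ^ (2 * s m)))"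
    by (intro avg_mono exp_sum_le_excess finite_J \<theta>_nonneg sum_le_1 \<eta>_pos)
  also have "\<dots> = exp (\<theta> * (\<Sum>m\<in>J. \<eta> m)) + exp \<theta> * (\<Sum>m\<in>J. avg A (\<lambda>x. f m x ^ (2 * s m)) / \<eta> m ^ (2 * s m))"
    by (simp only: avg_add avg_cmult avg_divide avg_sum avg_const[OF A_finite_nonempty])
  also have "\<dots> \<le> exp (\<theta> * (\<Sum>m\<in>J. \<eta> m)) + exp \<theta> * (\<Sum>m\<in>J. exp (- 2 * \<theta>))"
  proof (intro add_left_mono mult_left_mono sum_mono)
    fix m assume "m \<in> J"
    then show "avg A (\<lambda>x. f m x ^ (2 * s m)) / \<eta> m ^ (2 * s m) \<le> exp (- 2 * \<theta>)"
      using moment_s[of m] \<eta>_pos[of m] by (simp add: pos_divide_le_eq mult.commute)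
  qed simp
  also have "exp \<theta> * (\<Sum>m\<in>J. exp (- 2 * \<theta>)) = card J * exp (- \<theta>)"
    by (simp add: exp_add[symmetric] mult.left_commute)
  finally show ?thesis .
qed

lemma sum_power_min_le:
  fixes \<kappa> :: real
  assumes \<kappa>_bounds: "0 \<le> \<kappa>" "\<kappa> \<le> 1 / 2" and k_pos: "1 \<le> k" and fit: "k * l < r"
  shows "(\<Sum>m = 1..l. \<kappa> ^ min (k * m) (r - k * m)) \<le> 4 * \<kappa>"
proof -
  have "\<kappa> ^ min (k * m) (r - k * m) \<le> \<kappa> ^ m + \<kappa> ^ (l + 1 - m)" if m_range: "m \<in> {1..l}" for m
  proof -
    have "1 * m \<le> k * m" "1 * (l - m) \<le> k * (l - m)" "k * m \<le> k * l"
      using m_range k_pos by (intro mult_le_mono1 mult_le_mono2; simp)+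
    then have "m \<le> k * m" "l + 1 - m \<le> r - k * m"
      using m_range fit unfolding diff_mult_distrib2 atLeastAtMost_iff by linarith+
    then have "\<kappa> ^ (k * m) \<le> \<kappa> ^ m" "\<kappa> ^ (r - k * m) \<le> \<kappa> ^ (l + 1 - m)"
      using \<kappa>_bounds by (auto intro!: power_decreasing)
    then show ?thesis using \<kappa>_bounds by (auto simp: min_def add_increasing add_increasing2)
  qed
  then have "(\<Sum>m = 1..l. \<kappa> ^ min (k * m) (r - k * m)) \<le> (\<Sum>m = 1..l. \<kappa> ^ m) + (\<Sum>m = 1..l. \<kappa> ^ (l + 1 - m))"
    unfolding sum.distrib[symmetric] by (rule sum_mono)
  also have "(\<Sum>m = 1..l. \<kappa> ^ (l + 1 - m)) = (\<Sum>m = 1..l. \<kappa> ^ m)"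
    by (rule sum.reindex_bij_witness[of _ "\<lambda>m. l + 1 - m" "\<lambda>m. l + 1 - m"]) auto
  also have "(\<Sum>m = 1..l. \<kappa> ^ m) \<le> \<kappa> / (1 - \<kappa>)"
    using \<kappa>_bounds by (intro sum_power_le_geometric) auto
  also have "\<dots> \<le> \<kappa> / (1 / 2)" using \<kappa>_bounds by (intro divide_left_mono) auto
  finally show ?thesis by simp
qed

context random_blocks
begin

lemma exp_moment_deficit_quadratic:
  assumes "0 \<le> \<theta>" "\<theta> \<le> 1"
  shows "avg (Pow I) (\<lambda>x. exp (\<theta> * deficit I l k Y w x)) \<le> exp (\<theta>\<^sup>2 * (\<Sum>m = 1..l. level_weight m))"
proof -
  let ?D = "deficit I l k Y w"
  have "exp (\<theta> * ?D x) \<le> 1 + \<theta> * ?D x + \<theta>\<^sup>2 * (?D x)\<^sup>2" for x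
  proof -
    have "\<theta> * ?D x \<le> \<theta> * 1" using assms deficit_le_1[OF w_bounds] by (intro mult_left_mono) auto
    then show ?thesis using exp_le_quadratic[of "\<theta> * ?D x"] assms by (simp add: power_mult_distrib)
  qed
  then have "avg (Pow I) (\<lambda>x. exp (\<theta> * ?D x)) \<le> avg (Pow I) (\<lambda>x. 1 + \<theta> * ?D x + \<theta>\<^sup>2 * (?D x)\<^sup>2)"
    by (intro avg_mono)
  also have "\<dots> = 1 + \<theta>\<^sup>2 * avg (Pow I) (\<lambda>x. (?D x)\<^sup>2)"
    by (simp add: avg_add avg_cmult avg_Pow_const[OF finite_I] avg_deficit[OF finite_I k_pos])
  also have "\<dots> \<le> 1 + \<theta>\<^sup>2 * (\<Sum>m = 1..l. level_weight m)"
    by (intro add_left_mono mult_left_mono second_moment_deficit) auto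
  also have "\<dots> \<le> exp (\<theta>\<^sup>2 * (\<Sum>m = 1..l. level_weight m))" by (rule exp_ge_add_one_self)
  finally show ?thesis .
qed

lemma mult_le_card: "m \<le> l \<Longrightarrow> k * m \<le> card I"
  using mult_le_mono2[of m l k] blocks_fit by linarith

lemma choose_power_le_card: "m \<le> l \<Longrightarrow> n \<le> k \<Longrightarrow> (l choose m) ^ n \<le> k * l choose (k * m)"
  by (rule order_trans[OF power_increasing choose_power_le]) (auto simp: Suc_le_eq)

lemma level_weight_le_power:
  assumes k_ge_2: "2 \<le> k" and m_range: "m \<in> {1..l}"
  shows "level_weight m \<le> (real (k * l) / real (card I)) ^ (k * m)"
proof -
  have "0 < k * m" "k * m \<le> card I" using m_range k_ge_2 mult_le_card by auto
  then have positive: "0 < card I" "0 < card I choose (k * m)" by (linarith, simp)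
  have "(real (l choose m))\<^sup>2 \<le> real (k * l choose (k * m))"
    using choose_power_le_card[of m 2] k_ge_2 m_range
    by (metis atLeastAtMost_iff of_nat_le_iff of_nat_power)
  then have "level_weight m \<le> real (k * l choose (k * m)) / real (card I choose (k * m))"
    unfolding level_weight_def by (rule divide_right_mono) simp
  also have "\<dots> \<le> real (k * l) ^ (k * m) / real (card I) ^ (k * m)"
  proof -
    have "real (k * l choose (k * m)) * real (card I) ^ (k * m)
        \<le> real (card I choose (k * m)) * real (k * l) ^ (k * m)"
      using choose_mult_power_le[OF blocks_fit, of "k * m"]
      by (metis of_nat_le_iff of_nat_mult of_nat_power)
    then show ?thesis using positive by (simp add: divide_le_eq le_divide_eq mult.commute)
  qed
  finally show ?thesis by (simp only: power_divide)
qed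

lemma sum_level_weight_le:
  assumes k_ge_2: "2 \<le> k" and fit: "k * l < card I"
  shows "(\<Sum>m = 1..l. level_weight m) \<le> real (k * l) / (real (card I) - real (k * l))"
proof -
  define q where "q = real (k * l) / real (card I)"
  have less: "real (k * l) < real (card I)" using fit by (simp only: of_nat_less_iff)
  then have q_bounds: "0 \<le> q" "q < 1" by (auto simp: q_def divide_less_eq_1 simp del: of_nat_mult)
  have "level_weight m \<le> q ^ m" if m_range: "m \<in> {1..l}" for m
  proof -
    have "1 * m \<le> k * m" using k_ge_2 by (intro mult_le_mono1) simp
    then have "q ^ (k * m) \<le> q ^ m" using q_bounds by (intro power_decreasing) auto
    then show ?thesis using level_weight_le_power[OF k_ge_2 m_range] unfolding q_def by linarith
  qed
  then have "(\<Sum>m = 1..l. level_weight m) \<le> (\<Sum>m = 1..l. q ^ m)" by (rule sum_mono)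
  also have "\<dots> \<le> q / (1 - q)" using q_bounds by (rule sum_power_le_geometric)
  also have "\<dots> = real (k * l) / (real (card I) - real (k * l))"
    using less unfolding q_def by (simp add: field_simps del: of_nat_mult)
  finally show ?thesis .
qed

definition codegree :: "nat \<Rightarrow> nat" where
  "codegree m = min (k * m) (card I - k * m)"

lemma codegree_le_half: "2 * codegree m \<le> card I"
  unfolding codegree_def by arith

lemma choose_codegree:
  assumes "m \<le> l"
  shows "card I choose codegree m = card I choose (k * m)"
  using binomial_symmetric[OF mult_le_card[OF assms]] by (simp add: codegree_def min_def)

lemma moment_level_le_powr:
  assumes m_le: "m \<le> l" and r_pos: "1 \<le> card I"
  shows "avg (Pow I) (\<lambda>x. level m x ^ (2 * s))
    \<le> (real (2 * s - 1) * real (codegree m) * real (card I) powr (2 / real k - 1)) ^ (codegree m * s)"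
proof -
  define d where "d = codegree m"
  let ?r = "real (card I)"
  have pos: "0 < (?r / real d) ^ d" using r_pos by (cases "d = 0") auto
  have "level_weight m \<le> (?r powr (2 / real k)) ^ d / (?r / real d) ^ d"
    unfolding level_weight_def choose_codegree[OF m_le, symmetric] d_def[symmetric]
  proof (rule frac_le)
    show "(real (l choose m))\<^sup>2 \<le> (?r powr (2 / real k)) ^ d"
      unfolding d_def codegree_def using m_le r_pos by (intro choose_square_le_powr k_pos blocks_fit)
    show "(?r / real d) ^ d \<le> real (card I choose d)"
      using codegree_le_half[of m] by (intro binomial_ge_n_over_k_pow_k) (simp add: d_def)
  qed (use pos in auto)
  also have "\<dots> = (real d * ?r powr (2 / real k - 1)) ^ d"
    using r_pos by (simp add: power_divide[symmetric] powr_diff mult.commute)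
  finally have "real (2 * s - 1) ^ d * level_weight m
      \<le> real (2 * s - 1) ^ d * (real d * ?r powr (2 / real k - 1)) ^ d"
    by (intro mult_left_mono) auto
  also have "\<dots> = (real (2 * s - 1) * real d * ?r powr (2 / real k - 1)) ^ d"
    by (simp only: power_mult_distrib mult.assoc)
  finally have "(real (2 * s - 1) ^ d * level_weight m) ^ s
      \<le> ((real (2 * s - 1) * real d * ?r powr (2 / real k - 1)) ^ d) ^ s"
    by (intro power_mono) (auto simp: level_weight_def)
  then show ?thesis
    using moment_level[of m s] by (simp add: d_def codegree_def power_mult)
qed

lemma level_weight_cube_le:
  assumes "3 \<le> k" "m \<le> l"
  shows "level_weight m ^ 3 \<le> 1 / real (card I choose (k * m))"
proof -
  let ?b = "real (card I choose (k * m))"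
  have "(l choose m) ^ 3 \<le> card I choose (k * m)"
    using choose_power_le_card[OF assms(2,1)] binomial_right_mono[OF blocks_fit] by (rule order_trans)
  then have "real (l choose m) ^ 3 \<le> ?b" by (metis of_nat_le_iff of_nat_power)
  then have "(real (l choose m) ^ 3)\<^sup>2 / ?b ^ 3 \<le> ?b\<^sup>2 / ?b ^ 3"
    by (intro divide_right_mono power_mono) auto
  moreover have "level_weight m ^ 3 = (real (l choose m) ^ 3)\<^sup>2 / ?b ^ 3"
    by (simp add: level_weight_def power_divide power_mult[symmetric] mult.commute)
  moreover have "?b\<^sup>2 / ?b ^ 3 = 1 / ?b"
    using mult_le_card[OF assms(2)] by (simp add: power2_eq_square power3_eq_cube)
  ultimately show ?thesis by linarith
qed

end

locale large_blocks = random_blocks +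
  fixes \<kappa> \<theta> :: real
  assumes k_ge_3: "3 \<le> k" and blocks_fit_strict: "k * l < card I"
    and \<kappa>_pos: "0 < \<kappa>" and \<kappa>_le: "\<kappa> \<le> exp (- 2)"
    and \<theta>_eq: "\<theta> = \<kappa>\<^sup>2 / (6 * exp 1) * real (card I) powr (1 - 2 / real k)" and \<theta>_ge_1: "1 \<le> \<theta>"
begin

lemma card_I_pos: "1 \<le> card I"
  using blocks_fit_strict by linarith

lemma \<theta>_mult_powr: "6 * \<theta> * real (card I) powr (2 / real k - 1) = \<kappa>\<^sup>2 * exp (- 1)"
proof -
  let ?r = "real (card I)"
  have "6 * \<theta> * ?r powr (2 / real k - 1)
      = 6 * (\<kappa>\<^sup>2 / (6 * exp 1)) * (?r powr (1 - 2 / real k) * ?r powr (2 / real k - 1))"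
    unfolding \<theta>_eq by (simp only: mult.assoc)
  also have "?r powr (1 - 2 / real k) * ?r powr (2 / real k - 1) = 1"
    using card_I_pos by (simp add: powr_add[symmetric])
  also have "6 * (\<kappa>\<^sup>2 / (6 * exp 1)) = \<kappa>\<^sup>2 * exp (- 1)"
    by (simp add: exp_minus field_simps)
  finally show ?thesis by (simp only: mult_1_right)
qed

lemma moment_level_small_codegree:
  assumes m_range: "m \<in> {1..l}" and small: "real (codegree m) \<le> 2 * \<theta>"
  shows "\<exists>s. avg (Pow I) (\<lambda>x. level m x ^ (2 * s)) \<le> (\<kappa> ^ codegree m) ^ (2 * s) * exp (- 2 * \<theta>)"
proof
  define d where "d = codegree m"
  define s where "s = nat \<lceil>2 * \<theta> / real d\<rceil>"
  let ?r = "real (card I)"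
  have "0 < k * m" "k * m \<le> k * l" using m_range k_pos by auto
  then have "0 < k * m" "k * m < card I" using blocks_fit_strict by linarith+
  then have d_pos: "0 < real d" by (simp add: d_def codegree_def min_def)
  have quotient: "1 \<le> 2 * \<theta> / real d" using small d_pos by (simp add: d_def)
  then have s_bounds: "2 * \<theta> / real d \<le> real s" "real s \<le> 2 * \<theta> / real d + 1" unfolding s_def by linarith+
  have "real (2 * s - 1) = 2 * real s - 1" using s_bounds(1) quotient by simp
  then have "real (2 * s - 1) * real d \<le> (6 * \<theta> / real d) * real d"
    using s_bounds(2) quotient by (intro mult_right_mono) auto
  then have "real (2 * s - 1) * real d * ?r powr (2 / real k - 1) \<le> 6 * \<theta> * ?r powr (2 / real k - 1)"
    using d_pos by (intro mult_right_mono) auto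
  also have "\<dots> = \<kappa>\<^sup>2 * exp (- 1)" by (rule \<theta>_mult_powr)
  finally have "(real (2 * s - 1) * real d * ?r powr (2 / real k - 1)) ^ (d * s)
      \<le> (\<kappa>\<^sup>2 * exp (- 1)) ^ (d * s)"
    by (rule power_mono) simp
  moreover have "avg (Pow I) (\<lambda>x. level m x ^ (2 * s))
      \<le> (real (2 * s - 1) * real d * ?r powr (2 / real k - 1)) ^ (d * s)"
    unfolding d_def using m_range card_I_pos by (intro moment_level_le_powr) auto
  moreover have "(\<kappa>\<^sup>2 * exp (- 1)) ^ (d * s) = (\<kappa> ^ d) ^ (2 * s) * exp (- real (d * s))"
  proof -
    have "exp (- 1 :: real) ^ (d * s) = exp (- real (d * s))"
      using exp_of_nat_mult[of "d * s" "- 1 :: real"] by simp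
    then show ?thesis by (simp only: power_mult_distrib power_mult[symmetric] ac_simps)
  qed
  moreover have "(\<kappa> ^ d) ^ (2 * s) * exp (- real (d * s)) \<le> (\<kappa> ^ d) ^ (2 * s) * exp (- 2 * \<theta>)"
    using s_bounds(1) d_pos \<kappa>_pos by (intro mult_left_mono) (auto simp: divide_le_eq mult.commute)
  ultimately show "avg (Pow I) (\<lambda>x. level m x ^ (2 * s)) \<le> (\<kappa> ^ codegree m) ^ (2 * s) * exp (- 2 * \<theta>)"
    unfolding d_def by linarith
qed

lemma exp_le_choose_codegree:
  assumes "2 * \<theta> < real (codegree m)"
  shows "exp (9 * \<theta>) \<le> real (card I choose codegree m)"
proof -
  define n where "n = nat \<lceil>2 * \<theta>\<rceil>"
  let ?r = "real (card I)"
  have n_bounds: "2 * \<theta> \<le> real n" "real n \<le> 3 * \<theta>" "n \<le> codegree m"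
    using \<theta>_ge_1 assms unfolding n_def by linarith+
  have "?r powr (1 - 2 / real k) \<le> ?r powr 1" using card_I_pos by (intro powr_mono) auto
  then have "\<theta> \<le> \<kappa>\<^sup>2 / (6 * exp 1) * ?r" unfolding \<theta>_eq using card_I_pos by (intro mult_left_mono) auto
  also have "\<dots> \<le> exp (- 9 / 2) / 3 * ?r"
  proof (intro mult_right_mono)
    have "\<kappa>\<^sup>2 \<le> (exp (- 2))\<^sup>2" using \<kappa>_pos \<kappa>_le by (intro power_mono) auto
    also have "\<dots> = exp (- 5) * exp 1" by (simp add: exp_double[symmetric] exp_add[symmetric])
    also have "\<dots> \<le> (2 * exp (- 9 / 2)) * exp 1"
      by (intro mult_right_mono) (auto intro: order_trans[of _ "exp (- 9 / 2)"])
    finally show "\<kappa>\<^sup>2 / (6 * exp 1) \<le> exp (- 9 / 2) / 3" by (simp add: field_simps)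
  qed simp
  finally have "real n \<le> exp (- 9 / 2) * ?r" using n_bounds(2) by linarith
  then have "exp (9 / 2) * real n \<le> exp (9 / 2) * (exp (- 9 / 2) * ?r)" by (intro mult_left_mono) auto
  also have "\<dots> = ?r" by (simp add: mult.assoc[symmetric] exp_add[symmetric])
  finally have "exp (9 / 2 * real n) \<le> real (card I choose codegree m)"
    using n_bounds(3) codegree_le_half by (intro exp_le_choose)
  moreover have "exp (9 * \<theta>) \<le> exp (9 / 2 * real n)" using n_bounds(1) by simp
  ultimately show ?thesis by linarith
qed

lemma second_moment_level_large_codegree:
  assumes m_le: "m \<le> l" and large: "2 * \<theta> < real (codegree m)"
  shows "avg (Pow I) (\<lambda>x. level m x ^ (2 * 1)) \<le> exp (- \<theta> / 2) ^ (2 * 1) * exp (- 2 * \<theta>)"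
proof -
  have "level_weight m ^ 3 \<le> 1 / real (card I choose codegree m)"
    using level_weight_cube_le[OF k_ge_3 m_le] by (simp add: choose_codegree[OF m_le])
  also have "\<dots> \<le> 1 / exp (9 * \<theta>)"
    by (intro frac_le exp_le_choose_codegree[OF large]) auto
  also have "\<dots> = exp (- 3 * \<theta>) ^ 3"
    using exp_of_nat_mult[of 3 "- 3 * \<theta>"] by (simp add: exp_minus inverse_eq_divide)
  finally have "level_weight m \<le> exp (- 3 * \<theta>)"
    by (subst (asm) power_mono_iff) (auto simp: level_weight_def)
  also have "\<dots> = exp (- \<theta> / 2) ^ (2 * 1) * exp (- 2 * \<theta>)"
    by (simp add: exp_of_nat_mult[symmetric] exp_add[symmetric])
  finally show ?thesis using moment_level[of m 1] by simp
qed

lemma moment_level_le: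
  assumes m_range: "m \<in> {1..l}"
  shows "\<exists>s. avg (Pow I) (\<lambda>x. level m x ^ (2 * s))
      \<le> (\<kappa> ^ codegree m + exp (- \<theta> / 2)) ^ (2 * s) * exp (- 2 * \<theta>)"
proof -
  let ?\<eta> = "\<kappa> ^ codegree m + exp (- \<theta> / 2)"
  obtain a s where "avg (Pow I) (\<lambda>x. level m x ^ (2 * s)) \<le> a ^ (2 * s) * exp (- 2 * \<theta>)"
    and a_cases: "a = \<kappa> ^ codegree m \<or> a = exp (- \<theta> / 2)"
    using moment_level_small_codegree[OF m_range] second_moment_level_large_codegree[of m] m_range
    by (metis atLeastAtMost_iff not_le)
  moreover have "a ^ (2 * s) * exp (- 2 * \<theta>) \<le> ?\<eta> ^ (2 * s) * exp (- 2 * \<theta>)"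
    using a_cases \<kappa>_pos by (intro mult_right_mono power_mono) auto
  ultimately show ?thesis by (meson order_trans)
qed

lemma exp_moment_deficit:
  "avg (Pow I) (\<lambda>x. exp (\<theta> * deficit I l k Y w x)) \<le> exp (\<theta> * (4 * \<kappa> + 2 * real l * exp (- \<theta> / 2)))"
proof -
  define \<eta> where "\<eta> m = \<kappa> ^ codegree m + exp (- \<theta> / 2)" for m
  define H where "H = 4 * \<kappa> + real l * exp (- \<theta> / 2)"
  have "exp (- 2) \<le> (1 / 2 :: real)" using exp_ge_add_one_self[of 2] by (simp add: exp_minus field_simps)
  then have "(\<Sum>m = 1..l. \<kappa> ^ codegree m) \<le> 4 * \<kappa>"
    unfolding codegree_def using \<kappa>_pos \<kappa>_le by (intro sum_power_min_le k_pos blocks_fit_strict) auto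
  then have "(\<Sum>m = 1..l. \<eta> m) \<le> H" by (simp add: \<eta>_def H_def sum.distrib)
  then have "exp (\<theta> * (\<Sum>m = 1..l. \<eta> m)) \<le> exp (\<theta> * H)" using \<theta>_ge_1 by simp
  moreover have "avg (Pow I) (\<lambda>x. exp (\<theta> * (\<Sum>m = 1..l. level m x)))
      \<le> exp (\<theta> * (\<Sum>m = 1..l. \<eta> m)) + real (card {1..l}) * exp (- \<theta>)"
    using finite_I \<theta>_ge_1 \<kappa>_pos moment_level_le deficit_le_1[of w I l k Y, OF w_bounds]
    unfolding deficit_eq_sum_level \<eta>_def by (intro exp_moment_sum_le) (auto simp: add_pos_pos)
  ultimately have "avg (Pow I) (\<lambda>x. exp (\<theta> * deficit I l k Y w x)) \<le> exp (\<theta> * H) + real l * exp (- \<theta>)"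
    unfolding deficit_eq_sum_level card_atLeastAtMost diff_Suc_1 by linarith
  also have "real l * exp (- \<theta>) \<le> exp (\<theta> * H) * (\<theta> * (real l * exp (- \<theta> / 2)))"
  proof -
    have "1 * (1 * (real l * exp (- \<theta>))) \<le> exp (\<theta> * H) * (\<theta> * (real l * exp (- \<theta> / 2)))"
      using \<theta>_ge_1 \<kappa>_pos by (intro mult_mono) (auto simp: H_def)
    then show ?thesis by simp
  qed
  also have "exp (\<theta> * H) + exp (\<theta> * H) * (\<theta> * (real l * exp (- \<theta> / 2)))
      = exp (\<theta> * H) * (1 + \<theta> * (real l * exp (- \<theta> / 2)))"
    by (simp add: algebra_simps)
  also have "\<dots> \<le> exp (\<theta> * H) * exp (\<theta> * (real l * exp (- \<theta> / 2)))"
    by (intro mult_left_mono exp_ge_add_one_self) auto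
  also have "\<dots> = exp (\<theta> * (4 * \<kappa> + 2 * real l * exp (- \<theta> / 2)))"
    unfolding exp_add[symmetric] H_def by (simp add: algebra_simps)
  finally show ?thesis by simp
qed

end

lemma deficit_moment_le_2:
  fixes \<delta> \<epsilon> :: real
  assumes card_I: "real (card I) = (2 + \<delta>) * real l" "0 < card I" and \<delta>_pos: "0 < \<delta>"
    and \<theta>_bounds: "0 \<le> \<theta>" "\<theta> \<le> 1" "\<theta> \<le> \<epsilon> * \<delta> / 2"
  shows "deficit_moment_le \<theta> \<epsilon> I l 2"
  unfolding deficit_moment_le_def
proof (intro allI impI)
  fix Y :: "nat \<Rightarrow> bool" and w :: "'a list list \<Rightarrow> real"
  assume w_bounds: "\<forall>U. 0 \<le> w U \<and> w U \<le> 1"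
  have l_pos: "0 < real l" using card_I by (cases "l = 0") auto
  then have "real (2 * l) < real (card I)" using \<delta>_pos unfolding card_I by (simp add: algebra_simps)
  then have fit: "2 * l < card I" by linarith
  interpret random_blocks I l 2 Y w
    using fit w_bounds card_I(2) by unfold_locales (auto intro: card_ge_0_finite)
  have "(\<Sum>m = 1..l. level_weight m) \<le> real (2 * l) / (real (card I) - real (2 * l))"
    using fit by (intro sum_level_weight_le) auto
  also have "\<dots> = 2 / \<delta>" using l_pos \<delta>_pos unfolding card_I by (simp add: field_simps)
  finally have "\<theta>\<^sup>2 * (\<Sum>m = 1..l. level_weight m) \<le> \<theta>\<^sup>2 * (2 / \<delta>)" by (rule mult_left_mono) simp
  also have "\<dots> \<le> \<theta> * \<epsilon>"
  proof -
    have "\<theta> * \<theta> \<le> \<theta> * (\<epsilon> * \<delta> / 2)" using \<theta>_bounds by (intro mult_left_mono) auto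
    then show ?thesis using \<delta>_pos by (simp add: power2_eq_square field_simps)
  qed
  finally have "exp (\<theta>\<^sup>2 * (\<Sum>m = 1..l. level_weight m)) \<le> exp (\<theta> * \<epsilon>)" by simp
  then show "avg (Pow I) (\<lambda>x. exp (\<theta> * deficit I l 2 Y w x)) \<le> exp (\<theta> * \<epsilon>)"
    using exp_moment_deficit_quadratic[OF \<theta>_bounds(1,2)] by linarith
qed

lemma deficit_moment_le_ge_3:
  fixes \<kappa> a \<epsilon> :: real
  assumes k_ge_3: "3 \<le> k" and fit: "k * l < card I" and \<kappa>_bounds: "0 < \<kappa>" "\<kappa> \<le> exp (- 2)" "8 * \<kappa> \<le> \<epsilon>"
    and a_eq: "a = \<kappa>\<^sup>2 / (6 * exp 1)"
    and large: "2 * real (card I) * exp (- (a * real (card I) powr (1 / 3)) / 2) \<le> \<epsilon> / 2"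
      "1 \<le> a * real (card I) powr (1 / 3)"
  shows "deficit_moment_le (a * real (card I) powr (1 - 2 / real k)) \<epsilon> I l k"
  unfolding deficit_moment_le_def
proof (intro allI impI)
  fix Y :: "nat \<Rightarrow> bool" and w :: "'a list list \<Rightarrow> real"
  assume w_bounds: "\<forall>U. 0 \<le> w U \<and> w U \<le> 1"
  define \<theta> where "\<theta> = a * real (card I) powr (1 - 2 / real k)"
  have "real (card I) powr (1 / 3) \<le> real (card I) powr (1 - 2 / real k)"
    using fit k_ge_3 by (intro powr_mono) (auto simp: field_simps)
  then have \<theta>_lower: "a * real (card I) powr (1 / 3) \<le> \<theta>"
    unfolding \<theta>_def a_eq by (rule mult_left_mono) simp
  then have "1 \<le> \<theta>" using large(2) by linarith
  then interpret large_blocks I l k Y w \<kappa> \<theta>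
    using k_ge_3 fit \<kappa>_bounds w_bounds by unfold_locales (auto simp: \<theta>_def a_eq intro: card_ge_0_finite)
  have "1 * l \<le> k * l" using k_ge_3 by (intro mult_le_mono1) simp
  then have "l \<le> card I" using fit by linarith
  then have "2 * real l * exp (- \<theta> / 2)
      \<le> 2 * real (card I) * exp (- (a * real (card I) powr (1 / 3)) / 2)"
    using \<theta>_lower by (intro mult_mono) auto
  then have "4 * \<kappa> + 2 * real l * exp (- \<theta> / 2) \<le> \<epsilon>" using large(1) \<kappa>_bounds(3) by linarith
  then have "exp (\<theta> * (4 * \<kappa> + 2 * real l * exp (- \<theta> / 2))) \<le> exp (\<theta> * \<epsilon>)" using \<theta>_ge_1 by simp
  then show "avg (Pow I) (\<lambda>x. exp (a * real (card I) powr (1 - 2 / real k) * deficit I l k Y w x))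
      \<le> exp (a * real (card I) powr (1 - 2 / real k) * \<epsilon>)"
    using exp_moment_deficit unfolding \<theta>_def by linarith
qed

lemma eventually_exp_neg_powr_small:
  fixes a \<epsilon> :: real
  assumes "0 < a" "0 < \<epsilon>"
  shows "eventually (\<lambda>x. 2 * x * exp (- (a * x powr (1 / 3)) / 2) \<le> \<epsilon> \<and> 1 \<le> a * x powr (1 / 3)) at_top"
proof (rule eventually_conj)
  have "((\<lambda>x. 2 * x * exp (- (a * x powr (1 / 3)) / 2)) \<longlongrightarrow> 0) at_top"
    using assms(1) by real_asymp
  then have "eventually (\<lambda>x. 2 * x * exp (- (a * x powr (1 / 3)) / 2) < \<epsilon>) at_top"
    using assms(2) by (rule order_tendstoD(2))
  then show "eventually (\<lambda>x. 2 * x * exp (- (a * x powr (1 / 3)) / 2) \<le> \<epsilon>) at_top"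
    by (rule eventually_mono) simp
  show "eventually (\<lambda>x. 1 \<le> a * x powr (1 / 3)) at_top" using assms(1) by real_asymp
qed

theorem deficit_moment_le_uniform:
  fixes \<delta> \<epsilon> :: real
  assumes \<delta>_pos: "0 < \<delta>" and \<epsilon>_pos: "0 < \<epsilon>"
  obtains a :: real and R :: nat where "0 < a"
    and "\<And>k l (I :: 'a set). 2 \<le> k \<Longrightarrow> real (card I) = (real k + \<delta>) * real l \<Longrightarrow> R \<le> card I \<Longrightarrow>
      deficit_moment_le (a * real (card I) powr (1 - 2 / real k)) \<epsilon> I l k"
proof -
  define \<kappa> where "\<kappa> = min (exp (- 2)) (min (\<epsilon> / 8) (\<epsilon> * \<delta> / 2))"
  have \<kappa>_bounds: "0 < \<kappa>" "\<kappa> \<le> exp (- 2)" "8 * \<kappa> \<le> \<epsilon>" "\<kappa> \<le> \<epsilon> * \<delta> / 2"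
    using \<epsilon>_pos \<delta>_pos by (auto simp: \<kappa>_def)
  have "\<kappa> \<le> 1" using \<kappa>_bounds(2) by (rule order_trans) simp
  define a where "a = \<kappa>\<^sup>2 / (6 * exp 1)"
  have "0 < a" using \<kappa>_bounds(1) by (simp add: a_def)
  have "1 * 1 \<le> 6 * exp (1 :: real)" by (intro mult_mono) auto
  then have "\<kappa> * \<kappa> \<le> \<kappa> * (6 * exp 1)" using \<kappa>_bounds(1) \<open>\<kappa> \<le> 1\<close> by (intro mult_left_mono) auto
  then have "a \<le> \<kappa>" by (simp add: a_def power2_eq_square divide_le_eq)
  obtain x\<^sub>0 where x\<^sub>0: "\<And>x. x\<^sub>0 \<le> x \<Longrightarrow>
      2 * x * exp (- (a * x powr (1 / 3)) / 2) \<le> \<epsilon> / 2 \<and> 1 \<le> a * x powr (1 / 3)"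
    using eventually_exp_neg_powr_small[of a "\<epsilon> / 2"] \<open>0 < a\<close> \<epsilon>_pos
    unfolding eventually_at_top_linorder by auto
  show thesis
  proof (rule that[OF \<open>0 < a\<close>])
    fix k l :: nat and I :: "'a set"
    assume k_ge_2: "2 \<le> k" and card_I: "real (card I) = (real k + \<delta>) * real l"
        and card_I_large: "max 1 (nat \<lceil>x\<^sub>0\<rceil>) \<le> card I"
    then have pos: "0 < card I" and "x\<^sub>0 \<le> real (card I)" by linarith+
    note large = x\<^sub>0[OF this(2)]
    show "deficit_moment_le (a * real (card I) powr (1 - 2 / real k)) \<epsilon> I l k"
    proof (cases "k = 2")
      case True
      have "deficit_moment_le a \<epsilon> I l 2"
        using card_I True pos \<delta>_pos \<open>0 < a\<close> \<open>a \<le> \<kappa>\<close> \<kappa>_bounds(4) \<open>\<kappa> \<le> 1\<close>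
        by (intro deficit_moment_le_2) auto
      then show ?thesis using True pos by simp
    next
      case False
      have "0 < real l" using card_I pos by (cases "l = 0") auto
      then have "real (k * l) < real (card I)" unfolding card_I using \<delta>_pos by (simp add: algebra_simps)
      then have "k * l < card I" by linarith
      with False k_ge_2 \<kappa>_bounds(1-3) large show ?thesis
        by (intro deficit_moment_le_ge_3[where \<kappa> = \<kappa>]) (auto simp: a_def)
    qed
  qed
qed

section \<open>Expectations under finitely supported distributions\<close>

lemma expectation_bind_finite:
  fixes h :: "'b \<Rightarrow> real"
  assumes "finite (set_pmf p)" "\<And>x. x \<in> set_pmf p \<Longrightarrow> finite (set_pmf (q x))"
  shows "\<E> (bind_pmf p q) h = \<E> p (\<lambda>x. \<E> (q x) h)"
  using assms by (subst pmf_expectation_bind[of "set_pmf p"])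
      (simp_all add: integral_measure_pmf[of "set_pmf p"])

lemma expectation_swap_finite:
  fixes h :: "'a \<Rightarrow> 'b \<Rightarrow> real"
  assumes "finite (set_pmf p)" "finite (set_pmf q)"
  shows "\<E> p (\<lambda>x. \<E> q (h x))
    = \<E> q (\<lambda>y. \<E> p (\<lambda>x. h x y))"
  using assms
  by (simp add: integral_measure_pmf[of "set_pmf p"] integral_measure_pmf[of "set_pmf q"]
      sum_distrib_left sum.swap[of _ "set_pmf q" "set_pmf p"] mult.left_commute)

lemma expectation_mono_finite:
  fixes f g :: "'a \<Rightarrow> real"
  assumes "finite (set_pmf p)" "\<And>x. x \<in> set_pmf p \<Longrightarrow> f x \<le> g x"
  shows "\<E> p f \<le> \<E> p g"
  using assms by (intro integral_mono_AE integrable_measure_pmf_finite AE_pmfI) auto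

lemma expectation_sum_finite:
  fixes f :: "'i \<Rightarrow> 'a \<Rightarrow> real"
  assumes "finite (set_pmf p)"
  shows "\<E> p (\<lambda>x. \<Sum>i\<in>J. f i x) = (\<Sum>i\<in>J. \<E> p (f i))"
  by (intro Bochner_Integration.integral_sum integrable_measure_pmf_finite assms)

lemma expectation_avg_finite:
  fixes f :: "'i \<Rightarrow> 'a \<Rightarrow> real"
  assumes "finite (set_pmf p)"
  shows "\<E> p (\<lambda>x. avg J (\<lambda>i. f i x)) = avg J (\<lambda>i. \<E> p (f i))"
  by (simp add: avg_def expectation_sum_finite[OF assms])

lemma expectation_affine_finite:
  fixes f :: "'a \<Rightarrow> real"
  assumes "finite (set_pmf p)"
  shows "\<E> p (\<lambda>x. a * f x + b) = a * \<E> p f + b"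
  using assms by (simp add: integrable_measure_pmf_finite)

text \<open>A union bound over the possible values of \<open>f\<close>, followed by Jensen's inequality for \<open>exp\<close>.\<close>

lemma expectation_le_ln_card_plus:
  fixes F :: "'m \<Rightarrow> 'x \<Rightarrow> real"
  assumes finite_p: "finite (set_pmf p)" and messages: "finite M" "\<And>x. x \<in> set_pmf p \<Longrightarrow> f x \<in> M"
    and moment: "\<And>\<mu>. \<mu> \<in> M \<Longrightarrow> \<E> p (\<lambda>x. exp (F \<mu> x)) \<le> exp c"
  shows "\<E> p (\<lambda>x. F (f x) x) \<le> ln (card M) + c"
proof -
  define b where "b = ln (card M) + c"
  have "M \<noteq> {}" using messages(2) set_pmf_not_empty[of p] by blast
  then have exp_b: "card M * exp c = exp b" using messages(1) by (simp add: b_def exp_add card_gt_0_iff)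
  have "\<E> p (\<lambda>x. exp (F (f x) x)) \<le> \<E> p (\<lambda>x. \<Sum>\<mu>\<in>M. exp (F \<mu> x))"
    using messages by (intro expectation_mono_finite finite_p) (auto intro!: member_le_sum)
  also have "\<dots> = (\<Sum>\<mu>\<in>M. \<E> p (\<lambda>x. exp (F \<mu> x)))"
    by (rule expectation_sum_finite[OF finite_p])
  also have "\<dots> \<le> (\<Sum>\<mu>\<in>M. exp c)" by (intro sum_mono moment)
  finally have union: "\<E> p (\<lambda>x. exp (F (f x) x)) \<le> exp b" by (simp add: exp_b)
  have "\<E> p (\<lambda>x. F (f x) x)
      \<le> \<E> p (\<lambda>x. exp (- b) * exp (F (f x) x) + (b - 1))"
  proof (intro expectation_mono_finite finite_p)
    fix x
    have "exp (- b) * exp (F (f x) x) = exp (F (f x) x - b)" by (simp add: exp_add[symmetric])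
    then show "F (f x) x \<le> exp (- b) * exp (F (f x) x) + (b - 1)"
      using exp_ge_add_one_self[of "F (f x) x - b"] by linarith
  qed
  also have "\<dots> = exp (- b) * \<E> p (\<lambda>x. exp (F (f x) x)) + (b - 1)"
    by (rule expectation_affine_finite[OF finite_p])
  also have "\<dots> \<le> exp (- b) * exp b + (b - 1)" using union by (intro add_right_mono mult_left_mono) auto
  also have "\<dots> = b" by (simp add: exp_minus)
  finally show ?thesis by (simp add: b_def)
qed

section \<open>Messages reveal little about parities over random blocks\<close>

lemma avg_conditioned:
  assumes finite_A: "finite A" and density: "avg A (\<lambda>x. c * of_bool (P x)) = 1"
  shows "avg {x \<in> A. P x} h = avg A (\<lambda>x. h x * (c * of_bool (P x)))"
proof -
  have count: "(\<Sum>x\<in>A. of_bool (P x)) = real (card {x \<in> A. P x})"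
    using finite_A by (simp add: Int_def)
  have "c * card {x \<in> A. P x} / card A = 1"
    using density unfolding avg_def sum_distrib_left[symmetric] count .
  then have "0 < card A" and card_A: "card A = c * card {x \<in> A. P x}" by auto
  then have "c \<noteq> 0" by auto
  have "(\<Sum>x | x \<in> A \<and> P x. h x) = (\<Sum>x\<in>A. h x * of_bool (P x))"
    using finite_A by (intro sum.mono_neutral_cong_left) auto
  then show ?thesis
    using \<open>c \<noteq> 0\<close> by (simp add: avg_def card_A sum_distrib_left[symmetric] mult.left_commute[of _ c])
qed

locale independent_columns =
  fixes t :: nat and I :: "nat \<Rightarrow> 'a set" and l k :: nat and codes :: "'x set"
      and col :: "'x \<Rightarrow> nat \<Rightarrow> 'a set"
  assumes t_pos: "0 < t" and finite_I: "\<And>j. j < t \<Longrightarrow> finite (I j)"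
    and k_pos: "1 \<le> k" and blocks_fit: "\<And>j. j < t \<Longrightarrow> k * l \<le> card (I j)"
    and columns_bij: "bij_betw (\<lambda>X. \<lambda>j\<in>{..<t}. col X j) codes (PiE {..<t} (\<lambda>j. Pow (I j)))"
begin

abbreviation free_instances :: "nat \<Rightarrow> ('x \<times> 'a list list) set" where
  "free_instances j \<equiv> codes \<times> disjoint_seqs (I j) l k"

definition instances :: "(nat \<Rightarrow> bool) \<Rightarrow> nat \<Rightarrow> ('x \<times> 'a list list) set" where
  "instances Y j = {(X, U) \<in> free_instances j. has_parities l Y U (col X j)}"

lemma codes_finite_nonempty: "finite codes" "codes \<noteq> {}"
proof -
  have "finite (PiE {..<t} (\<lambda>j. Pow (I j)))" using finite_I by (intro finite_PiE) auto
  moreover have "PiE {..<t} (\<lambda>j. Pow (I j)) \<noteq> {}" by (simp add: PiE_eq_empty_iff Pow_not_empty)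
  ultimately show "finite codes" "codes \<noteq> {}"
    using bij_betw_finite[OF columns_bij] bij_betw_empty2[of _ codes] columns_bij
    by (auto simp: bij_betw_def)
qed

lemma seqs_finite_nonempty:
  assumes "j < t"
  shows "finite (disjoint_seqs (I j) l k)" "disjoint_seqs (I j) l k \<noteq> {}"
  using finite_disjoint_seqs finite_I disjoint_seqs_nonempty blocks_fit assms by blast+

lemma free_instances_finite_nonempty:
  assumes "j < t"
  shows "finite (free_instances j)" "free_instances j \<noteq> {}"
  using codes_finite_nonempty seqs_finite_nonempty[OF assms] by auto

lemma avg_codes_prod: "avg codes (\<lambda>X. \<Prod>j<t. f j (col X j)) = (\<Prod>j<t. avg (Pow (I j)) (f j))"
proof -
  have "avg codes (\<lambda>X. \<Prod>j<t. f j (col X j)) = avg codes (\<lambda>X. \<Prod>j<t. f j ((\<lambda>j\<in>{..<t}. col X j) j))"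
    by simp
  also have "\<dots> = avg (PiE {..<t} (\<lambda>j. Pow (I j))) (\<lambda>h. \<Prod>j<t. f j (h j))"
    by (rule avg_reindex[OF columns_bij])
  also have "\<dots> = (\<Prod>j<t. avg (Pow (I j)) (f j))" using finite_I by (intro avg_prod_PiE) auto
  finally show ?thesis .
qed

lemma avg_codes_column:
  assumes "j < t"
  shows "avg codes (\<lambda>X. f (col X j)) = avg (Pow (I j)) f"
proof -
  have "avg codes (\<lambda>X. f (col X j)) = avg codes (\<lambda>X. f ((\<lambda>j\<in>{..<t}. col X j) j))"
    using assms by simp
  also have "\<dots> = avg (PiE {..<t} (\<lambda>j. Pow (I j))) (\<lambda>h. f (h j))"
    by (rule avg_reindex[OF columns_bij])
  also have "\<dots> = avg (Pow (I j)) f" using assms finite_I by (intro avg_PiE_component) auto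
  finally show ?thesis .
qed

lemma avg_free_parity_density:
  assumes j_less: "j < t"
  shows "avg (free_instances j) (\<lambda>(X, U). parity_density l Y U (col X j)) = 1"
proof -
  have "avg (free_instances j) (\<lambda>(X, U). parity_density l Y U (col X j))
      = avg (disjoint_seqs (I j) l k) (\<lambda>U. avg codes (\<lambda>X. parity_density l Y U (col X j)))"
    by (simp add: avg_Times avg_swap[of codes])
  also have "\<dots> = avg (disjoint_seqs (I j) l k) (\<lambda>U. 1)"
    using avg_codes_column[OF j_less] avg_parity_density[OF finite_I[OF j_less] k_pos]
    by (intro avg_cong) simp
  also have "\<dots> = 1" using seqs_finite_nonempty[OF j_less] by (rule avg_const)
  finally show ?thesis .
qed

lemma avg_instances:
  assumes j_less: "j < t"
  shows "avg (instances Y j) (\<lambda>(X, U). h X U)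
      = avg (free_instances j) (\<lambda>(X, U). h X U * parity_density l Y U (col X j))"
proof -
  have "avg (free_instances j) (\<lambda>p. 2 ^ l * of_bool (has_parities l Y (snd p) (col (fst p) j))) = 1"
    using avg_free_parity_density[OF j_less, of Y] by (simp add: parity_density_def case_prod_unfold)
  moreover have "instances Y j = {p \<in> free_instances j. has_parities l Y (snd p) (col (fst p) j)}"
    by (auto simp: instances_def)
  ultimately show ?thesis
    using avg_conditioned[OF free_instances_finite_nonempty(1)[OF j_less]]
    by (simp only: parity_density_def case_prod_unfold)
qed

lemma instances_finite_nonempty:
  assumes j_less: "j < t"
  shows "finite (instances Y j)" "instances Y j \<noteq> {}"
proof -
  show "finite (instances Y j)"
    by (rule finite_subset[OF _ free_instances_finite_nonempty(1)[OF j_less]]) (auto simp: instances_def)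
  have "avg (instances Y j) (\<lambda>(X, U). 1) = 1"
    using avg_instances[OF j_less, of Y "\<lambda>_ _. 1"] avg_free_parity_density[OF j_less, of Y] by simp
  then show "instances Y j \<noteq> {}" by (auto simp: avg_def)
qed

lemma avg_free_minus_avg_instances:
  assumes j_less: "j < t"
  shows "avg (free_instances j) (\<lambda>(X, U). h (f X) U) - avg (instances Y j) (\<lambda>(X, U). h (f X) U)
    = avg codes (\<lambda>X. deficit (I j) l k Y (h (f X)) (col X j))"
  unfolding avg_instances[OF j_less] deficit_def avg_Times avg_diff[symmetric]
  by (simp add: algebra_simps)

text \<open>For each message the deficits of the columns are independent, and the moment bounds multiply.\<close>

lemma avg_sum_deficit_le:
  fixes h :: "'m \<Rightarrow> nat \<Rightarrow> 'a list list \<Rightarrow> real" and \<theta> \<epsilon> :: real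
  assumes h_bounds: "\<And>\<mu> j U. 0 \<le> h \<mu> j U \<and> h \<mu> j U \<le> 1"
    and messages: "finite M" "\<And>X. X \<in> codes \<Longrightarrow> f X \<in> M" and \<theta>_pos: "0 < \<theta>"
    and moment: "\<And>j. j < t \<Longrightarrow> deficit_moment_le \<theta> \<epsilon> (I j) l k"
  shows "avg codes (\<lambda>X. \<Sum>j<t. deficit (I j) l k Y (h (f X) j) (col X j)) \<le> t * \<epsilon> + ln (card M) / \<theta>"
proof -
  define total where "total \<mu> X = (\<Sum>j<t. deficit (I j) l k Y (h \<mu> j) (col X j))" for \<mu> X
  have "avg codes (\<lambda>X. exp (\<theta> * total \<mu> X)) \<le> exp (\<theta> * (t * \<epsilon>))" for \<mu>
  proof -
    have "avg codes (\<lambda>X. exp (\<theta> * total \<mu> X))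
        = (\<Prod>j<t. avg (Pow (I j)) (\<lambda>x. exp (\<theta> * deficit (I j) l k Y (h \<mu> j) x)))"
      unfolding total_def sum_distrib_left exp_sum[OF finite_lessThan] by (rule avg_codes_prod)
    also have "\<dots> \<le> (\<Prod>j<t. exp (\<theta> * \<epsilon>))"
      using moment h_bounds by (intro prod_mono conjI avg_nonneg) (auto simp: deficit_moment_le_def)
    also have "\<dots> = exp (\<theta> * (t * \<epsilon>))" by (simp add: exp_of_nat_mult[symmetric] ac_simps)
    finally show ?thesis .
  qed
  then have "\<E> (pmf_of_set codes) (\<lambda>X. \<theta> * total (f X) X) \<le> ln (card M) + \<theta> * (t * \<epsilon>)"
    using messages codes_finite_nonempty
    by (intro expectation_le_ln_card_plus[where F = "\<lambda>\<mu> X. \<theta> * total \<mu> X"])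
        (auto simp: expectation_pmf_of_set)
  then have "\<theta> * avg codes (\<lambda>X. total (f X) X) \<le> ln (card M) + \<theta> * (t * \<epsilon>)"
    by (simp add: expectation_pmf_of_set codes_finite_nonempty avg_cmult)
  then have "avg codes (\<lambda>X. total (f X) X) \<le> (ln (card M) + \<theta> * (t * \<epsilon>)) / \<theta>"
    using \<theta>_pos by (simp add: pos_le_divide_eq mult.commute)
  then show ?thesis using \<theta>_pos by (simp add: total_def add_divide_distrib)
qed

theorem avg_instances_le:
  fixes g :: "'m \<Rightarrow> nat \<Rightarrow> 'a list list \<Rightarrow> real" and \<theta> \<epsilon> :: real
  assumes g_bounds: "\<And>\<mu> j U. 0 \<le> g \<mu> j U \<and> g \<mu> j U \<le> 1"
    and messages: "finite M" "\<And>X. X \<in> codes \<Longrightarrow> f X \<in> M" and \<theta>_pos: "0 < \<theta>"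
    and moment: "\<And>j. j < t \<Longrightarrow> deficit_moment_le \<theta> \<epsilon> (I j) l k"
  shows "avg {..<t} (\<lambda>j. avg (instances Y j) (\<lambda>(X, U). g (f X) j U))
    \<le> avg {..<t} (\<lambda>j. avg (free_instances j) (\<lambda>(X, U). g (f X) j U)) + \<epsilon> + ln (card M) / (\<theta> * t)"
proof -
  define h where "h \<mu> j U = 1 - g \<mu> j U" for \<mu> j U
  have diff: "avg (instances Y j) (\<lambda>(X, U). g (f X) j U) - avg (free_instances j) (\<lambda>(X, U). g (f X) j U)
      = avg codes (\<lambda>X. deficit (I j) l k Y (h (f X) j) (col X j))" if j_less: "j < t" for j
  proof -
    have "avg A (\<lambda>(X, U). h (f X) j U) = 1 - avg A (\<lambda>(X, U). g (f X) j U)" if "finite A" "A \<noteq> {}" for A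
      using avg_const[OF that, of 1] by (simp add: h_def avg_diff case_prod_unfold)
    then show ?thesis
      using avg_free_minus_avg_instances[OF j_less, where h = "\<lambda>\<mu>. h \<mu> j" and f = f]
        instances_finite_nonempty[OF j_less] free_instances_finite_nonempty[OF j_less] by simp
  qed
  have "avg {..<t} (\<lambda>j. avg (instances Y j) (\<lambda>(X, U). g (f X) j U))
      - avg {..<t} (\<lambda>j. avg (free_instances j) (\<lambda>(X, U). g (f X) j U))
      = avg {..<t} (\<lambda>j. avg codes (\<lambda>X. deficit (I j) l k Y (h (f X) j) (col X j)))"
    unfolding avg_diff[symmetric] using diff by (intro avg_cong) simp
  also have "\<dots> = avg codes (\<lambda>X. \<Sum>j<t. deficit (I j) l k Y (h (f X) j) (col X j)) / t"
    by (simp add: avg_def[of "{..<t}"] avg_sum)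
  also have "\<dots> \<le> (t * \<epsilon> + ln (card M) / \<theta>) / t"
    using g_bounds
    by (intro divide_right_mono avg_sum_deficit_le[OF _ messages \<theta>_pos moment]) (auto simp: h_def)
  also have "\<dots> = \<epsilon> + ln (card M) / (\<theta> * t)" using t_pos by (simp add: add_divide_distrib)
  finally show ?thesis by linarith
qed

end

section \<open>Parities along augmenting paths\<close>

definition copy_of :: "bool \<Rightarrow> rs_vertex \<Rightarrow> enc_vertex" where
  "copy_of b v = (if b then BV v else AV v)"

lemma copy_of_eq_iff [simp]: "copy_of b v = copy_of c w \<longleftrightarrow> b = c \<and> v = w"
  by (auto simp: copy_of_def)

abbreviation rs_left :: "rs_graph \<Rightarrow> nat \<Rightarrow> nat set" where
  "rs_left G j \<equiv> fst ` rs_matching G j"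

abbreviation rs_codes :: "rs_graph \<Rightarrow> (nat \<times> nat \<Rightarrow> bool) set" where
  "rs_codes G \<equiv> ({..<rs_r G} \<times> {..<rs_t G}) \<rightarrow>\<^sub>E UNIV"

definition rs_column :: "rs_graph \<Rightarrow> (nat \<times> nat \<Rightarrow> bool) \<Rightarrow> nat \<Rightarrow> nat set" where
  "rs_column G X j = (\<lambda>i. fst (rs_edge G i j)) ` {i. i < rs_r G \<and> X (i, j)}"

lemma enc_edge_eq: "enc_edge b e = range (\<lambda>c. {copy_of c (LV (fst e)), copy_of (c \<noteq> b) (RV (snd e))})"
  by (auto simp: enc_edge_def copy_of_def UNIV_bool)

lemma valid_seqs_iff: "valid_seqs G j l k U \<longleftrightarrow> U \<in> disjoint_seqs (rs_left G j) l k"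
  by (simp add: valid_seqs_def disjoint_seqs_def)

locale indexed_matching =
  fixes G :: rs_graph and j :: nat
  assumes is_rs: "is_rs_graph G" and index: "j < rs_t G"
begin

abbreviation partner :: "nat \<Rightarrow> nat" where
  "partner \<equiv> mate (rs_matching G j)"

lemma inj_edge: "inj_on (\<lambda>i. rs_edge G i j) {..<rs_r G}"
  and inj_fst: "inj_on fst (rs_matching G j)" and inj_snd: "inj_on snd (rs_matching G j)"
  using is_rs index by (auto simp: is_rs_graph_def induced_matching_def bip_matching_def)

lemma inj_left: "inj_on (\<lambda>i. fst (rs_edge G i j)) {..<rs_r G}"
  using comp_inj_on[OF inj_edge, of fst] inj_fst by (simp add: rs_matching_def comp_def)

lemma rs_left_eq: "rs_left G j = (\<lambda>i. fst (rs_edge G i j)) ` {..<rs_r G}"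
  by (simp add: rs_matching_def image_image)

lemma finite_rs_left: "finite (rs_left G j)" and card_rs_left: "card (rs_left G j) = rs_r G"
  unfolding rs_left_eq using card_image[OF inj_left] by simp_all

lemma partner_fst:
  assumes "e \<in> rs_matching G j"
  shows "partner (fst e) = snd e"
  unfolding mate_def
proof (rule the_equality)
  show "(fst e, snd e) \<in> rs_matching G j" using assms by simp
  fix v assume "(fst e, v) \<in> rs_matching G j"
  then show "v = snd e" using inj_onD[OF inj_fst, of "(fst e, v)" e] assms by (cases e) auto
qed

lemma inj_partner: "inj_on partner (rs_left G j)"
proof (rule inj_onI)
  fix u u' assume "u \<in> rs_left G j" "u' \<in> rs_left G j" and same_partner: "partner u = partner u'"
  then obtain e e' where "e \<in> rs_matching G j" "u = fst e" "e' \<in> rs_matching G j" "u' = fst e'" by blast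
  then show "u = u'" using same_partner partner_fst inj_onD[OF inj_snd, of e e'] by auto
qed

lemma mem_rs_column_iff: "i < rs_r G \<Longrightarrow> fst (rs_edge G i j) \<in> rs_column G X j \<longleftrightarrow> X (i, j)"
  unfolding rs_column_def using inj_onD[OF inj_left] by fastforce

lemma rep_eq:
  "rep G X j = {{copy_of c (LV u), copy_of (c \<noteq> (u \<in> rs_column G X j)) (RV (partner u))} | c u.
        u \<in> rs_left G j}"
proof -
  have "enc_edge (X (i, j)) (rs_edge G i j)
      = range (\<lambda>c. {copy_of c (LV u), copy_of (c \<noteq> (u \<in> rs_column G X j)) (RV (partner u))})"
    if "i < rs_r G" "u = fst (rs_edge G i j)" for i u
  proof -
    have "rs_edge G i j \<in> rs_matching G j" using that(1) by (simp add: rs_matching_def)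
    then show ?thesis
      unfolding enc_edge_eq that(2) using mem_rs_column_iff[OF that(1), of X] by (simp add: partner_fst)
  qed
  then have "rep G X j = (\<Union>i<rs_r G. range (\<lambda>c. {copy_of c (LV (fst (rs_edge G i j))),
      copy_of (c \<noteq> (fst (rs_edge G i j) \<in> rs_column G X j)) (RV (partner (fst (rs_edge G i j))))}))"
    unfolding rep_def by (intro SUP_cong) auto
  then show ?thesis by (auto simp: rs_matching_def)
qed

lemma Union_rep:
  "\<Union>(rep G X j)
      = {copy_of c (LV u) | c u. u \<in> rs_left G j} \<union> {copy_of c (RV (partner u)) | c u. u \<in> rs_left G j}"
proof
  show "\<Union>(rep G X j)
      \<subseteq> {copy_of c (LV u) | c u. u \<in> rs_left G j} \<union> {copy_of c (RV (partner u)) | c u. u \<in> rs_left G j}"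
    unfolding rep_eq by blast
  have "copy_of c (LV u) \<in> \<Union>(rep G X j)" if "u \<in> rs_left G j" for c u
    unfolding rep_eq using that by blast
  moreover have "copy_of c (RV (partner u)) \<in> \<Union>(rep G X j)" if "u \<in> rs_left G j" for c u
  proof -
    define b where "b = (c \<noteq> (u \<in> rs_column G X j))"
    have "c = (b \<noteq> (u \<in> rs_column G X j))" by (auto simp: b_def)
    then have "{copy_of b (LV u), copy_of c (RV (partner u))} \<in> rep G X j"
      unfolding rep_eq using that by blast
    then show ?thesis by blast
  qed
  ultimately show "{copy_of c (LV u) | c u. u \<in> rs_left G j}
      \<union> {copy_of c (RV (partner u)) | c u. u \<in> rs_left G j}
      \<subseteq> \<Union>(rep G X j)"
    by blast
qed

lemma follow_rep:
  assumes u_left: "u \<in> rs_left G j"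
  shows "follow (rep G X j) (copy_of b (LV u)) = copy_of (b \<noteq> (u \<in> rs_column G X j)) (RV (partner u))"
  unfolding follow_def
proof (rule the_equality)
  show "{copy_of b (LV u), copy_of (b \<noteq> (u \<in> rs_column G X j)) (RV (partner u))} \<in> rep G X j"
    unfolding rep_eq using u_left by blast
  fix w assume "{copy_of b (LV u), w} \<in> rep G X j"
  then show "w = copy_of (b \<noteq> (u \<in> rs_column G X j)) (RV (partner u))"
    unfolding rep_eq by (auto simp: doubleton_eq_iff)
qed

lemma augmenting_edges_eq:
  "augmenting_edges G j us
    = {{copy_of c (RV (partner (us ! i))), copy_of c (LV (us ! Suc i))} | c i. Suc i < length us}"
proof -
  have "{..<length us - 1} = {i. Suc i < length us}" by auto
  then have "augmenting_edges G j us = (\<Union>i\<in>{i. Suc i < length us}.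
      range (\<lambda>c. {copy_of c (RV (partner (us ! i))), copy_of c (LV (us ! Suc i))}))"
    unfolding augmenting_edges_def by (intro SUP_cong) (auto simp: Let_def copy_of_def UNIV_bool)
  then show ?thesis by blast
qed

lemma follow_augmenting_edges:
  assumes us_path: "distinct us" "set us \<subseteq> rs_left G j" and i_less: "Suc i < length us"
  shows "follow (augmenting_edges G j us) (copy_of b (RV (partner (us ! i))))
      = copy_of b (LV (us ! Suc i))"
  unfolding follow_def
proof (rule the_equality)
  show "{copy_of b (RV (partner (us ! i))), copy_of b (LV (us ! Suc i))} \<in> augmenting_edges G j us"
    unfolding augmenting_edges_eq using i_less by blast
  fix w assume "{copy_of b (RV (partner (us ! i))), w} \<in> augmenting_edges G j us"
  then obtain i' where same_partner: "Suc i' < length us" "partner (us ! i) = partner (us ! i')"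
    and w_eq: "w = copy_of b (LV (us ! Suc i'))"
    unfolding augmenting_edges_eq by (auto simp: doubleton_eq_iff)
  have "us ! i \<in> rs_left G j" "us ! i' \<in> rs_left G j"
    using us_path(2) i_less same_partner(1) by (meson Suc_lessD nth_mem subsetD)+
  then have "us ! i = us ! i'" using inj_onD[OF inj_partner same_partner(2)] by blast
  then have "i = i'" using us_path(1) i_less same_partner(1) by (simp add: nth_eq_iff_index_eq)
  then show "w = copy_of b (LV (us ! Suc i))" by (simp add: w_eq)
qed

lemma last_alternating_walk:
  assumes us_path: "distinct us" "set us \<subseteq> rs_left G j" and position: "i + Suc n = length us"
  shows "last (alternating_walk (Suc (2 * n)) (rep G X j) (augmenting_edges G j us)
        (copy_of b (LV (us ! i))))
    = copy_of (b \<noteq> odd (card (set (drop i us) \<inter> rs_column G X j))) (RV (partner (last us)))"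
  using position
proof (induction n arbitrary: i b)
  case 0
  then have "us \<noteq> []" "i = length us - 1" by auto
  then have "last us = us ! i" "drop i us = [us ! i]"
    by (auto simp: last_conv_nth Cons_nth_drop_Suc[symmetric])
  moreover have "us ! i \<in> rs_left G j" using 0 by (intro subsetD[OF us_path(2)] nth_mem) simp
  ultimately show ?case by (simp add: follow_rep Int_insert_left)
next
  case (Suc n)
  let ?u = "us ! i" and ?C = "rs_column G X j"
  have indices: "i < length us" "Suc i < length us" using Suc.prems by auto
  have u_left: "?u \<in> rs_left G j" using indices by (intro subsetD[OF us_path(2)] nth_mem)
  have drop: "drop i us = ?u # drop (Suc i) us" using indices by (simp add: Cons_nth_drop_Suc)
  then have "?u \<notin> set (drop (Suc i) us)" using distinct_drop[OF us_path(1), of i] by simp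
  then have parity: "odd (card (set (drop i us) \<inter> ?C))
      \<longleftrightarrow> ((?u \<in> ?C) \<noteq> odd (card (set (drop (Suc i) us) \<inter> ?C)))"
    unfolding drop by (simp add: Int_insert_left)
  have "last (alternating_walk (Suc (2 * Suc n)) (rep G X j) (augmenting_edges G j us)
        (copy_of b (LV ?u)))
      = last (alternating_walk (Suc (2 * n)) (rep G X j) (augmenting_edges G j us)
          (copy_of (b \<noteq> (?u \<in> ?C)) (LV (us ! Suc i))))"
    by (simp add: follow_rep[OF u_left] follow_augmenting_edges[OF us_path indices(2)])
  also have "\<dots> = copy_of ((b \<noteq> (?u \<in> ?C)) \<noteq> odd (card (set (drop (Suc i) us) \<inter> ?C)))
      (RV (partner (last us)))"
    by (rule Suc.IH) (use Suc.prems in simp)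
  also have "((b \<noteq> (?u \<in> ?C)) \<noteq> odd (card (set (drop (Suc i) us) \<inter> ?C)))
      \<longleftrightarrow> (b \<noteq> odd (card (set (drop i us) \<inter> ?C)))"
    unfolding parity by blast
  finally show ?case .
qed

lemma aug_end_eq_target_iff:
  assumes us_path: "distinct us" "set us \<subseteq> rs_left G j" "us \<noteq> []"
  shows "aug_end G X j us = aug_target G j us \<longleftrightarrow> even (card (set us \<inter> rs_column G X j))"
proof -
  obtain n where length_us: "length us = Suc n" using us_path(3) by (cases us) auto
  have "aug_start us = copy_of False (LV (us ! 0))"
    using us_path(3) by (simp add: aug_start_def copy_of_def hd_conv_nth)
  then have "aug_end G X j us = copy_of (odd (card (set us \<inter> rs_column G X j))) (RV (partner (last us)))"
    using last_alternating_walk[OF us_path(1,2), of 0 n X False] length_us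
    by (simp add: aug_end_def aug_path_def del: alternating_walk.simps)
  moreover have "aug_target G j us = copy_of False (RV (partner (last us)))"
    by (simp add: aug_target_def copy_of_def)
  ultimately show ?thesis by simp
qed

lemma aug_target_inj:
  assumes U_seqs: "U \<in> disjoint_seqs (rs_left G j) l k" and k_pos: "1 \<le> k"
    and members: "us \<in> set U" "us' \<in> set U" and same_target: "aug_target G j us = aug_target G j us'"
  shows "us = us'"
proof -
  obtain i i' where positions: "i < l" "us = U ! i" "i' < l" "us' = U ! i'"
    using U_seqs members by (auto simp: disjoint_seqs_def in_set_conv_nth)
  have last: "last (U ! n) \<in> set (U ! n)" if "n < l" for n
    using disjoint_seqs_nth(3)[OF U_seqs that] k_pos by (intro last_in_set) auto
  have "partner (last (U ! i)) = partner (last (U ! i'))"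
    using same_target positions by (simp add: aug_target_def)
  moreover have "last (U ! n) \<in> rs_left G j" if "n < l" for n
    using last[OF that] disjoint_seqs_nth(2)[OF U_seqs that] by blast
  ultimately have "last (U ! i) = last (U ! i')" using inj_onD[OF inj_partner] positions(1,3) by blast
  then have "i = i'"
    using disjoint_seqs_disjoint[OF U_seqs positions(1,3)]
      last[OF positions(1)] last[OF positions(3)] by auto
  then show ?thesis using positions by simp
qed

lemma aug_target_mem_iff:
  assumes U_seqs: "U \<in> disjoint_seqs (rs_left G j) l k" and k_pos: "1 \<le> k" and i_less: "i < l"
  shows "aug_target G j (U ! i) \<in> aug_set G X j U \<longleftrightarrow> even (card (set (U ! i) \<inter> rs_column G X j))"
    and "aug_target G j (U ! i) \<in> aug_bar_set G X j U \<longleftrightarrow> odd (card (set (U ! i) \<inter> rs_column G X j))"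
proof -
  have mem: "U ! i \<in> set U" using U_seqs i_less by (auto simp: disjoint_seqs_def)
  have "distinct (U ! i)" "set (U ! i) \<subseteq> rs_left G j" "U ! i \<noteq> []"
    using disjoint_seqs_nth[OF U_seqs i_less] k_pos by auto
  note target = aug_end_eq_target_iff[OF this, of X] and inj = aug_target_inj[OF U_seqs k_pos _ mem]
  show "aug_target G j (U ! i) \<in> aug_set G X j U \<longleftrightarrow> even (card (set (U ! i) \<inter> rs_column G X j))"
    "aug_target G j (U ! i) \<in> aug_bar_set G X j U \<longleftrightarrow> odd (card (set (U ! i) \<inter> rs_column G X j))"
    using target inj mem unfolding aug_set_def aug_bar_set_def mem_Collect_eq by metis+
qed

lemma aug_instances_eq:
  assumes "1 \<le> k"
  shows "aug_instances G Y l k j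
    = {(X, U) \<in> rs_codes G \<times> disjoint_seqs (rs_left G j) l k. has_parities l Y U (rs_column G X j)}"
proof -
  have "(\<forall>i<l. aug_target G j (U ! i) \<in> (if Y i then aug_bar_set G X j U else aug_set G X j U))
      \<longleftrightarrow> has_parities l Y U (rs_column G X j)" if "U \<in> disjoint_seqs (rs_left G j) l k" for X U
    unfolding has_parities_def using aug_target_mem_iff[OF that assms] by auto
  then show ?thesis unfolding aug_instances_def valid_seqs_iff by blast
qed

lemma ag_rest_code_independent: "ag_rest (aug_graph_of G X j U) = ag_rest (aug_graph_of G X' j U)"
  by (simp add: aug_graph_of_def Union_rep)

end

section \<open>Random augmentation graphs\<close>

definition code_of_columns :: "rs_graph \<Rightarrow> (nat \<Rightarrow> nat set) \<Rightarrow> nat \<times> nat \<Rightarrow> bool" where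
  "code_of_columns G c = (\<lambda>(i, j)\<in>{..<rs_r G} \<times> {..<rs_t G}. fst (rs_edge G i j) \<in> c j)"

lemma rs_column_code_of_columns:
  assumes "j < rs_t G" "c j \<subseteq> rs_left G j"
  shows "rs_column G (code_of_columns G c) j = c j"
  using assms by (auto simp: rs_column_def code_of_columns_def rs_matching_def)

lemma code_of_columns_rs_column:
  assumes is_rs: "is_rs_graph G" and X_code: "X \<in> rs_codes G"
    and c_eq: "\<And>j. j < rs_t G \<Longrightarrow> c j = rs_column G X j"
  shows "code_of_columns G c = X"
proof (rule extensionalityI)
  show "code_of_columns G c \<in> extensional ({..<rs_r G} \<times> {..<rs_t G})" by (simp add: code_of_columns_def)
  show "X \<in> extensional ({..<rs_r G} \<times> {..<rs_t G})" using X_code by (simp add: PiE_def)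
  fix p assume "p \<in> {..<rs_r G} \<times> {..<rs_t G}"
  then obtain i j where p_eq: "p = (i, j)" "i < rs_r G" "j < rs_t G" by auto
  interpret indexed_matching G j using is_rs p_eq by unfold_locales
  show "code_of_columns G c p = X p"
    using p_eq mem_rs_column_iff by (simp add: code_of_columns_def c_eq)
qed

lemma bij_betw_rs_columns:
  assumes "is_rs_graph G"
  shows "bij_betw (\<lambda>X. \<lambda>j\<in>{..<rs_t G}. rs_column G X j) (rs_codes G)
      (PiE {..<rs_t G} (\<lambda>j. Pow (rs_left G j)))"
proof (rule bij_betw_byWitness[where f' = "code_of_columns G"])
  show "\<forall>X\<in>rs_codes G. code_of_columns G (\<lambda>j\<in>{..<rs_t G}. rs_column G X j) = X"
    using assms by (intro ballI code_of_columns_rs_column) auto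
  show "\<forall>c\<in>PiE {..<rs_t G} (\<lambda>j. Pow (rs_left G j)).
      (\<lambda>j\<in>{..<rs_t G}. rs_column G (code_of_columns G c) j) = c"
  proof
    fix c assume c_PiE: "c \<in> PiE {..<rs_t G} (\<lambda>j. Pow (rs_left G j))"
    then have "rs_column G (code_of_columns G c) j = c j" if "j < rs_t G" for j
      using that by (intro rs_column_code_of_columns) (auto simp: PiE_def Pi_def)
    then show "(\<lambda>j\<in>{..<rs_t G}. rs_column G (code_of_columns G c) j) = c"
      using c_PiE by (intro extensionalityI[of _ "{..<rs_t G}"]) (auto simp: PiE_def)
  qed
qed (auto simp: rs_column_def rs_matching_def code_of_columns_def)

definition aug_mixture ::
  "rs_graph \<Rightarrow> (nat \<Rightarrow> ((nat \<times> nat \<Rightarrow> bool) \<times> nat list list) set) \<Rightarrow> aug_graph pmf" where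
  "aug_mixture G S =
     do {
       j \<leftarrow> pmf_of_set {..<rs_t G};
       (X, U) \<leftarrow> pmf_of_set (S j);
       return_pmf (aug_graph_of G X j U)
     }"

lemma D_aug_eq_mixture: "D_aug G Y l k = aug_mixture G (aug_instances G Y l k)"
  by (simp add: D_aug_def aug_mixture_def)

definition D_free :: "rs_graph \<Rightarrow> nat \<Rightarrow> nat \<Rightarrow> aug_graph pmf" where
  "D_free G l k = aug_mixture G (\<lambda>j. rs_codes G \<times> disjoint_seqs (rs_left G j) l k)"

lemma
  assumes t_pos: "0 < rs_t G" and S_finite_nonempty: "\<And>j. j < rs_t G \<Longrightarrow> finite (S j) \<and> S j \<noteq> {}"
  shows finite_aug_mixture: "finite (set_pmf (aug_mixture G S))"
    and expectation_aug_mixture: "\<E> (aug_mixture G S) h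
      = avg {..<rs_t G} (\<lambda>j. avg (S j) (\<lambda>(X, U). h (aug_graph_of G X j U)))"
proof -
  have index: "{..<rs_t G} \<noteq> {}" "finite {..<rs_t G}" using t_pos by auto
  let ?graph = "\<lambda>j. do { (X, U) \<leftarrow> pmf_of_set (S j); return_pmf (aug_graph_of G X j U) }"
  have graph: "?graph j = map_pmf (\<lambda>(X, U). aug_graph_of G X j U) (pmf_of_set (S j))" for j
    by (simp add: map_pmf_def case_prod_unfold)
  have finite_graph: "finite (set_pmf (?graph j))" if "j \<in> {..<rs_t G}" for j
    using S_finite_nonempty[of j] that unfolding graph by simp
  show "finite (set_pmf (aug_mixture G S))"
    unfolding aug_mixture_def using index finite_graph by auto
  have "\<E> (aug_mixture G S) h = avg {..<rs_t G} (\<lambda>j. \<E> (?graph j) h)"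
    unfolding aug_mixture_def
    by (subst pmf_expectation_bind_pmf_of_set[OF index finite_graph])
      (simp_all add: avg_def sum_distrib_left divide_inverse mult.commute)
  also have "\<dots> = avg {..<rs_t G} (\<lambda>j. avg (S j) (\<lambda>(X, U). h (aug_graph_of G X j U)))"
    using S_finite_nonempty unfolding graph
    by (intro avg_cong) (simp add: expectation_pmf_of_set case_prod_unfold)
  finally show "\<E> (aug_mixture G S) h
      = avg {..<rs_t G} (\<lambda>j. avg (S j) (\<lambda>(X, U). h (aug_graph_of G X j U)))" .
qed

locale rs_blocks =
  fixes G :: rs_graph and l k :: nat
  assumes is_rs: "is_rs_graph G" and t_pos: "0 < rs_t G" and k_pos: "1 \<le> k"
    and blocks_fit: "k * l \<le> rs_r G"
begin

sublocale columns: independent_columns "rs_t G" "rs_left G" l k "rs_codes G" "rs_column G"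
proof
  fix j assume "j < rs_t G"
  then interpret indexed_matching G j using is_rs by unfold_locales
  show "finite (rs_left G j)" "k * l \<le> card (rs_left G j)"
    using finite_rs_left card_rs_left blocks_fit by auto
qed (use t_pos k_pos bij_betw_rs_columns[OF is_rs] in auto)

lemma aug_instances_eq_instances: "j < rs_t G \<Longrightarrow> aug_instances G Y l k j = columns.instances Y j"
  unfolding columns.instances_def using is_rs k_pos
  by (intro indexed_matching.aug_instances_eq indexed_matching.intro)

lemma finite_D_aug: "finite (set_pmf (D_aug G Y l k))"
  and expectation_D_aug: "\<E> (D_aug G Y l k) h
    = avg {..<rs_t G} (\<lambda>j. avg (aug_instances G Y l k j) (\<lambda>(X, U). h (aug_graph_of G X j U)))"
  unfolding D_aug_eq_mixture
  using t_pos columns.instances_finite_nonempty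
  by (intro finite_aug_mixture expectation_aug_mixture; simp add: aug_instances_eq_instances)+

lemma finite_D_free: "finite (set_pmf (D_free G l k))"
  and expectation_D_free: "\<E> (D_free G l k) h
    = avg {..<rs_t G} (\<lambda>j. avg (columns.free_instances j) (\<lambda>(X, U). h (aug_graph_of G X j U)))"
  unfolding D_free_def
  using t_pos columns.free_instances_finite_nonempty
    by (intro finite_aug_mixture expectation_aug_mixture; blast)+

theorem expectation_D_aug_le_D_free:
  fixes g :: "'m \<Rightarrow> aug_vertex set set \<Rightarrow> aug_vertex list \<Rightarrow> real" and \<theta> \<epsilon> :: real
  assumes g_bounds: "\<And>\<mu> E T. 0 \<le> g \<mu> E T \<and> g \<mu> E T \<le> 1"
    and messages: "finite M" "\<And>H. f H \<in> M" and \<theta>_pos: "0 < \<theta>"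
    and moment: "\<And>j. j < rs_t G \<Longrightarrow> deficit_moment_le \<theta> \<epsilon> (rs_left G j) l k"
  shows "\<E> (D_aug G Y l k) (\<lambda>A. g (f (ag_enc A)) (ag_rest A) (ag_targets A))
    \<le> \<E> (D_free G l k) (\<lambda>A. g (f (ag_enc A)) (ag_rest A) (ag_targets A))
      + \<epsilon> + ln (card M) / (\<theta> * rs_t G)"
proof -
  define f' where "f' X = f ((`) HV ` encoded_rs G X)" for X
  define g' where "g' \<mu> j U
    = g \<mu> (ag_rest (aug_graph_of G (\<lambda>_. False) j U))
        (ag_targets (aug_graph_of G (\<lambda>_. False) j U))" for \<mu> j U
  have g'_eq: "g (f (ag_enc (aug_graph_of G X j U))) (ag_rest (aug_graph_of G X j U))
      (ag_targets (aug_graph_of G X j U))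
      = g' (f' X) j U" if "j < rs_t G" for X j U
  proof -
    interpret indexed_matching G j using is_rs that by unfold_locales
    have "ag_targets (aug_graph_of G X j U) = ag_targets (aug_graph_of G (\<lambda>_. False) j U)"
      "ag_enc (aug_graph_of G X j U) = (`) HV ` encoded_rs G X"
      by (simp_all add: aug_graph_of_def)
    then show ?thesis
      using ag_rest_code_independent[of X U "\<lambda>_. False"] by (simp add: g'_def f'_def)
  qed
  have "\<E> (D_aug G Y l k) (\<lambda>A. g (f (ag_enc A)) (ag_rest A) (ag_targets A))
      = avg {..<rs_t G} (\<lambda>j. avg (columns.instances Y j) (\<lambda>(X, U). g' (f' X) j U))"
    unfolding expectation_D_aug by (rule avg_cong) (simp add: g'_eq aug_instances_eq_instances)
  moreover have "\<E> (D_free G l k) (\<lambda>A. g (f (ag_enc A)) (ag_rest A) (ag_targets A))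
      = avg {..<rs_t G} (\<lambda>j. avg (columns.free_instances j) (\<lambda>(X, U). g' (f' X) j U))"
    unfolding expectation_D_free by (rule avg_cong) (simp add: g'_eq)
  moreover have "avg {..<rs_t G} (\<lambda>j. avg (columns.instances Y j) (\<lambda>(X, U). g' (f' X) j U))
    \<le> avg {..<rs_t G} (\<lambda>j. avg (columns.free_instances j) (\<lambda>(X, U). g' (f' X) j U))
      + \<epsilon> + ln (card M) / (\<theta> * rs_t G)"
    using g_bounds messages by (intro columns.avg_instances_le \<theta>_pos moment) (auto simp: g'_def f'_def)
  ultimately show ?thesis by simp
qed

end

section \<open>Certified edges of a random subset\<close>

definition random_subset :: "real \<Rightarrow> 'e set \<Rightarrow> 'e set pmf" where
  "random_subset p E = map_pmf (\<lambda>keep. {e \<in> E. keep e}) (Pi_pmf E False (\<lambda>_. bernoulli_pmf p))"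

lemma subsampled_graph_eq: "subsampled_graph \<delta> G = random_subset (1 - \<delta>) (rs_edges G)"
  by (simp add: subsampled_graph_def random_subset_def)

lemma finite_random_subset:
  assumes "finite E"
  shows "finite (set_pmf (random_subset p E))"
proof (rule finite_subset)
  show "set_pmf (random_subset p E) \<subseteq> Pow E" by (auto simp: random_subset_def)
  show "finite (Pow E)" using assms by simp
qed

lemma expectation_subset_random_subset:
  assumes finite_E: "finite E" and p_bounds: "0 \<le> p" "p \<le> 1" and S_subset: "S \<subseteq> E"
  shows "\<E> (random_subset p E) (\<lambda>A. of_bool (S \<subseteq> A)) = p ^ card S"
proof -
  let ?P = "Pi_pmf E False (\<lambda>_. bernoulli_pmf p)"
  let ?B = "\<lambda>e. if e \<in> S then {True} else UNIV"
  have "\<E> (random_subset p E) (\<lambda>A. of_bool (S \<subseteq> A))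
      = \<E> ?P (\<lambda>keep. indicator (Pi E ?B) keep :: real)"
    unfolding random_subset_def integral_map_pmf
    using S_subset by (intro Bochner_Integration.integral_cong refl) (auto simp: indicator_def Pi_def)
  also have "\<dots> = measure_pmf.prob ?P (Pi E ?B)" by simp
  also have "\<dots> = (\<Prod>e\<in>E. measure_pmf.prob (bernoulli_pmf p) (?B e))"
    by (rule measure_Pi_pmf_Pi[OF finite_E])
  also have "\<dots> = (\<Prod>e\<in>E. if e \<in> S then p else 1)"
    using p_bounds by (intro prod.cong refl) (simp add: measure_pmf_single)
  also have "\<dots> = p ^ card S" using S_subset finite_E by (simp add: prod.If_cases Int_absorb1)
  finally show ?thesis .
qed

lemma expectation_prod_subset_random_subset:
  assumes finite_E: "finite E" and p_bounds: "0 \<le> p" "p \<le> 1" and finite_J: "finite J"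
    and Q_family: "\<And>j. j \<in> J \<Longrightarrow> Q j \<subseteq> E" "disjoint_family_on Q J"
  shows "\<E> (random_subset p E) (\<lambda>A. \<Prod>j\<in>J. of_bool (Q j \<subseteq> A)) = (\<Prod>j\<in>J. p ^ card (Q j))"
proof -
  have "(\<Prod>j\<in>J. of_bool (Q j \<subseteq> A) :: real) = of_bool (\<Union>(Q ` J) \<subseteq> A)" for A
    using finite_J by (induction J) auto
  then have "\<E> (random_subset p E) (\<lambda>A. \<Prod>j\<in>J. of_bool (Q j \<subseteq> A)) = p ^ card (\<Union>(Q ` J))"
    using expectation_subset_random_subset[OF finite_E p_bounds, of "\<Union>(Q ` J)"] Q_family(1)
    by (simp add: UN_subset_iff)
  also have "card (\<Union>(Q ` J)) = (\<Sum>j\<in>J. card (Q j))"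
    using finite_J Q_family finite_E finite_subset[of _ E]
    by (intro card_UN_disjoint) (auto simp: disjoint_family_on_def)
  finally show ?thesis by (simp add: power_sum)
qed

lemma exp_moment_subset_count:
  assumes finite_E: "finite E" and p_bounds: "0 \<le> p" "p \<le> 1" and finite_J: "finite J"
    and Q_family: "\<And>j. j \<in> J \<Longrightarrow> Q j \<subseteq> E" "disjoint_family_on Q J"
    and \<theta>_nonneg: "0 \<le> \<theta>" and rare: "\<And>j. j \<in> J \<Longrightarrow> p ^ card (Q j) \<le> exp (- \<theta>)"
  shows "\<E> (random_subset p E) (\<lambda>A. exp (\<theta> * (\<Sum>j\<in>J. of_bool (Q j \<subseteq> A)))) \<le> exp (card J)"
proof -
  let ?R = "random_subset p E" and ?c = "exp \<theta> - 1"
  have weight_nonneg: "0 \<le> ?c" using \<theta>_nonneg by simp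
  have "exp (\<theta> * (\<Sum>j\<in>J. of_bool (Q j \<subseteq> A)))
      = (\<Sum>J'\<in>Pow J. ?c ^ card J' * (\<Prod>j\<in>J'. of_bool (Q j \<subseteq> A)))" for A
  proof -
    have "exp (\<theta> * (\<Sum>j\<in>J. of_bool (Q j \<subseteq> A))) = (\<Prod>j\<in>J. ?c * of_bool (Q j \<subseteq> A) + 1)"
      unfolding sum_distrib_left exp_sum[OF finite_J] by (intro prod.cong) auto
    then show ?thesis by (simp add: prod_add[OF finite_J] prod.distrib)
  qed
  then have "\<E> ?R (\<lambda>A. exp (\<theta> * (\<Sum>j\<in>J. of_bool (Q j \<subseteq> A))))
      = (\<Sum>J'\<in>Pow J. ?c ^ card J' * \<E> ?R (\<lambda>A. \<Prod>j\<in>J'. of_bool (Q j \<subseteq> A)))"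
    by (simp add: expectation_sum_finite[OF finite_random_subset[OF finite_E]])
  also have "\<dots> = (\<Sum>J'\<in>Pow J. \<Prod>j\<in>J'. ?c * p ^ card (Q j))"
  proof (intro sum.cong refl)
    fix J' assume "J' \<in> Pow J"
    then have "\<E> ?R (\<lambda>A. \<Prod>j\<in>J'. of_bool (Q j \<subseteq> A)) = (\<Prod>j\<in>J'. p ^ card (Q j))"
      using Q_family finite_J finite_subset
      by (intro expectation_prod_subset_random_subset finite_E p_bounds)
        (auto intro: disjoint_family_on_mono)
    then show "?c ^ card J' * \<E> ?R (\<lambda>A. \<Prod>j\<in>J'. of_bool (Q j \<subseteq> A))
        = (\<Prod>j\<in>J'. ?c * p ^ card (Q j))"
      by (simp add: prod.distrib)
  qed
  also have "\<dots> = (\<Prod>j\<in>J. ?c * p ^ card (Q j) + 1)" by (simp add: prod_add[OF finite_J])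
  also have "\<dots> \<le> (\<Prod>j\<in>J. exp 1)"
  proof (intro prod_mono conjI)
    fix j assume "j \<in> J"
    then have "?c * p ^ card (Q j) \<le> exp \<theta> * exp (- \<theta>)"
      using rare weight_nonneg p_bounds by (intro mult_mono) auto
    then show "?c * p ^ card (Q j) + 1 \<le> exp 1"
      using exp_ge_add_one_self[of 1] by (simp add: exp_minus)
    show "0 \<le> ?c * p ^ card (Q j) + 1"
      using weight_nonneg p_bounds by (intro add_nonneg_nonneg mult_nonneg_nonneg) auto
  qed
  finally show ?thesis by (simp add: exp_of_nat_mult[symmetric])
qed

theorem expectation_avg_subset_le:
  assumes finite_E: "finite E" and p_bounds: "0 \<le> p" "p \<le> 1" and J_finite_nonempty: "finite J" "J \<noteq> {}"
    and messages: "finite M" "\<And>A. f A \<in> M"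
    and Q_family: "\<And>\<mu> j. j \<in> J \<Longrightarrow> Q \<mu> j \<subseteq> E" "\<And>\<mu>. disjoint_family_on (Q \<mu>) J"
    and \<theta>_pos: "0 < \<theta>" and rare: "\<And>\<mu> j. j \<in> J \<Longrightarrow> p ^ card (Q \<mu> j) \<le> exp (- \<theta>)"
  shows "\<E> (random_subset p E) (\<lambda>A. avg J (\<lambda>j. of_bool (Q (f A) j \<subseteq> A)))
    \<le> (ln (card M) / card J + 1) / \<theta>"
proof -
  let ?R = "random_subset p E"
  have pos: "0 < card J * \<theta>" using J_finite_nonempty \<theta>_pos by (simp add: card_gt_0_iff)
  have "\<E> ?R (\<lambda>A. \<theta> * (\<Sum>j\<in>J. of_bool (Q (f A) j \<subseteq> A))) \<le> ln (card M) + card J"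
    using \<theta>_pos messages
    by (intro expectation_le_ln_card_plus[where F = "\<lambda>\<mu> A. \<theta> * (\<Sum>j\<in>J. of_bool (Q \<mu> j \<subseteq> A))"]
        finite_random_subset exp_moment_subset_count finite_E p_bounds J_finite_nonempty Q_family rare) auto
  also have "(\<lambda>A. \<theta> * (\<Sum>j\<in>J. of_bool (Q (f A) j \<subseteq> A)))
      = (\<lambda>A. card J * \<theta> * avg J (\<lambda>j. of_bool (Q (f A) j \<subseteq> A)))"
    using J_finite_nonempty by (simp add: avg_def)
  finally have "\<E> ?R (\<lambda>A. avg J (\<lambda>j. of_bool (Q (f A) j \<subseteq> A)))
      \<le> (ln (card M) + card J) / (card J * \<theta>)"
    using pos by (simp only: integral_mult_right_zero pos_le_divide_eq mult.commute)
  also have "\<dots> = (ln (card M) / card J + 1) / \<theta>" using J_finite_nonempty by (simp add: add_divide_distrib)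
  finally show ?thesis .
qed

lemma expectation_partition:
  fixes h :: "'a \<Rightarrow> real"
  assumes finite_p: "finite (set_pmf p)"
  shows "\<E> p h
    = (\<Sum>\<tau>\<in>tr ` set_pmf p. \<E> p (\<lambda>x. of_bool (tr x = \<tau>) * h x))"
proof -
  have "\<E> p h
      = \<E> p (\<lambda>x. \<Sum>\<tau>\<in>tr ` set_pmf p. of_bool (tr x = \<tau>) * h x)"
    using finite_p
    by (intro integral_cong_AE AE_pmfI) (simp_all add: of_bool_def sum_distrib_right[symmetric])
  then show ?thesis by (simp only: expectation_sum_finite[OF finite_p])
qed

text \<open>Given the transcript, the output is a fixed candidate, so the candidate most likely to be good
  given the transcript does at least as well.\<close>

lemma expectation_good_le_best:
  assumes finite_p: "finite (set_pmf p)"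
    and best: "\<And>\<tau> Q. Q \<in> cand \<Longrightarrow>
      \<E> p (\<lambda>x. of_bool (tr x = \<tau> \<and> good Q x))
      \<le> \<E> p (\<lambda>x. of_bool (tr x = \<tau> \<and> good (best \<tau>) x))"
  shows "\<E> p (\<lambda>x. of_bool (out (tr x) \<in> cand \<and> good (out (tr x)) x))
    \<le> \<E> p (\<lambda>x. of_bool (good (best (tr x)) x))"
proof (subst (1 2) expectation_partition[OF finite_p, of _ tr], rule sum_mono)
  fix \<tau>
  have fixed: "of_bool (tr x = \<tau>) * of_bool (P (tr x) x) = (of_bool (tr x = \<tau> \<and> P \<tau> x) :: real)" for P x
    by auto
  show "\<E> p (\<lambda>x. of_bool (tr x = \<tau>) * of_bool (out (tr x) \<in> cand \<and> good (out (tr x)) x))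
      \<le> \<E> p (\<lambda>x. of_bool (tr x = \<tau>) * of_bool (good (best (tr x)) x))"
    unfolding fixed[where P = "\<lambda>\<tau> x. out \<tau> \<in> cand \<and> good (out \<tau>) x"]
      fixed[where P = "\<lambda>\<tau> x. good (best \<tau>) x"]
    using best[of "out \<tau>" \<tau>] by (cases "out \<tau> \<in> cand") (auto intro!: Bochner_Integration.integral_nonneg)
qed

section \<open>The value of a protocol\<close>

definition bit_strings :: "nat \<Rightarrow> bool list set" where
  "bit_strings C = {xs. length xs \<le> C}"

lemma finite_bit_strings: "finite (bit_strings C)"
  using finite_lists_length_le[of "UNIV :: bool set" C] by (simp add: bit_strings_def)

lemma card_bit_strings_pos: "0 < card (bit_strings C)"
proof -
  have "[] \<in> bit_strings C" by (simp add: bit_strings_def)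
  then show ?thesis using finite_bit_strings card_gt_0_iff by blast
qed

lemma card_bit_strings_le: "card (bit_strings C) \<le> 4 ^ C"
proof -
  have "card (bit_strings C) = (\<Sum>i\<le>C. 2 ^ i)"
    using card_lists_length_le[of "UNIV :: bool set" C] by (simp add: bit_strings_def)
  also have "\<dots> \<le> 4 ^ C"
  proof (induction C)
    case (Suc C)
    have "(2 :: nat) ^ C \<le> 4 ^ C" by (intro power_mono) auto
    then show ?case using Suc.IH by simp
  qed simp
  finally show ?thesis .
qed

lemma ln_card_bit_strings_le: "ln (card (bit_strings C)) \<le> C * ln 4"
proof -
  have "real (card (bit_strings C)) \<le> 4 ^ C"
    using card_bit_strings_le[of C] by (metis of_nat_le_iff of_nat_numeral of_nat_power)
  then have "ln (card (bit_strings C)) \<le> ln (4 ^ C)" using card_bit_strings_pos[of C] by simp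
  then show ?thesis by (simp add: ln_realpow)
qed

lemma finite_rs_edges: "finite (rs_edges G)"
  by (simp add: rs_edges_def rs_matching_def)

lemma finite_rs_matching: "finite (rs_matching G j)"
  by (simp add: rs_matching_def)

lemma card_le_rs_r:
  assumes "Q \<subseteq> rs_matching G j"
  shows "card Q \<le> rs_r G"
proof -
  have "card Q \<le> card (rs_matching G j)" by (rule card_mono[OF finite_rs_matching assms])
  also have "\<dots> \<le> rs_r G" unfolding rs_matching_def using card_image_le[of "{..<rs_r G}"] by simp
  finally show ?thesis .
qed

lemma disjoint_rs_matchings:
  assumes "is_rs_graph G"
  shows "disjoint_family_on (rs_matching G) {..<rs_t G}"
  using assms by (simp add: is_rs_graph_def disjoint_family_on_def)

locale bounded_game =
  fixes \<delta> :: real and k :: nat and G1 G2 :: rs_graph and C :: nat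
    and alice1 :: "(nat \<times> nat) set \<Rightarrow> bool list"
    and bob1 :: "game_vertex set set \<Rightarrow> bool list \<Rightarrow> bool list"
    and alice2 :: "(nat \<times> nat) set \<Rightarrow> bool list \<Rightarrow> game_vertex set set \<Rightarrow> bool list"
    and bob2 :: "game_vertex set set \<Rightarrow> bool list \<Rightarrow> bool list \<Rightarrow> game_vertex set set \<Rightarrow>
      nat \<Rightarrow> (nat \<times> nat) set"
  assumes params: "hm_params \<delta> k G1 G2"
    and bounded: "alice1 A \<in> bit_strings C" "bob1 H m \<in> bit_strings C" "alice2 A m E \<in> bit_strings C"
begin

abbreviation "n1 \<equiv> rs_n G1"
abbreviation "r1 \<equiv> rs_r G1"
abbreviation "t1 \<equiv> rs_t G1"
abbreviation "dist_A \<equiv> subsampled_graph \<delta> G1"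
abbreviation "dist_L j \<equiv> D_aug G2 (\<lambda>i. i \<in> fst ` rs_matching G1 j) n1 k"
abbreviation "dist_R j \<equiv> D_aug G2 (\<lambda>i. i \<in> snd ` rs_matching G1 j) n1 k"
abbreviation "dist_free \<equiv> D_free G2 n1 k"
abbreviation "game_input A j KL KR \<equiv> \<lparr> in_A = A, in_j = j, in_L = KL, in_R = KR \<rparr>"

definition bob_message :: "hm_input \<Rightarrow> bool list" where
  "bob_message I = bob1 (graph_B I) (alice1 (in_A I))"

definition messages_after :: "bool list \<Rightarrow> hm_input \<Rightarrow> bool list \<times> bool list \<times> bool list" where
  "messages_after m2 I = (alice1 (in_A I), m2, alice2 (in_A I) m2 (graph_2 I))"

abbreviation messages :: "hm_input \<Rightarrow> bool list \<times> bool list \<times> bool list" where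
  "messages I \<equiv> messages_after (bob_message I) I"

definition answer :: "hm_input \<Rightarrow> bool list \<times> bool list \<times> bool list \<Rightarrow> (nat \<times> nat) set" where
  "answer I \<tau> = (case \<tau> of (m1, m2, m3) \<Rightarrow> bob2 (graph_B I) m1 m3 (graph_2 I) (in_j I))"

definition valid_output :: "hm_input \<Rightarrow> (nat \<times> nat) set" where
  "valid_output I =
     (if answer I (messages I) \<subseteq> in_A I then answer I (messages I) \<inter> rs_matching G1 (in_j I) else {})"

lemma is_rs_G1: "is_rs_graph G1" and t1_pos: "0 < t1" and \<delta>_bounds: "0 < \<delta>" "\<delta> < 1"
  using params by (auto simp: hm_params_def)

sublocale G2: rs_blocks G2 n1 k
proof
  show "is_rs_graph G2" "0 < rs_t G2" "1 \<le> k" using params by (auto simp: hm_params_def)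
  have "real (k * n1) \<le> real (rs_r G2)" using params by (simp add: hm_params_def algebra_simps)
  then show "k * n1 \<le> rs_r G2" by linarith
qed

lemma finite_dist_A: "finite (set_pmf dist_A)"
  unfolding subsampled_graph_eq by (rule finite_random_subset[OF finite_rs_edges])

lemmas finite_dist = finite_dist_A G2.finite_D_aug G2.finite_D_free

lemma indices_finite_nonempty: "finite {..<t1}" "{..<t1} \<noteq> {}"
  using t1_pos by auto

lemma expectation_hm_dist:
  fixes h :: "hm_input \<Rightarrow> real"
  shows "\<E> (hm_dist \<delta> k G1 G2) h
    = \<E> dist_A (\<lambda>A. avg {..<t1} (\<lambda>j. \<E> (dist_L j)
        (\<lambda>KL. \<E> (dist_R j) (\<lambda>KR. h (game_input A j KL KR)))))"
  unfolding hm_dist_def using finite_dist indices_finite_nonempty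
  by (simp add: expectation_bind_finite expectation_pmf_of_set)

lemma expectation_hm_dist_swap:
  fixes h :: "hm_input \<Rightarrow> real"
  shows "\<E> (hm_dist \<delta> k G1 G2) h
    = avg {..<t1} (\<lambda>j. \<E> (dist_L j) (\<lambda>KL. \<E> (dist_R j)
        (\<lambda>KR. \<E> dist_A (\<lambda>A. h (game_input A j KL KR)))))"
  unfolding expectation_hm_dist
  by (simp only: expectation_avg_finite[OF finite_dist_A]
      expectation_swap_finite[OF finite_dist_A G2.finite_D_aug])

end

locale certified_game = bounded_game +
  fixes \<gamma> \<theta> \<epsilon> :: real
  assumes \<gamma>_bounds: "0 < \<gamma>" "\<gamma> \<le> 1" and \<theta>_pos: "0 < \<theta>" and r1_pos: "0 < rs_r G1"
    and moment: "\<And>j. j < rs_t G2 \<Longrightarrow> deficit_moment_le \<theta> \<epsilon> (rs_left G2 j) (rs_n G1) k"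
begin

definition candidates :: "nat \<Rightarrow> (nat \<times> nat) set set" where
  "candidates j = {Q. Q \<subseteq> rs_matching G1 j \<and> \<gamma> * r1 \<le> card Q}"

definition survival ::
  "game_vertex set set \<Rightarrow> bool list \<times> bool list \<times> bool list \<Rightarrow> (nat \<times> nat) set \<Rightarrow> real" where
  "survival E \<tau> Q = (case \<tau> of (m1, m2, m3) \<Rightarrow>
     \<E> dist_A (\<lambda>A. of_bool (alice1 A = m1 \<and> alice2 A m2 E = m3 \<and> Q \<subseteq> A)))"

text \<open>Unlike Bob's output, the best candidate depends on the encoded graphs only through the messages.\<close>

definition best :: "game_vertex set set \<Rightarrow> nat \<Rightarrow> bool list \<times> bool list \<times> bool list \<Rightarrow> (nat \<times> nat) set" where
  "best E j \<tau> = arg_min_on (\<lambda>Q. - survival E \<tau> Q) (candidates j)"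

definition certified_by :: "bool list \<Rightarrow> hm_input \<Rightarrow> real" where
  "certified_by m2 I = of_bool (best (graph_2 I) (in_j I) (messages_after m2 I) \<subseteq> in_A I)"

abbreviation certified :: "hm_input \<Rightarrow> real" where
  "certified I \<equiv> certified_by (bob_message I) I"

definition leakage :: real where
  "leakage = \<epsilon> + C * ln 4 / (\<theta> * rs_t G2)"

definition rarity :: real where
  "rarity = - (\<gamma> * r1 * ln (1 - \<delta>))"

lemma rarity_pos: "0 < rarity"
  unfolding rarity_def using \<gamma>_bounds r1_pos \<delta>_bounds by (simp add: mult_pos_neg)

lemma candidates_finite_nonempty:
  assumes "j < t1"
  shows "finite (candidates j)" "candidates j \<noteq> {}"
proof -
  interpret indexed_matching G1 j using is_rs_G1 assms by unfold_locales
  have "card (rs_matching G1 j) = r1" unfolding rs_matching_def using card_image[OF inj_edge] by simp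
  then have "rs_matching G1 j \<in> candidates j"
    using \<gamma>_bounds by (simp add: candidates_def mult_left_le_one_le)
  then show "candidates j \<noteq> {}" by blast
  show "finite (candidates j)" using finite_rs_matching[of G1 j] by (simp add: candidates_def)
qed

lemma best_mem_candidates: "j < t1 \<Longrightarrow> best E j \<tau> \<in> candidates j"
  unfolding best_def by (rule arg_min_if_finite(1)[OF candidates_finite_nonempty])

lemma survival_le_best:
  assumes "j < t1" "Q \<in> candidates j"
  shows "survival E \<tau> Q \<le> survival E \<tau> (best E j \<tau>)"
  using arg_min_least[OF candidates_finite_nonempty[OF assms(1)] assms(2), of "\<lambda>Q. - survival E \<tau> Q"]
  by (simp add: best_def)

lemma candidate_rare:
  assumes "Q \<in> candidates j"
  shows "(1 - \<delta>) ^ card Q \<le> exp (- rarity)"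
proof -
  have "(1 - \<delta>) ^ card Q = exp (card Q * ln (1 - \<delta>))"
    using \<delta>_bounds by (simp add: exp_of_nat_mult)
  also have "\<dots> \<le> exp (\<gamma> * r1 * ln (1 - \<delta>))"
    using assms \<delta>_bounds by (auto simp: candidates_def intro!: mult_right_mono_neg)
  finally show ?thesis by (simp add: rarity_def)
qed

lemma card_valid_output_le:
  fixes I :: hm_input
  defines "Q \<equiv> answer I (messages I) \<inter> rs_matching G1 (in_j I)"
  shows "real (card (valid_output I)) \<le> real r1 * of_bool (Q \<in> candidates (in_j I) \<and> Q \<subseteq> in_A I) + \<gamma> * r1"
proof (cases "\<gamma> * r1 < card (valid_output I)")
  case True
  have "0 \<le> \<gamma> * r1" using \<gamma>_bounds by simp
  then have "valid_output I \<noteq> {}" using True by auto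
  then have "valid_output I = Q" "Q \<subseteq> in_A I"
    unfolding valid_output_def Q_def by (auto split: if_splits)
  moreover from this True have "Q \<in> candidates (in_j I)" by (simp add: candidates_def Q_def)
  moreover have "card Q \<le> r1" by (rule card_le_rs_r[of _ _ "in_j I"]) (simp add: Q_def)
  ultimately show ?thesis using \<gamma>_bounds by (simp add: add_increasing2)
qed (simp add: add_increasing)

lemma expectation_candidate_le_best:
  assumes j_less: "j < t1"
  shows "\<E> dist_A (\<lambda>A. of_bool (out (messages (game_input A j KL KR)) \<in> candidates j \<and>
      out (messages (game_input A j KL KR)) \<subseteq> A))
    \<le> \<E> dist_A (\<lambda>A. certified (game_input A j KL KR))"
proof -
  define B E where "B = graph_B (game_input {} j KL KR)" and "E = graph_2 (game_input {} j KL KR)"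
  have graphs: "graph_B (game_input A j KL KR) = B" "graph_2 (game_input A j KL KR) = E" for A
    by (simp_all add: B_def E_def graph_B_def graph_2_def)
  have "\<E> dist_A (\<lambda>A. of_bool (out (messages (game_input A j KL KR)) \<in> candidates j \<and>
      out (messages (game_input A j KL KR)) \<subseteq> A))
    \<le> \<E> dist_A (\<lambda>A. of_bool (best E j (messages (game_input A j KL KR)) \<subseteq> A))"
  proof (intro expectation_good_le_best finite_dist_A)
    fix \<tau> :: "bool list \<times> bool list \<times> bool list" and Q assume Q_candidate: "Q \<in> candidates j"
    obtain m1 m2 m3 where \<tau>_eq: "\<tau> = (m1, m2, m3)" by (cases \<tau>)
    show "\<E> dist_A (\<lambda>A. of_bool (messages (game_input A j KL KR) = \<tau> \<and> Q \<subseteq> A))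
        \<le> \<E> dist_A
            (\<lambda>A. of_bool (messages (game_input A j KL KR) = \<tau> \<and> best E j \<tau> \<subseteq> A))"
    proof (cases "m2 = bob1 B m1")
      case True
      then have "messages (game_input A j KL KR) = \<tau> \<and> R \<longleftrightarrow> alice1 A = m1 \<and> alice2 A m2 E = m3 \<and> R" for A R
        by (auto simp: messages_after_def bob_message_def graphs \<tau>_eq)
      then show ?thesis
        using survival_le_best[OF j_less Q_candidate, of E \<tau>] by (simp add: survival_def \<tau>_eq)
    next
      case False
      then have "messages (game_input A j KL KR) \<noteq> \<tau>" for A
        by (auto simp: messages_after_def bob_message_def graphs \<tau>_eq)
      then show ?thesis by simp
    qed
  qed
  then show ?thesis by (simp add: certified_by_def graphs)
qed

lemma expectation_valid_output_le_certified:
  assumes j_less: "j < t1"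
  shows "\<E> dist_A (\<lambda>A. real (card (valid_output (game_input A j KL KR))))
    \<le> r1 * \<E> dist_A (\<lambda>A. certified (game_input A j KL KR)) + \<gamma> * r1"
proof -
  define out where "out \<tau> = answer (game_input {} j KL KR) \<tau> \<inter> rs_matching G1 j" for \<tau>
  let ?out = "\<lambda>A. out (messages (game_input A j KL KR))"
  have "answer (game_input A j KL KR) \<tau> \<inter> rs_matching G1 j = out \<tau>" for A \<tau>
    by (simp add: out_def answer_def graph_B_def graph_2_def)
  then have "real (card (valid_output (game_input A j KL KR)))
      \<le> real r1 * of_bool (?out A \<in> candidates j \<and> ?out A \<subseteq> A) + \<gamma> * r1" for A
    using card_valid_output_le[of "game_input A j KL KR"] by (simp only: hm_input.simps)
  then have "\<E> dist_A (\<lambda>A. real (card (valid_output (game_input A j KL KR))))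
      \<le> \<E> dist_A (\<lambda>A. real r1 * of_bool (?out A \<in> candidates j \<and> ?out A \<subseteq> A) + \<gamma> * r1)"
    by (intro expectation_mono_finite finite_dist_A)
  also have "\<dots> = r1 * \<E> dist_A (\<lambda>A. of_bool (?out A \<in> candidates j \<and> ?out A \<subseteq> A)) + \<gamma> * r1"
    by (rule expectation_affine_finite[OF finite_dist_A])
  also have "\<dots> \<le> r1 * \<E> dist_A (\<lambda>A. certified (game_input A j KL KR)) + \<gamma> * r1"
    by (intro add_right_mono mult_left_mono expectation_candidate_le_best[OF j_less]) simp
  finally show ?thesis .
qed

lemma expectation_certified_D_aug_le:
  fixes I :: "aug_graph \<Rightarrow> hm_input"
  assumes public: "\<And>K K'. in_A (I K) = in_A (I K')" "\<And>K K'. in_j (I K) = in_j (I K')"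
    and graph_B: "\<And>K K'. ag_enc K = ag_enc K' \<Longrightarrow> graph_B (I K) = graph_B (I K')"
    and graph_2: "\<And>K K'. ag_rest K = ag_rest K' \<Longrightarrow> ag_targets K = ag_targets K' \<Longrightarrow>
        graph_2 (I K) = graph_2 (I K')"
  shows "\<E> (D_aug G2 Y n1 k) (\<lambda>K. certified (I K))
    \<le> \<E> dist_free (\<lambda>K. certified (I K)) + leakage"
proof -
  define g where "g \<mu> E T = certified_by \<mu> (I \<lparr> ag_enc = {}, ag_rest = E, ag_targets = T \<rparr>)" for \<mu> E T
  define f where "f H = bob_message (I \<lparr> ag_enc = H, ag_rest = {}, ag_targets = [] \<rparr>)" for H
  have split: "certified (I K) = g (f (ag_enc K)) (ag_rest K) (ag_targets K)" for K
  proof -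
    define K_rest where "K_rest = \<lparr> ag_enc = {}, ag_rest = ag_rest K, ag_targets = ag_targets K \<rparr>"
    define K_enc where "K_enc = \<lparr> ag_enc = ag_enc K, ag_rest = {}, ag_targets = [] \<rparr>"
    have "graph_2 (I K) = graph_2 (I K_rest)" by (rule graph_2) (simp_all add: K_rest_def)
    then have "certified_by \<mu> (I K) = certified_by \<mu> (I K_rest)" for \<mu>
      by (simp only: certified_by_def messages_after_def public[of K K_rest])
    moreover have "graph_B (I K) = graph_B (I K_enc)" by (rule graph_B) (simp add: K_enc_def)
    then have "bob_message (I K) = bob_message (I K_enc)"
      by (simp only: bob_message_def public[of K K_enc])
    ultimately show ?thesis by (simp add: g_def f_def K_rest_def K_enc_def)
  qed
  have "\<E> (D_aug G2 Y n1 k) (\<lambda>K. certified (I K))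
      \<le> \<E> dist_free (\<lambda>K. certified (I K)) + \<epsilon> + ln (card (bit_strings C)) / (\<theta> * rs_t G2)"
    unfolding split
  proof (rule G2.expectation_D_aug_le_D_free[OF _ finite_bit_strings _ \<theta>_pos moment])
    show "0 \<le> g \<mu> E T \<and> g \<mu> E T \<le> 1" for \<mu> E T by (simp add: g_def certified_by_def)
    show "f H \<in> bit_strings C" for H using bounded by (simp add: f_def bob_message_def)
  qed
  moreover have "ln (card (bit_strings C)) / (\<theta> * rs_t G2) \<le> C * ln 4 / (\<theta> * rs_t G2)"
    using ln_card_bit_strings_le \<theta>_pos by (intro divide_right_mono) auto
  ultimately show ?thesis by (simp add: leakage_def)
qed

lemma expectation_certified_le_free:
  "\<E> (dist_L j) (\<lambda>KL. \<E> (dist_R j) (\<lambda>KR. certified (game_input A j KL KR)))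
    \<le> \<E> dist_free (\<lambda>KL. \<E> dist_free (\<lambda>KR. certified (game_input A j KL KR)))
      + 2 * leakage"
proof -
  note shift = expectation_affine_finite[where a = 1, simplified]
  have "\<E> (dist_L j) (\<lambda>KL. \<E> (dist_R j) (\<lambda>KR. certified (game_input A j KL KR)))
      \<le> \<E> (dist_L j)
          (\<lambda>KL. \<E> dist_free (\<lambda>KR. certified (game_input A j KL KR)) + leakage)"
    by (intro expectation_mono_finite finite_dist expectation_certified_D_aug_le)
      (simp_all add: graph_B_def graph_2_def)
  also have "\<dots> = \<E> dist_free
      (\<lambda>KR. \<E> (dist_L j) (\<lambda>KL. certified (game_input A j KL KR))) + leakage"
    by (simp only: shift[OF finite_dist(2)] expectation_swap_finite[OF finite_dist(2,3)])
  also have "\<dots> \<le> \<E> dist_free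
      (\<lambda>KR. \<E> dist_free (\<lambda>KL. certified (game_input A j KL KR)) + leakage) + leakage"
    by (intro add_right_mono expectation_mono_finite finite_dist expectation_certified_D_aug_le)
      (simp_all add: graph_B_def graph_2_def)
  also have "\<dots> = \<E> dist_free
      (\<lambda>KL. \<E> dist_free (\<lambda>KR. certified (game_input A j KL KR))) + 2 * leakage"
    by (subst shift[OF finite_dist(3)], subst expectation_swap_finite[OF finite_dist(3,3)]) simp
  finally show ?thesis .
qed

lemma expectation_certified_fixed_graphs:
  "\<E> dist_A (\<lambda>A. avg {..<t1} (\<lambda>j. certified (game_input A j KL KR)))
    \<le> (3 * real C * ln 4 / t1 + 1) / rarity"
proof -
  define E where "E = graph_2 (game_input {} 0 KL KR)"
  define transcript where "transcript A = messages (game_input A 0 KL KR)" for A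
  let ?S = "bit_strings C" and ?M = "bit_strings C \<times> bit_strings C \<times> bit_strings C"
  have best: "best E j \<tau> \<subseteq> rs_matching G1 j" if "j < t1" for j \<tau>
    using best_mem_candidates[OF that] by (auto simp: candidates_def)
  have "certified (game_input A j KL KR) = of_bool (best E j (transcript A) \<subseteq> A)" for A j
    by (simp add: certified_by_def bob_message_def transcript_def messages_after_def E_def
        graph_B_def graph_2_def)
  then have "\<E> dist_A (\<lambda>A. avg {..<t1} (\<lambda>j. certified (game_input A j KL KR)))
      = \<E> (random_subset (1 - \<delta>) (rs_edges G1))
          (\<lambda>A. avg {..<t1} (\<lambda>j. of_bool (best E j (transcript A) \<subseteq> A)))"
    by (simp add: subsampled_graph_eq)
  also have "\<dots> \<le> (ln (card ?M) / card {..<t1} + 1) / rarity"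
  proof (rule expectation_avg_subset_le[where Q = "\<lambda>\<tau> j. best E j \<tau>"])
    show "transcript A \<in> ?M" for A
      using bounded by (simp add: transcript_def messages_after_def bob_message_def)
    show "disjoint_family_on (\<lambda>j. best E j \<tau>) {..<t1}" for \<tau>
      using disjoint_rs_matchings[OF is_rs_G1] best unfolding disjoint_family_on_def
      by (metis Int_mono lessThan_iff subset_empty)
    show "best E j \<tau> \<subseteq> rs_edges G1" if "j \<in> {..<t1}" for j \<tau>
      using best[of j \<tau>] that by (auto simp: rs_edges_def)
    show "(1 - \<delta>) ^ card (best E j \<tau>) \<le> exp (- rarity)" if "j \<in> {..<t1}" for j \<tau>
      using candidate_rare[OF best_mem_candidates[of j E \<tau>]] that by simp
  qed (use finite_rs_edges finite_bit_strings indices_finite_nonempty \<delta>_bounds rarity_pos in auto)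
  also have "\<dots> \<le> (3 * real C * ln 4 / t1 + 1) / rarity"
  proof -
    have "ln (card ?M) = 3 * ln (card ?S)"
      using card_bit_strings_pos[of C] by (simp add: card_cartesian_product ln_mult)
    then have "ln (card ?M) \<le> 3 * real C * ln 4" using ln_card_bit_strings_le[of C] by simp
    then show ?thesis
      using rarity_pos by (intro divide_right_mono add_right_mono) (auto intro: divide_right_mono)
  qed
  finally show ?thesis .
qed

lemma expectation_valid_output_le_expectation_certified:
  "\<E> (hm_dist \<delta> k G1 G2) (\<lambda>I. real (card (valid_output I)))
    \<le> r1 * \<E> (hm_dist \<delta> k G1 G2) certified + \<gamma> * r1"
proof -
  have "\<E> (hm_dist \<delta> k G1 G2) (\<lambda>I. real (card (valid_output I)))
      \<le> avg {..<t1} (\<lambda>j. \<E> (dist_L j) (\<lambda>KL. \<E> (dist_R j)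
          (\<lambda>KR. r1 * \<E> dist_A (\<lambda>A. certified (game_input A j KL KR)) + \<gamma> * r1)))"
    unfolding expectation_hm_dist_swap
    by (intro avg_mono expectation_mono_finite finite_dist expectation_valid_output_le_certified) simp
  also have "\<dots> = r1 * \<E> (hm_dist \<delta> k G1 G2) certified + \<gamma> * r1"
    unfolding expectation_hm_dist_swap
    by (simp only: expectation_affine_finite[OF G2.finite_D_aug] avg_add avg_cmult
        avg_const[OF indices_finite_nonempty])
  finally show ?thesis .
qed

lemma expectation_certified_le:
  "\<E> (hm_dist \<delta> k G1 G2) certified \<le> 2 * leakage + (3 * real C * ln 4 / t1 + 1) / rarity"
proof -
  let ?free = "\<lambda>h. \<E> dist_free (\<lambda>KL. \<E> dist_free (\<lambda>KR. h KL KR))"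
  note shift = expectation_affine_finite[where a = 1, simplified]
  have "\<E> (hm_dist \<delta> k G1 G2) certified
      \<le> \<E> dist_A
          (\<lambda>A. avg {..<t1} (\<lambda>j. ?free (\<lambda>KL KR. certified (game_input A j KL KR)) + 2 * leakage))"
    unfolding expectation_hm_dist
    by (intro expectation_mono_finite finite_dist avg_mono expectation_certified_le_free)
  also have "\<dots> = ?free (\<lambda>KL KR. \<E> dist_A
      (\<lambda>A. avg {..<t1} (\<lambda>j. certified (game_input A j KL KR)))) + 2 * leakage"
    by (simp only: avg_add avg_const[OF indices_finite_nonempty] shift[OF finite_dist_A]
        expectation_avg_finite[OF finite_dist(3), symmetric] expectation_swap_finite[OF finite_dist(1,3)])
  also have "\<dots> \<le> ?free (\<lambda>KL KR. (3 * real C * ln 4 / t1 + 1) / rarity) + 2 * leakage"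
    by (intro add_right_mono expectation_mono_finite finite_dist expectation_certified_fixed_graphs)
  finally show ?thesis by simp
qed

theorem expectation_valid_output_le:
  "\<E> (hm_dist \<delta> k G1 G2) (\<lambda>I. real (card (valid_output I)))
    \<le> r1 * (\<gamma> + 2 * leakage + (3 * real C * ln 4 / t1 + 1) / rarity)"
proof -
  have "r1 * \<E> (hm_dist \<delta> k G1 G2) certified
      \<le> r1 * (2 * leakage + (3 * real C * ln 4 / t1 + 1) / rarity)"
    by (intro mult_left_mono expectation_certified_le) simp
  then show ?thesis using expectation_valid_output_le_expectation_certified by (simp add: algebra_simps)
qed

end

lemma expectation_pair_pmf_le:
  fixes f :: "'a \<times> 'b \<Rightarrow> real"
  assumes f_bounds: "\<And>z. 0 \<le> f z" "\<And>z. f z \<le> K"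
    and section_le: "\<And>x. x \<in> set_pmf p \<Longrightarrow> \<E> q (\<lambda>y. f (x, y)) \<le> B"
  shows "\<E> (pair_pmf p q) f \<le> B"
proof -
  have section_integrable: "integrable q (\<lambda>y. f (x, y))" for x
    using f_bounds by (intro measure_pmf.integrable_const_bound[where B = K]) auto
  obtain x where "x \<in> set_pmf p" using set_pmf_not_empty[of p] by blast
  then have "0 \<le> B"
    using section_le[of x] f_bounds(1) by (meson Bochner_Integration.integral_nonneg order_trans)
  have "ennreal (\<E> (pair_pmf p q) f) = (\<integral>\<^sup>+z. ennreal (f z) \<partial>pair_pmf p q)"
    using f_bounds
    by (intro nn_integral_eq_integral[symmetric] measure_pmf.integrable_const_bound[where B = K]) auto
  also have "\<dots> = (\<integral>\<^sup>+x. \<integral>\<^sup>+y. ennreal (f (x, y)) \<partial>q \<partial>p)" by (rule nn_integral_pair_pmf')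
  also have "\<dots> = (\<integral>\<^sup>+x. ennreal (\<E> q (\<lambda>y. f (x, y))) \<partial>p)"
    using section_integrable f_bounds(1) by (intro nn_integral_cong nn_integral_eq_integral) auto
  also have "\<dots> \<le> (\<integral>\<^sup>+x. ennreal B \<partial>p)" by (intro nn_integral_mono_AE AE_pmfI ennreal_leI section_le)
  finally show ?thesis using \<open>0 \<le> B\<close> by simp
qed

theorem hm_val_le:
  fixes \<pi> :: "('p, 'a, 'b) protocol" and \<gamma> \<theta> \<epsilon> :: real
  assumes params: "hm_params \<delta> k G1 G2" and cost: "comm_cost \<delta> k G1 G2 \<pi> = enat C"
    and \<gamma>_bounds: "0 < \<gamma>" "\<gamma> \<le> 1" and \<theta>_pos: "0 < \<theta>" and r1_pos: "0 < rs_r G1"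
    and moment: "\<And>j. j < rs_t G2 \<Longrightarrow> deficit_moment_le \<theta> \<epsilon> (rs_left G2 j) (rs_n G1) k"
  shows "hm_val \<delta> k G1 G2 \<pi> \<le> rs_r G1 * (\<gamma> + 2 * (\<epsilon> + C * ln 4 / (\<theta> * rs_t G2))
    + (3 * real C * ln 4 / rs_t G1 + 1) / - (\<gamma> * rs_r G1 * ln (1 - \<delta>)))" (is "_ \<le> ?B")
  unfolding hm_val_def
proof (rule expectation_pair_pmf_le)
  show "0 \<le> (case z of (s, I) \<Rightarrow> real (card (hm_out G1 \<pi> s I)))" for z by (simp split: prod.split)
  have "card (hm_out G1 \<pi> s I) \<le> rs_r G1" for s I
    by (rule card_le_rs_r[of _ _ "in_j I"]) (simp add: hm_out_def)
  then show "(case z of (s, I) \<Rightarrow> real (card (hm_out G1 \<pi> s I))) \<le> rs_r G1" for z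
    by (simp split: prod.split)
  fix s assume s_support: "s \<in> set_pmf (seeds \<pi>)"
  obtain p a b where seeds: "s = (p, a, b)" by (cases s)
  \<comment> \<open>The cost bounds messages only on the support of the inputs; \<open>D_free\<close> leaves it, hence the truncation.\<close>
  interpret certified_game \<delta> k G1 G2 C "\<lambda>A. take C (p_alice1 \<pi> p a A)"
    "\<lambda>H m. take C (p_bob1 \<pi> p b H m)" "\<lambda>A m E. take C (p_alice2 \<pi> p a A m E)" "p_bob2 \<pi> p b" \<gamma> \<theta> \<epsilon>
    using params \<gamma>_bounds \<theta>_pos r1_pos moment by unfold_locales (auto simp: bit_strings_def)
  have "hm_out G1 \<pi> s I = valid_output I" if I_support: "I \<in> set_pmf (hm_dist \<delta> k G1 G2)" for I
  proof -
    have "enat (bits (transcript \<pi> s I)) \<le> comm_cost \<delta> k G1 G2 \<pi>"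
      unfolding comm_cost_def using s_support I_support by (intro SUP_upper2[of "(s, I)"]) auto
    then have "bits (transcript \<pi> s I) \<le> C" unfolding cost by simp
    then show ?thesis
      by (simp add: bits_def transcript_def hm_out_def bob_output_def valid_output_def answer_def
          messages_after_def bob_message_def seeds Let_def)
  qed
  then have "\<E> (hm_dist \<delta> k G1 G2) (\<lambda>I. case (s, I) of (s, I) \<Rightarrow> real (card (hm_out G1 \<pi> s I)))
      = \<E> (hm_dist \<delta> k G1 G2) (\<lambda>I. real (card (valid_output I)))"
    by (intro integral_cong_AE AE_pmfI) auto
  also have "\<dots> \<le> ?B" using expectation_valid_output_le unfolding leakage_def rarity_def .
  finally show "\<E> (hm_dist \<delta> k G1 G2)
      (\<lambda>I. case (s, I) of (s, I) \<Rightarrow> real (card (hm_out G1 \<pi> s I))) \<le> ?B" .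
qed

lemma rs_r_le_rs_n:
  assumes "is_rs_graph G" "0 < rs_t G"
  shows "rs_r G \<le> rs_n G"
proof -
  interpret indexed_matching G 0 using assms by unfold_locales
  have "rs_left G 0 \<subseteq> {..<rs_n G}"
    using assms unfolding is_rs_graph_def rs_edges_def by fastforce
  then show ?thesis using card_mono[of "{..<rs_n G}" "rs_left G 0"] card_rs_left by simp
qed

lemma hm_params_rs_r_le:
  assumes "hm_params \<delta> k G1 G2"
  shows "rs_r G1 \<le> rs_r G2"
proof -
  have "rs_r G1 \<le> rs_n G1" using assms by (intro rs_r_le_rs_n) (auto simp: hm_params_def)
  moreover have "1 * real (rs_n G1) \<le> (real k + \<delta>) * real (rs_n G1)"
    using assms by (intro mult_right_mono) (auto simp: hm_params_def)
  then have "real (rs_n G1) \<le> real (rs_r G2)" using assms by (simp only: hm_params_def mult_1)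
  ultimately show ?thesis by linarith
qed

lemma mult_le_mult_of_le:
  fixes a b c x y :: real
  assumes "x \<le> a * y" "0 \<le> b" "a * b \<le> c" "0 \<le> y"
  shows "x * b \<le> c * y"
proof -
  have "x * b \<le> a * y * b" using assms(1,2) by (rule mult_right_mono)
  also have "\<dots> = (a * b) * y" by simp
  also have "\<dots> \<le> c * y" using assms(3,4) by (rule mult_right_mono)
  finally show ?thesis .
qed

lemma hm_val_le_mult_rs_r:
  fixes \<gamma> \<theta> c :: real
  assumes params: "hm_params \<delta> k G1 G2" and cost: "comm_cost \<delta> k G1 G2 \<pi> = enat C"
    and \<gamma>_bounds: "0 < \<gamma>" "\<gamma> \<le> 1" "\<gamma> \<le> c / 4" and \<theta>_pos: "0 < \<theta>" and r1_pos: "0 < rs_r G1"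
    and moment: "\<And>j. j < rs_t G2 \<Longrightarrow> deficit_moment_le \<theta> (c / 16) (rs_left G2 j) (rs_n G1) k"
    and leak: "C * ln 4 \<le> c / 16 * (\<theta> * rs_t G2)"
    and rare: "3 * real C * ln 4 / rs_t G1 + 1 \<le> c / 2 * - (\<gamma> * rs_r G1 * ln (1 - \<delta>))"
  shows "hm_val \<delta> k G1 G2 \<pi> \<le> c * rs_r G1"
proof -
  have "0 < \<delta>" "\<delta> < 1" "0 < rs_t G2" using params by (auto simp: hm_params_def)
  then have pos: "0 < \<theta> * rs_t G2" "0 < - (\<gamma> * rs_r G1 * ln (1 - \<delta>))"
    using \<theta>_pos \<gamma>_bounds r1_pos by (auto simp: mult_pos_neg)
  have "hm_val \<delta> k G1 G2 \<pi> \<le> rs_r G1 * (\<gamma> + 2 * (c / 16 + C * ln 4 / (\<theta> * rs_t G2))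
      + (3 * real C * ln 4 / rs_t G1 + 1) / - (\<gamma> * rs_r G1 * ln (1 - \<delta>)))"
    by (rule hm_val_le[OF params cost \<gamma>_bounds(1,2) \<theta>_pos r1_pos moment])
  also have "\<dots> \<le> rs_r G1 * (c / 4 + 2 * (c / 16 + c / 16) + c / 2)"
    using leak rare
    unfolding pos_divide_le_eq[OF pos(1), symmetric] pos_divide_le_eq[OF pos(2), symmetric]
    by (intro mult_left_mono add_mono order.refl \<gamma>_bounds) auto
  finally show ?thesis by (simp add: mult.commute)
qed

theorem hm_val_le_of_small_cost:
  fixes \<delta> c :: real
  assumes \<delta>_bounds: "0 < \<delta>" "\<delta> < 1" and c_pos: "0 < c"
  obtains a :: real and R :: nat where "0 < a"
    and "\<And>k G1 G2 (\<pi> :: ('p, 'a, 'b) protocol) C. hm_params \<delta> k G1 G2 \<Longrightarrow> comm_cost \<delta> k G1 G2 \<pi> = enat C \<Longrightarrow>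
      R \<le> rs_r G1 \<Longrightarrow> real C \<le> a * (real (rs_t G2) * real (rs_r G2) powr (1 - 2 / real k)) \<Longrightarrow>
      real C \<le> a * (real (rs_t G1) * real (rs_r G1)) \<Longrightarrow> hm_val \<delta> k G1 G2 \<pi> \<le> c * rs_r G1"
proof -
  define \<gamma> where "\<gamma> = min 1 (c / 4)"
  define \<beta> where "\<beta> = - (\<gamma> * ln (1 - \<delta>))"
  have \<gamma>_bounds: "0 < \<gamma>" "\<gamma> \<le> 1" "\<gamma> \<le> c / 4" using c_pos by (auto simp: \<gamma>_def)
  have \<beta>_pos: "0 < \<beta>" using \<gamma>_bounds \<delta>_bounds by (simp add: \<beta>_def mult_pos_neg)
  have "0 < c / 16" using c_pos by simp
  then obtain a\<^sub>0 :: real and R\<^sub>0 :: nat where a\<^sub>0_pos: "0 < a\<^sub>0"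
    and moment: "\<And>k l (I :: nat set). 2 \<le> k \<Longrightarrow>
        real (card I) = (real k + \<delta>) * real l \<Longrightarrow> R\<^sub>0 \<le> card I \<Longrightarrow>
        deficit_moment_le (a\<^sub>0 * real (card I) powr (1 - 2 / real k)) (c / 16) I l k"
    using deficit_moment_le_uniform[OF \<delta>_bounds(1), where 'a = nat] by blast
  define a where "a = min (c / 16 * a\<^sub>0) (c / 12 * \<beta>) / ln 4"
  have a_bounds: "0 < a" "a * ln 4 \<le> c / 16 * a\<^sub>0" "a * ln 4 \<le> c / 12 * \<beta>"
    using a\<^sub>0_pos \<beta>_pos c_pos by (auto simp: a_def)
  show thesis
  proof (rule that[OF a_bounds(1)])
    fix k :: nat and G1 G2 :: rs_graph and \<pi> :: "('p, 'a, 'b) protocol" and C :: nat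
    assume params: "hm_params \<delta> k G1 G2" and cost: "comm_cost \<delta> k G1 G2 \<pi> = enat C"
      and r1_large: "max (Suc R\<^sub>0) (nat \<lceil>4 / (c * \<beta>)\<rceil>) \<le> rs_r G1"
      and cost_2: "real C \<le> a * (real (rs_t G2) * real (rs_r G2) powr (1 - 2 / real k))"
      and cost_1: "real C \<le> a * (real (rs_t G1) * real (rs_r G1))"
    have r1_bounds: "0 < rs_r G1" "4 / (c * \<beta>) \<le> rs_r G1" and r2_bounds: "R\<^sub>0 \<le> rs_r G2" "0 < rs_r G2"
      using r1_large hm_params_rs_r_le[OF params] by linarith+
    define \<theta> where "\<theta> = a\<^sub>0 * real (rs_r G2) powr (1 - 2 / real k)"
    show "hm_val \<delta> k G1 G2 \<pi> \<le> c * rs_r G1"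
    proof (rule hm_val_le_mult_rs_r[OF params cost \<gamma>_bounds _ r1_bounds(1)])
      show "0 < \<theta>" using a\<^sub>0_pos r2_bounds by (simp add: \<theta>_def)
      show "deficit_moment_le \<theta> (c / 16) (rs_left G2 j) (rs_n G1) k" if "j < rs_t G2" for j
      proof -
        interpret indexed_matching G2 j using params that by unfold_locales (simp add: hm_params_def)
        show ?thesis
          using moment[of k "rs_left G2 j" "rs_n G1"] params r2_bounds(1) card_rs_left
          by (simp add: hm_params_def \<theta>_def)
      qed
      show "C * ln 4 \<le> c / 16 * (\<theta> * rs_t G2)"
        using mult_le_mult_of_le[OF cost_2 _ a_bounds(2)] by (simp add: \<theta>_def ac_simps)
      have "C * ln 4 \<le> c / 12 * \<beta> * (real (rs_t G1) * real (rs_r G1))"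
        using mult_le_mult_of_le[OF cost_1 _ a_bounds(3)] by simp
      then have "3 * real C * ln 4 / rs_t G1 \<le> c / 4 * (\<beta> * rs_r G1)"
        using params by (simp add: hm_params_def pos_divide_le_eq ac_simps)
      moreover have "1 \<le> c / 4 * (\<beta> * rs_r G1)"
        using r1_bounds(2) c_pos \<beta>_pos by (simp add: pos_divide_le_eq ac_simps)
      ultimately show "3 * real C * ln 4 / rs_t G1 + 1 \<le> c / 2 * - (\<gamma> * rs_r G1 * ln (1 - \<delta>))"
        by (simp add: \<beta>_def algebra_simps)
    qed
  qed
qed

theorem theorem4p1:
  fixes \<delta> :: real
    and k :: "nat \<Rightarrow> nat"
    and G1 G2 :: "nat \<Rightarrow> rs_graph"
    and \<pi> :: "nat \<Rightarrow> ('p, 'a, 'b) protocol"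
    and C :: "nat \<Rightarrow> nat"
  assumes params: "\<And>m. hm_params \<delta> (k m) (G1 m) (G2 m)"
    and r1_limit: "filterlim (\<lambda>m. rs_r (G1 m)) at_top sequentially"
    and cost: "\<And>m. comm_cost \<delta> (k m) (G1 m) (G2 m) (\<pi> m) = enat (C m)"
    and cost_small_2: "(\<lambda>m. real (C m)) \<in>
      o(\<lambda>m. real (rs_t (G2 m)) * real (rs_r (G2 m)) powr (1 - 2 / real (k m)))"
    and cost_small_1: "(\<lambda>m. real (C m)) \<in> o(\<lambda>m. real (rs_t (G1 m)) * real (rs_r (G1 m)))"
  shows "(\<lambda>m. hm_val \<delta> (k m) (G1 m) (G2 m) (\<pi> m)) \<in> o(\<lambda>m. real (rs_r (G1 m)))"
proof (rule landau_o.smallI)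
  fix c :: real assume "0 < c"
  have "0 < \<delta>" "\<delta> < 1" using params[of 0] by (auto simp: hm_params_def)
  then obtain a :: real and R where "0 < a" and val_le: "\<And>k G1 G2 (\<pi> :: ('p, 'a, 'b) protocol) C.
      hm_params \<delta> k G1 G2 \<Longrightarrow> comm_cost \<delta> k G1 G2 \<pi> = enat C \<Longrightarrow> R \<le> rs_r G1 \<Longrightarrow>
      real C \<le> a * (real (rs_t G2) * real (rs_r G2) powr (1 - 2 / real k)) \<Longrightarrow>
      real C \<le> a * (real (rs_t G1) * real (rs_r G1)) \<Longrightarrow> hm_val \<delta> k G1 G2 \<pi> \<le> c * rs_r G1"
    using hm_val_le_of_small_cost[OF _ _ \<open>0 < c\<close>, where 'p = 'p and 'a = 'a and 'b = 'b] by blast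
  have "\<forall>\<^sub>F m in sequentially. R \<le> rs_r (G1 m)" using r1_limit by (simp add: filterlim_at_top)
  with landau_o.smallD[OF cost_small_2 \<open>0 < a\<close>] landau_o.smallD[OF cost_small_1 \<open>0 < a\<close>]
  show "\<forall>\<^sub>F m in sequentially. norm (hm_val \<delta> (k m) (G1 m) (G2 m) (\<pi> m)) \<le> c * norm (real (rs_r (G1 m)))"
  proof eventually_elim
    case (elim m)
    have "hm_val \<delta> (k m) (G1 m) (G2 m) (\<pi> m) \<le> c * rs_r (G1 m)"
      using elim by (intro val_le[OF params cost])
        (simp_all only: real_norm_def abs_of_nat abs_of_nonneg[OF powr_ge_zero] abs_mult)
    moreover have "0 \<le> hm_val \<delta> (k m) (G1 m) (G2 m) (\<pi> m)"
      unfolding hm_val_def by (intro Bochner_Integration.integral_nonneg) auto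
    ultimately show ?case by simp
  qed
qed

end
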